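(* Let $H(K)$ be a reproducing kernel Hilbert space of complex-valued functions on a subset $D\subset\mathbb{R}^d$ with a positive definite Hermitian kernel $K(\cdot,\cdot)$, and let $\varrho_D$ be a measure on $D$ such that the finite trace property $\operatorname{tr}(K)=\int_D K(\mathbf{x},\mathbf{x})\,d\varrho_D(\mathbf{x})<\infty$ holds. Let $r>1$ and $m,n\in\mathbb{N}$, $n\ge3$, where $m:=\big\lfloor \frac{n}{14\,r\log n}\big\rfloor$. Draw $\mathbf{X}=(\mathbf{x}^1,\dots,\mathbf{x}^n)$ at random according to the product measure $(\varrho_m(\mathbf{x})\,d\varrho_D(\mathbf{x}))^n$ with the density $$\varrho_m(\mathbf{x})=\frac13\bigg(\frac{\sum_{j=1}^{m-1}|\eta_j(\mathbf{x})|^2}{m-1}+\frac{\sum_{j=m}^{\infty}|e_j(\mathbf{x})|^2}{\sum_{j=m}^\infty\lambda_j}+\frac{K^0(\mathbf{x},\mathbf{x})}{\operatorname{tr}_0(K)}\bigg).$$ Then $$\sup_{\|f\|_{H(K)}\le1}\big\|f-\widetilde S^m_{\mathbf{X}}f\big\|^2_{L_2(D,\varrho_D)}\le 441\,\max\Big\{\sigma_m^2,\ \frac{r\log n}{n}\sum_{j=m}^\infty\sigma_j^2,\ \frac{\operatorname{tr}_0(K)}{n}\Big\}$$ with probability at least $1-\eta\, n^{1-r}$, where $\eta=2^{3/4}+1$ and $\widetilde S^m_{\mathbf{X}}$ is the weighted least squares operator built with this density $\varrho_m$.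
   Context: $H(K)$ is not assumed separable; it is assumed infinite-dimensional. $L_2(D,\varrho_D)$ is the space of complex-valued square-integrable functions; $\log$ is the natural logarithm. The finite trace condition implies that the embedding $\mathrm{Id}:H(K)\to L_2(D,\varrho_D)$ is Hilbert–Schmidt (it need not be injective). The (at most) countable system of strictly positive eigenvalues of $\mathrm{Id}^*\circ\mathrm{Id}:H(K)\to H(K)$, arranged in non-increasing order, is denoted by $\lambda_1\ge\lambda_2\ge\cdots>0$. Put $\sigma_j:=\sqrt{\lambda_j}$ (the singular numbers of $\mathrm{Id}$). Let $(e_j)_j\subset H(K)$ be the corresponding system of eigenvectors, orthonormal in $H(K)$, and $\eta_j:=\sigma_j^{-1}e_j$ (defined pointwise on $D$), which is an orthonormal system in $L_2(D,\varrho_D)$. Put $K^1(\mathbf{x},\mathbf{y}):=\sum_{k=1}^\infty e_k(\mathbf{x})\overline{e_k(\mathbf{y})}$, $K^0(\mathbf{x},\mathbf{y}):=K(\mathbf{x},\mathbf{y})-K^1(\mathbf{x},\mathbf{y})$, and $$\operatorname{tr}_0(K):=\int_D K^0(\mathbf{x},\mathbf{x})\,d\varrho_D(\mathbf{x})=\int_D K(\mathbf{x},\mathbf{x})\,d\varrho_D(\mathbf{x})-\sum_{k=1}^\infty\lambda_k\ \ge 0.$$ Weighted least squares operator $\widetilde S^m_{\mathbf{X}}$ for a density $\varrho_m$ and nodes $\mathbf{X}=(\mathbf{x}^1,\dots,\mathbf{x}^n)\in D^n$: given $f$, put $g_j:=f(\mathbf{x}^j)/\sqrt{\varrho_m(\mathbf{x}^j)}$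 if $\varrho_m(\mathbf{x}^j)\ne0$ and $g_j:=0$ otherwise, $\mathbf{g}=(g_j)_{j=1}^n$; let $\widetilde{\mathbf{L}}_m=(l_{j,k})\in\mathbb{C}^{n\times(m-1)}$ with $l_{j,k}:=\eta_k(\mathbf{x}^j)/\sqrt{\varrho_m(\mathbf{x}^j)}$ if $\varrho_m(\mathbf{x}^j)\neq0$ and $l_{j,k}:=0$ otherwise. When $\widetilde{\mathbf{L}}_m$ has full column rank, put $(\tilde c_1,\dots,\tilde c_{m-1})^\top:=(\widetilde{\mathbf{L}}_m^*\widetilde{\mathbf{L}}_m)^{-1}\widetilde{\mathbf{L}}_m^*\mathbf{g}$ and $\widetilde S^m_{\mathbf{X}}f:=\sum_{k=1}^{m-1}\tilde c_k\eta_k$.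
   Formalization: K is assumed jointly measurable on D×D (otherwise the probability can be undefined or the bound fail), tr(K)>0, and λ_k>0 for k<m so that η_1,…,η_{m−1} exist; terms of ϱ_m with zero denominator are omitted and the mean is taken over the rest. *)

theory Defs
  imports
    "HOL-Probability.Probability"
    "HOL-Library.Function_Algebras"
    "Jordan_Normal_Form.Gauss_Jordan_Elimination"
    "Jordan_Normal_Form.Schur_Decomposition"
    "Jordan_Normal_Form.DL_Rank"
begin

section \<open>Reproducing kernel Hilbert spaces of complex-valued functions\<close>

definition cscale :: "complex \<Rightarrow> ('a \<Rightarrow> complex) \<Rightarrow> 'a \<Rightarrow> complex" where
  "cscale c f = (\<lambda>x. c * f x)"

global_interpretation cfun: Vector_Spaces.vector_space "cscale :: complex \<Rightarrow> ('a \<Rightarrow> complex) \<Rightarrow> 'a \<Rightarrow> complex"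
  by standard (simp_all add: cscale_def fun_eq_iff algebra_simps)

definition hnorm :: "('b \<Rightarrow> 'b \<Rightarrow> complex) \<Rightarrow> 'b \<Rightarrow> real" where
  "hnorm ip f = sqrt (Re (ip f f))"

text \<open>A function on \<open>D\<close> is represented by its extension by \<open>0\<close> to the whole type, so
  that equality of elements of \<open>H\<close> is equality on \<open>D\<close>. Inner products are linear in the first
  argument.\<close>

locale hilbert_function_space =
  fixes D :: "'a set" and H :: "('a \<Rightarrow> complex) set"
    and ip :: "('a \<Rightarrow> complex) \<Rightarrow> ('a \<Rightarrow> complex) \<Rightarrow> complex"
  assumes subspace: "cfun.subspace H"
    and support: "f \<in> H \<Longrightarrow> x \<notin> D \<Longrightarrow> f x = 0"
    and ip_add: "f \<in> H \<Longrightarrow> g \<in> H \<Longrightarrow> h \<in> H \<Longrightarrow> ip (f + g) h = ip f h + ip g h"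
    and ip_scale: "f \<in> H \<Longrightarrow> g \<in> H \<Longrightarrow> ip (cscale c f) g = c * ip f g"
    and ip_cnj: "f \<in> H \<Longrightarrow> g \<in> H \<Longrightarrow> ip g f = cnj (ip f g)"
    and ip_pos: "f \<in> H \<Longrightarrow> f \<noteq> 0 \<Longrightarrow> 0 < Re (ip f f)"
    and complete: "(\<And>i. F i \<in> H) \<Longrightarrow>
      (\<And>\<epsilon>. \<epsilon> > 0 \<Longrightarrow> \<exists>N. \<forall>i\<ge>N. \<forall>j\<ge>N. hnorm ip (F i - F j) < \<epsilon>) \<Longrightarrow>
      \<exists>f\<in>H. (\<lambda>i. hnorm ip (F i - f)) \<longlonglongrightarrow> 0"

locale rkhs = hilbert_function_space D H ip
  for D :: "'a set" and H :: "('a \<Rightarrow> complex) set"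
    and ip :: "('a \<Rightarrow> complex) \<Rightarrow> ('a \<Rightarrow> complex) \<Rightarrow> complex" +
  fixes K :: "'a \<Rightarrow> 'a \<Rightarrow> complex"
  assumes kernel_in: "y \<in> D \<Longrightarrow> (\<lambda>x. if x \<in> D then K x y else 0) \<in> H"
    and reproducing: "f \<in> H \<Longrightarrow> y \<in> D \<Longrightarrow> f y = ip f (\<lambda>x. if x \<in> D then K x y else 0)"

text \<open>Positive definite in the sense of reproducing kernels: the quadratic forms are only
  required to be nonnegative.\<close>

definition positive_definite_hermitian_kernel :: "'a set \<Rightarrow> ('a \<Rightarrow> 'a \<Rightarrow> complex) \<Rightarrow> bool" where
  "positive_definite_hermitian_kernel D K \<longleftrightarrow>
     (\<forall>x\<in>D. \<forall>y\<in>D. K y x = cnj (K x y)) \<and>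
     (\<forall>S a. finite S \<and> S \<subseteq> D \<longrightarrow> 0 \<le> Re (\<Sum>x\<in>S. \<Sum>y\<in>S. cnj (a x) * a y * K x y))"

definition infinite_dimensional :: "('a \<Rightarrow> complex) set \<Rightarrow> bool" where
  "infinite_dimensional H \<longleftrightarrow> \<not> (\<exists>B. finite B \<and> H \<subseteq> cfun.span B)"


section \<open>The embedding into the space of square-integrable functions\<close>

definition L2_inner :: "'a measure \<Rightarrow> ('a \<Rightarrow> complex) \<Rightarrow> ('a \<Rightarrow> complex) \<Rightarrow> complex" where
  "L2_inner M f g = (\<integral>x. f x * cnj (g x) \<partial>M)"

text \<open>The adjoint of \<open>Id : H \<rightarrow> L2(M)\<close>, applied to a representative of a class. As \<open>Id\<close> sends a
  function to its own class, \<open>Id* \<circ> Id\<close> is \<open>embedding_adjoint\<close> on elements of \<open>H\<close>.\<close>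

definition embedding_adjoint :: "'a measure \<Rightarrow> ('a \<Rightarrow> complex) set
    \<Rightarrow> (('a \<Rightarrow> complex) \<Rightarrow> ('a \<Rightarrow> complex) \<Rightarrow> complex) \<Rightarrow> ('a \<Rightarrow> complex) \<Rightarrow> 'a \<Rightarrow> complex" where
  "embedding_adjoint M H ip \<phi> = (THE g. g \<in> H \<and> (\<forall>h\<in>H. ip h g = L2_inner M h \<phi>))"

text \<open>\<open>lam 1 \<ge> lam 2 \<ge> \<dots>\<close> are the strictly positive eigenvalues of \<open>Id* \<circ> Id\<close>, listed with
  multiplicity, and \<open>e 1, e 2, \<dots>\<close> are orthonormal eigenvectors; the index \<open>0\<close> is not used.
  If there are only finitely many such eigenvalues, both sequences are continued by \<open>0\<close>.\<close>

definition eigensystem :: "'a measure \<Rightarrow> ('a \<Rightarrow> complex) set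
    \<Rightarrow> (('a \<Rightarrow> complex) \<Rightarrow> ('a \<Rightarrow> complex) \<Rightarrow> complex)
    \<Rightarrow> (nat \<Rightarrow> real) \<Rightarrow> (nat \<Rightarrow> 'a \<Rightarrow> complex) \<Rightarrow> bool" where
  "eigensystem M H ip lam e \<longleftrightarrow>
     (\<forall>k\<ge>1. 0 \<le> lam k \<and> lam (Suc k) \<le> lam k) \<and>
     (\<forall>k\<ge>1. lam k = 0 \<longrightarrow> e k = 0) \<and>
     (\<forall>k\<ge>1. \<forall>l\<ge>1. 0 < lam k \<and> 0 < lam l \<longrightarrow> ip (e k) (e l) = (if k = l then 1 else 0)) \<and>
     (\<forall>\<mu>>0. {f \<in> H. embedding_adjoint M H ip f = cscale (complex_of_real \<mu>) f}
              = cfun.span {e k |k. 1 \<le> k \<and> lam k = \<mu>})"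

definition singular_number :: "(nat \<Rightarrow> real) \<Rightarrow> nat \<Rightarrow> real" where
  "singular_number lam j = sqrt (lam j)"

definition eta :: "(nat \<Rightarrow> real) \<Rightarrow> (nat \<Rightarrow> 'a \<Rightarrow> complex) \<Rightarrow> nat \<Rightarrow> 'a \<Rightarrow> complex" where
  "eta lam e j = cscale (complex_of_real (1 / singular_number lam j)) (e j)"


section \<open>Traces and the sampling density\<close>

text \<open>The diagonals of \<open>K\<close> and \<open>K0\<close> are real.\<close>

definition kernel_trace :: "'a measure \<Rightarrow> ('a \<Rightarrow> 'a \<Rightarrow> complex) \<Rightarrow> real" where
  "kernel_trace M K = (\<integral>x. Re (K x x) \<partial>M)"

definition K1 :: "(nat \<Rightarrow> 'a \<Rightarrow> complex) \<Rightarrow> 'a \<Rightarrow> 'a \<Rightarrow> complex" where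
  "K1 e x y = (\<Sum>\<^sub>\<infinity>k\<in>{1..}. e k x * cnj (e k y))"

definition K0 :: "('a \<Rightarrow> 'a \<Rightarrow> complex) \<Rightarrow> (nat \<Rightarrow> 'a \<Rightarrow> complex) \<Rightarrow> 'a \<Rightarrow> 'a \<Rightarrow> complex" where
  "K0 K e x y = K x y - K1 e x y"

definition tr0 :: "'a measure \<Rightarrow> ('a \<Rightarrow> 'a \<Rightarrow> complex) \<Rightarrow> (nat \<Rightarrow> 'a \<Rightarrow> complex) \<Rightarrow> real" where
  "tr0 M K e = kernel_trace M (K0 K e)"

text \<open>Each of the three summands is a probability density whenever its denominator is nonzero.
  A summand with denominator \<open>0\<close> (for instance the third one if \<open>tr0 = 0\<close>, as happens for
  separable \<open>H\<close>) is omitted, and the mean is taken over the remaining ones; otherwise the prefactor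
  is \<open>1/3\<close>.\<close>

definition density_summands :: "'a measure \<Rightarrow> (nat \<Rightarrow> real) \<Rightarrow> ('a \<Rightarrow> 'a \<Rightarrow> complex)
    \<Rightarrow> (nat \<Rightarrow> 'a \<Rightarrow> complex) \<Rightarrow> nat \<Rightarrow> nat" where
  "density_summands M lam K e m =
     of_bool (m - 1 \<noteq> 0) + of_bool ((\<Sum>\<^sub>\<infinity>j\<in>{m..}. lam j) \<noteq> 0) + of_bool (tr0 M K e \<noteq> 0)"

definition sampling_density :: "'a measure \<Rightarrow> (nat \<Rightarrow> real) \<Rightarrow> ('a \<Rightarrow> 'a \<Rightarrow> complex)
    \<Rightarrow> (nat \<Rightarrow> 'a \<Rightarrow> complex) \<Rightarrow> nat \<Rightarrow> 'a \<Rightarrow> real" where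
  "sampling_density M lam K e m x =
     1 / real (density_summands M lam K e m) *
       ((\<Sum>j=1..m-1. (cmod (eta lam e j x))\<^sup>2) / real (m - 1)
        + (\<Sum>\<^sub>\<infinity>j\<in>{m..}. (cmod (e j x))\<^sup>2) / (\<Sum>\<^sub>\<infinity>j\<in>{m..}. lam j)
        + Re (K0 K e x x) / tr0 M K e)"


section \<open>Weighted least squares\<close>

text \<open>The nodes are \<open>X 0, \<dots>, X (n - 1)\<close>; column \<open>k\<close> of the matrix belongs to \<open>eta (k + 1)\<close>.\<close>

definition lsq_matrix :: "('a \<Rightarrow> real) \<Rightarrow> (nat \<Rightarrow> 'a \<Rightarrow> complex) \<Rightarrow> nat \<Rightarrow> nat \<Rightarrow> (nat \<Rightarrow> 'a) \<Rightarrow> complex mat" where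
  "lsq_matrix \<rho> \<eta> m n X = Matrix.mat n (m - 1)
     (\<lambda>(j, k). if \<rho> (X j) \<noteq> 0 then \<eta> (Suc k) (X j) / complex_of_real (sqrt (\<rho> (X j))) else 0)"

definition lsq_data :: "('a \<Rightarrow> real) \<Rightarrow> nat \<Rightarrow> (nat \<Rightarrow> 'a) \<Rightarrow> ('a \<Rightarrow> complex) \<Rightarrow> complex Matrix.vec" where
  "lsq_data \<rho> n X f = Matrix.vec n
     (\<lambda>j. if \<rho> (X j) \<noteq> 0 then f (X j) / complex_of_real (sqrt (\<rho> (X j))) else 0)"

definition lsq_full_rank :: "('a \<Rightarrow> real) \<Rightarrow> (nat \<Rightarrow> 'a \<Rightarrow> complex) \<Rightarrow> nat \<Rightarrow> nat \<Rightarrow> (nat \<Rightarrow> 'a) \<Rightarrow> bool" where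
  "lsq_full_rank \<rho> \<eta> m n X \<longleftrightarrow> vec_space.rank n (lsq_matrix \<rho> \<eta> m n X) = m - 1"

definition lsq_coeffs :: "('a \<Rightarrow> real) \<Rightarrow> (nat \<Rightarrow> 'a \<Rightarrow> complex) \<Rightarrow> nat \<Rightarrow> nat \<Rightarrow> (nat \<Rightarrow> 'a)
    \<Rightarrow> ('a \<Rightarrow> complex) \<Rightarrow> complex Matrix.vec" where
  "lsq_coeffs \<rho> \<eta> m n X f =
     (let L = lsq_matrix \<rho> \<eta> m n X
      in (the (mat_inverse (mat_adjoint L * L)) * mat_adjoint L) *\<^sub>v lsq_data \<rho> n X f)"

text \<open>Meaningful only if \<open>lsq_full_rank \<rho> \<eta> m n X\<close>.\<close>

definition lsq_operator :: "('a \<Rightarrow> real) \<Rightarrow> (nat \<Rightarrow> 'a \<Rightarrow> complex) \<Rightarrow> nat \<Rightarrow> nat \<Rightarrow> (nat \<Rightarrow> 'a)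
    \<Rightarrow> ('a \<Rightarrow> complex) \<Rightarrow> 'a \<Rightarrow> complex" where
  "lsq_operator \<rho> \<eta> m n X f =
     (\<Sum>k=1..m-1. cscale (vec_index (lsq_coeffs \<rho> \<eta> m n X f) (k - 1)) (\<eta> k))"

definition L2_norm_sq :: "'a measure \<Rightarrow> ('a \<Rightarrow> complex) \<Rightarrow> ennreal" where
  "L2_norm_sq M f = (\<integral>\<^sup>+x. ennreal ((cmod (f x))\<^sup>2) \<partial>M)"

definition node_distribution :: "'a measure \<Rightarrow> ('a \<Rightarrow> real) \<Rightarrow> nat \<Rightarrow> (nat \<Rightarrow> 'a) measure" where
  "node_distribution M \<rho> n = PiM {..<n} (\<lambda>_. density M (\<lambda>x. ennreal (\<rho> x)))"

end

theory Submission
  imports Defs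
begin

text \<open>Write \<open>f = p + g\<close> with \<open>p\<close> the projection of \<open>f\<close> onto the span of \<open>e 1, \<dots>, e (m - 1)\<close>. Least squares
  reproduces \<open>p\<close>, so the squared error is at most \<open>\<lambda>\<^sub>m\<close> plus the sum of the weighted squared samples of \<open>g\<close>
  divided by the smallest eigenvalue of the Gram matrix of \<open>\<eta> 1, \<dots>, \<eta> (m - 1)\<close> at the nodes. The samples of
  \<open>g\<close> split into two parts. The part in the span of \<open>e m, e (m + 1), \<dots>\<close> is controlled by the largest
  eigenvalue of another random Gram operator. The part in the kernel of the embedding is governed by
  the matrix \<open>K0(x\<^sub>i, x\<^sub>j)\<close>, which is almost surely diagonal by Fubini, because \<open>K0(\<cdot>, y)\<close> vanishes almost
  everywhere; this needs that the \<open>e k\<close> exhaust the embedding, which is the spectral theorem for a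
  form of finite trace.

  Both operators are sums of independent rank-one matrices \<open>y y\<^sup>*\<close> with \<open>|y|\<^sup>2 \<le> R\<close>. The expected trace of
  the exponential is followed one sample at a time: comparing the eigenbases of \<open>Z\<close> and \<open>Z + y y\<^sup>*\<close>
  entrywise gives
  \<open>tr exp(s(Z + y y\<^sup>*)) \<le> tr exp(sZ) + s (1 + sR/2)/(1 - sR/2) y\<^sup>* exp(sZ) y\<close> for \<open>sR < 2\<close>,
  which replaces the Golden--Thompson inequality and is linear in the second moment of \<open>y\<close>. Starting
  from \<open>tr (exp(sZ) - 1)\<close> in the upper estimate makes the dimension disappear, so that truncations of
  the infinite-dimensional operator are controlled uniformly.\<close>

section \<open>Positive semidefinite forms and Hilbert function spaces\<close>

text \<open>Three computations tie the constants together. With \<open>\<theta> = 2/(9d)\<close> and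
  \<open>d = m - 1\<close>, the level \<open>n/6\<close> gives a lower tail
  \<open>d exp(-2n/(27d))\<close>; since \<open>14 r d ln n \<le> n\<close>, the exponent is at most
  \<open>-(28/27) r ln n\<close>, so the 14 in the choice of \<open>m\<close> just fits the level
  1/6. With \<open>\<theta> = 2/(9T)\<close>, the factor 11 solves
  \<open>2/9 * 11 = 4/9 + 2\<close>. The failure probabilities are then 1 and 4/9 times
  \<open>n^(1-r)\<close>, with sum 13/9, below \<open>2^(3/4) + 1\<close>.

  Two obstacles shape the remaining work. As \<open>H\<close> may be non-separable, its elements
  need not share a countable expansion, so the measurability of members of \<open>H\<close> and the
  supremum over the unit ball are reached through Riesz representation and duality. And
  \<open>measure\<close> is 0 on sets outside the sigma-algebra, so the event of the theorem must
  itself be measurable; it is not enough that it contains a large measurable event.\<close>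

lemma quadratic_minimum_at_0:
  fixes a b :: real
  assumes "\<And>t. 0 \<le> 2 * t * a + t\<^sup>2 * b" "0 \<le> b" shows "a = 0"
proof (rule ccontr)
  assume "a \<noteq> 0"
  \<comment> \<open>For \<open>b > 0\<close> the parabola has its minimum at \<open>-a/b\<close>;
    using \<open>b + 1\<close> instead covers \<open>b = 0\<close> and still gives a negative
    value.\<close>
  define c where "c = 1 / (b + 1)"
  have c: "c > 0" "c * b < 1" using \<open>0 \<le> b\<close> by (auto simp: c_def field_simps)
  have "0 \<le> 2 * (- a * c) * a + (- a * c)\<^sup>2 * b" by (rule assms)
  also have "\<dots> = a\<^sup>2 * c * (c * b - 2)"
    by (simp add: algebra_simps power2_eq_square)
  also have "\<dots> < 0" using c \<open>a \<noteq> 0\<close> by (intro mult_pos_neg) auto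
  finally show False by simp
qed

text \<open>Only semidefiniteness is required, so that the same lemmas serve the inner product
  \<open>ip\<close>, the form \<open>L2_inner M\<close>, which may degenerate on \<open>H\<close>,
  the frame forms on \<open>cspace d\<close>, and the defect form \<open>\<mu> * ip - B\<close> in
  \<open>form_eigenvector\<close>.\<close>

locale psd_form =
  fixes H :: "('a \<Rightarrow> complex) set" and B :: "('a \<Rightarrow> complex) \<Rightarrow> ('a \<Rightarrow> complex) \<Rightarrow> complex"
  assumes sub: "cfun.subspace H"
    and add_left: "f \<in> H \<Longrightarrow> g \<in> H \<Longrightarrow> h \<in> H \<Longrightarrow> B (f + g) h = B f h + B g h"
    and scale_left: "f \<in> H \<Longrightarrow> g \<in> H \<Longrightarrow> B (cscale c f) g = c * B f g"
    and cnj_sym: "f \<in> H \<Longrightarrow> g \<in> H \<Longrightarrow> B g f = cnj (B f g)"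
    and nonneg: "f \<in> H \<Longrightarrow> 0 \<le> Re (B f f)"
begin

lemma in_add: "f \<in> H \<Longrightarrow> g \<in> H \<Longrightarrow> f + g \<in> H"
  using sub by (simp add: cfun.subspace_add)

lemma in_diff: "f \<in> H \<Longrightarrow> g \<in> H \<Longrightarrow> f - g \<in> H"
  using sub by (simp add: cfun.subspace_diff)

lemma in_scale: "f \<in> H \<Longrightarrow> cscale c f \<in> H"
  using sub by (simp add: cfun.subspace_scale)

lemma in_zero: "0 \<in> H"
  using sub by (simp add: cfun.subspace_0)

lemma in_sum: "(\<And>i. i \<in> I \<Longrightarrow> F i \<in> H) \<Longrightarrow> sum F I \<in> H"
  using sub by (simp add: cfun.subspace_sum)

lemmas in_intros = in_add in_diff in_scale in_zero in_sum

lemma zero_left: "g \<in> H \<Longrightarrow> B 0 g = 0"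
  using scale_left[of 0 g 0] in_zero by (simp add: cscale_def zero_fun_def)

lemma zero_right: "g \<in> H \<Longrightarrow> B g 0 = 0"
  using zero_left[of g] cnj_sym[of 0 g] in_zero by simp

lemma add_right: "f \<in> H \<Longrightarrow> g \<in> H \<Longrightarrow> h \<in> H \<Longrightarrow> B h (f + g) = B h f + B h g"
  by (simp add: cnj_sym[of _ h] in_intros add_left)

lemma scale_right: "f \<in> H \<Longrightarrow> g \<in> H \<Longrightarrow> B g (cscale c f) = cnj c * B g f"
  by (simp add: cnj_sym[of _ g] in_intros scale_left)

lemma diff_left:
  assumes "f \<in> H" "g \<in> H" "h \<in> H" shows "B (f - g) h = B f h - B g h"
  using add_left[of "f - g" g h] assms in_diff by simp

lemma diff_right: "f \<in> H \<Longrightarrow> g \<in> H \<Longrightarrow> h \<in> H \<Longrightarrow> B h (f - g) = B h f - B h g"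
  by (simp add: cnj_sym[of _ h] in_intros diff_left)

lemma sum_left: "(\<And>i. i \<in> I \<Longrightarrow> F i \<in> H) \<Longrightarrow> g \<in> H \<Longrightarrow> B (sum F I) g = (\<Sum>i\<in>I. B (F i) g)"
proof (induction I rule: infinite_finite_induct)
  case (insert x I)
  have "B (F x + sum F I) g = B (F x) g + B (sum F I) g"
    using insert.prems by (intro add_left in_sum) auto
  also have "\<dots> = B (F x) g + (\<Sum>i\<in>I. B (F i) g)"
    using insert by simp
  finally show ?case by (simp only: sum.insert[OF insert.hyps])
qed (simp_all add: zero_left)

lemma sum_right:
  assumes "\<And>i. i \<in> I \<Longrightarrow> F i \<in> H" "g \<in> H" shows "B g (sum F I) = (\<Sum>i\<in>I. B g (F i))"
  using assms by (simp add: cnj_sym[of _ g] in_sum sum_left)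

lemma Im_self: "f \<in> H \<Longrightarrow> Im (B f f) = 0"
  using cnj_sym[of f f] by (metis Reals_cnj_iff complex_is_Real_iff)

lemma self_real: "f \<in> H \<Longrightarrow> B f f = complex_of_real (Re (B f f))"
  using Im_self[of f] by (simp add: complex_eq_iff)

lemma Re_commute: "f \<in> H \<Longrightarrow> g \<in> H \<Longrightarrow> Re (B g f) = Re (B f g)"
  using cnj_sym[of f g] by simp

lemma expand_diff:
  assumes "f \<in> H" "g \<in> H"
  shows "Re (B (f - g) (f - g)) = Re (B f f) - 2 * Re (B f g) + Re (B g g)"
  using assms by (simp add: diff_left diff_right in_intros Re_commute[of f g])

lemma expand_add:
  assumes "f \<in> H" "g \<in> H"
  shows "Re (B (f + g) (f + g)) = Re (B f f) + 2 * Re (B f g) + Re (B g g)"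
  using assms by (simp add: add_left add_right in_intros Re_commute[of f g])

lemma expand_scale:
  assumes "f \<in> H"
  shows "Re (B (cscale c f) (cscale c f)) = (cmod c)\<^sup>2 * Re (B f f)"
proof -
  have "B (cscale c f) (cscale c f) = c * cnj c * B f f"
    using assms by (simp add: scale_left scale_right in_intros)
  also have "\<dots> = complex_of_real ((cmod c)\<^sup>2) * B f f"
    by (simp only: complex_norm_square)
  finally show ?thesis by simp
qed

lemma Cauchy_Schwarz:
  assumes f: "f \<in> H" and g: "g \<in> H"
  shows "(cmod (B f g))\<^sup>2 \<le> Re (B f f) * Re (B g g)"
proof -
  define b where "b = B f g"
  \<comment> \<open>The multiple of \<open>g\<close> carries the phase of \<open>b\<close>, so that
    the mixed term becomes the real number \<open>t * (cmod b)\<^sup>2\<close>.\<close>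
  have poly: "0 \<le> Re (B f f) - 2 * t * (cmod b)\<^sup>2 + t\<^sup>2 * (cmod b)\<^sup>2 * Re (B g g)" for t :: real
  proof -
    let ?c = "complex_of_real t * b"
    have "0 \<le> Re (B (f - cscale ?c g) (f - cscale ?c g))"
      using f g by (intro nonneg in_intros)
    also have "\<dots> = Re (B f f) - 2 * Re (B f (cscale ?c g)) + (cmod ?c)\<^sup>2 * Re (B g g)"
      using f g by (simp add: expand_diff in_intros expand_scale)
    also have "B f (cscale ?c g) = complex_of_real t * (b * cnj b)"
      using f g by (simp add: scale_right b_def)
    also have "Re \<dots> = t * (cmod b)\<^sup>2"
      by (simp add: complex_norm_square[symmetric] flip: of_real_mult)
    finally show ?thesis by (simp add: norm_mult power_mult_distrib)
  qed
  show ?thesis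
  proof (cases "Re (B g g) = 0")
    case True
    have "b = 0"
    proof (rule ccontr)
      assume "b \<noteq> 0"
      \<comment> \<open>When \<open>g\<close> has form value 0 the parabola degenerates to a line,
        which takes the value -1 at this \<open>t\<close>.\<close>
      define t where "t = (Re (B f f) + 1) / (2 * (cmod b)\<^sup>2)"
      from poly[of t] \<open>b \<noteq> 0\<close> show False unfolding True t_def by (simp add: field_simps)
    qed
    then show ?thesis unfolding b_def by (simp add: nonneg f g)
  next
    case False
    then have pos: "Re (B g g) > 0" using nonneg[OF g] by simp
    from poly[of "1 / Re (B g g)"] pos
    have "0 \<le> Re (B f f) - (cmod b)\<^sup>2 / Re (B g g)"
      by (simp add: field_simps power2_eq_square)
    then show ?thesis using pos by (simp add: field_simps b_def)
  qed
qed

text \<open>Young's inequality with unequal weights. Together with the bound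
  \<open>\<mu> / 2\<close> on a complement in \<open>form_eigenvector\<close>, the factor 3/2 leaves
  3/4, which can be absorbed; equal weights would give the factor 2 and leave exactly 1.\<close>

lemma split_bound:
  assumes "f \<in> H" "g \<in> H"
  shows "Re (B (f + g) (f + g)) \<le> 3 * Re (B f f) + 3 / 2 * Re (B g g)"
proof -
  have "0 \<le> Re (B (cscale 2 f - g) (cscale 2 f - g))"
    using assms by (intro nonneg in_intros)
  also have "\<dots> = 4 * Re (B f f) - 4 * Re (B f g) + Re (B g g)"
    using assms scale_left[of f g 2] by (simp add: expand_diff expand_scale in_intros)
  finally show ?thesis using assms by (simp add: expand_add)
qed

end

text \<open>Zero vectors are admitted because the eigenfunctions \<open>e k\<close> are continued by \<open>0\<close> after the last
  positive eigenvalue.\<close>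

definition (in psd_form) quasi_orthonormal :: "'i set \<Rightarrow> ('i \<Rightarrow> 'a \<Rightarrow> complex) \<Rightarrow> bool" where
  "quasi_orthonormal I u \<longleftrightarrow> (\<forall>i\<in>I. u i \<in> H \<and> (u i = 0 \<or> B (u i) (u i) = 1)) \<and>
     (\<forall>i\<in>I. \<forall>j\<in>I. i \<noteq> j \<longrightarrow> B (u i) (u j) = 0)"

context psd_form
begin

lemma quasi_orthonormalD:
  assumes "quasi_orthonormal I u"
  shows "i \<in> I \<Longrightarrow> u i \<in> H" "i \<in> I \<Longrightarrow> u i = 0 \<or> B (u i) (u i) = 1"
    "i \<in> I \<Longrightarrow> j \<in> I \<Longrightarrow> i \<noteq> j \<Longrightarrow> B (u i) (u j) = 0"
  using assms unfolding quasi_orthonormal_def by auto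

lemma quasi_orthonormal_subset: "quasi_orthonormal I u \<Longrightarrow> J \<subseteq> I \<Longrightarrow> quasi_orthonormal J u"
  by (auto simp: quasi_orthonormal_def subset_iff)

lemma ip_comb:
  assumes u: "quasi_orthonormal I u" and I: "finite I" and J: "J \<subseteq> I" and i: "i \<in> I"
  shows "B (\<Sum>j\<in>J. cscale (c j) (u j)) (u i) = (if i \<in> J \<and> u i \<noteq> 0 then c i else 0)"
proof -
  note uD = quasi_orthonormalD[OF u]
  have "B (\<Sum>j\<in>J. cscale (c j) (u j)) (u i) = (\<Sum>j\<in>J. c j * B (u j) (u i))"
    using J i uD(1) by (subst sum_left) (auto intro!: in_scale sum.cong simp: scale_left)
  also have "\<dots> = (\<Sum>j\<in>J. if j = i then (if u i \<noteq> 0 then c i else 0) else 0)"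
  proof (intro sum.cong refl)
    fix j assume "j \<in> J"
    then show "c j * B (u j) (u i) = (if j = i then (if u i \<noteq> 0 then c i else 0) else 0)"
      using J uD(3)[of j i] i uD(2)[OF i] zero_left[OF in_zero] by (cases "j = i") auto
  qed
  finally show ?thesis
    using finite_subset[OF J I] by simp
qed

lemma norm_comb:
  assumes u: "quasi_orthonormal I u" and I: "finite I"
  shows "Re (B (\<Sum>j\<in>I. cscale (c j) (u j)) (\<Sum>j\<in>I. cscale (c j) (u j)))
     = (\<Sum>j\<in>I. if u j \<noteq> 0 then (cmod (c j))\<^sup>2 else 0)"
proof -
  note uD = quasi_orthonormalD[OF u]
  let ?s = "\<Sum>j\<in>I. cscale (c j) (u j)"
  have s: "?s \<in> H" using uD(1) by (auto intro: in_intros)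
  have "B ?s ?s = (\<Sum>j\<in>I. cnj (c j) * B ?s (u j))"
    using uD(1) s by (simp add: sum_right in_scale scale_right)
  also have "\<dots> = (\<Sum>j\<in>I. of_real (if u j \<noteq> 0 then (cmod (c j))\<^sup>2 else 0))"
    by (intro sum.cong) (simp_all add: ip_comb[OF u I order_refl] complex_norm_square mult.commute[of "cnj _"] del: of_real_power)
  finally show ?thesis by simp
qed

lemma residual:
  assumes u: "quasi_orthonormal I u" and I: "finite I" and f: "f \<in> H"
  defines "p \<equiv> (\<Sum>i\<in>I. cscale (B f (u i)) (u i))"
  shows "p \<in> H" "i \<in> I \<Longrightarrow> B (f - p) (u i) = 0"
    "Re (B p p) = (\<Sum>i\<in>I. (cmod (B f (u i)))\<^sup>2)"
    "Re (B (f - p) (f - p)) = Re (B f f) - (\<Sum>i\<in>I. (cmod (B f (u i)))\<^sup>2)"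
proof -
  note uD = quasi_orthonormalD[OF u]
  show p: "p \<in> H" unfolding p_def using uD(1) by (auto intro: in_intros)
  show 1: "B (f - p) (u i) = 0" if "i \<in> I" for i
    using that uD(1) f p ip_comb[OF u I order_refl that, of "\<lambda>i. B f (u i)"]
    by (auto simp: diff_left p_def[symmetric] zero_right)
  \<comment> \<open>If \<open>u i = 0\<close>, the coefficient \<open>B f (u i)\<close> vanishes
    too, so the case distinction of \<open>norm_comb\<close> disappears.\<close>
  show 2: "Re (B p p) = (\<Sum>i\<in>I. (cmod (B f (u i)))\<^sup>2)"
    unfolding p_def norm_comb[OF u I] using f by (intro sum.cong) (auto simp: zero_right)
  have "B (f - p) p = 0"
  proof -
    have "B (f - p) p = (\<Sum>i\<in>I. B (f - p) (cscale (B f (u i)) (u i)))"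
      unfolding p_def using uD(1) f p[unfolded p_def] by (subst sum_right) (auto intro: in_intros)
    also have "\<dots> = 0"
      using uD(1) f p 1 by (intro sum.neutral) (auto simp: scale_right in_intros)
    finally show ?thesis .
  qed
  then have "B f p = B p p" using f p by (simp add: diff_left)
  then show "Re (B (f - p) (f - p)) = Re (B f f) - (\<Sum>i\<in>I. (cmod (B f (u i)))\<^sup>2)"
    using f p 2 by (simp add: expand_diff)
qed

lemma Bessel:
  assumes u: "quasi_orthonormal I u" and I: "finite I" and f: "f \<in> H"
  shows "(\<Sum>i\<in>I. (cmod (B f (u i)))\<^sup>2) \<le> Re (B f f)"
  using residual[OF u I f] nonneg[of "f - (\<Sum>i\<in>I. cscale (B f (u i)) (u i))"] f
  by (simp add: in_diff)

end

section \<open>Hilbert function spaces: limits and Riesz representation\<close>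

context hilbert_function_space
begin

sublocale psd_form H ip
proof
  show "cfun.subspace H" by (rule subspace)
  show "0 \<le> Re (ip f f)" if "f \<in> H" for f
  proof (cases "f = 0")
    case True
    then show ?thesis using ip_scale[of 0 0 0] that by (simp add: cscale_def zero_fun_def)
  qed (use ip_pos that in fastforce)
qed (simp_all add: ip_add ip_scale, rule ip_cnj)

abbreviation "nsq f \<equiv> Re (ip f f)"

lemma hnorm_sq: "f \<in> H \<Longrightarrow> (hnorm ip f)\<^sup>2 = nsq f"
  by (simp add: hnorm_def nonneg)

lemma nsq_eq_0: "f \<in> H \<Longrightarrow> nsq f = 0 \<longleftrightarrow> f = 0"
  using ip_pos[of f] zero_left[OF in_zero] by (cases "f = 0") auto

lemma complete_nsq:
  assumes F: "\<And>i. F i \<in> H"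
    and C: "\<And>\<epsilon>. \<epsilon> > 0 \<Longrightarrow> \<exists>N. \<forall>i\<ge>N. \<forall>j\<ge>N. nsq (F i - F j) < \<epsilon>"
  obtains f where "f \<in> H" "(\<lambda>i. nsq (F i - f)) \<longlonglongrightarrow> 0"
proof -
  have "\<exists>f\<in>H. (\<lambda>i. hnorm ip (F i - f)) \<longlonglongrightarrow> 0"
  proof (rule complete[OF F])
    fix \<epsilon> :: real assume "\<epsilon> > 0"
    with C[of "\<epsilon>\<^sup>2"] obtain N where N: "\<forall>i\<ge>N. \<forall>j\<ge>N. nsq (F i - F j) < \<epsilon>\<^sup>2" by auto
    show "\<exists>N. \<forall>i\<ge>N. \<forall>j\<ge>N. hnorm ip (F i - F j) < \<epsilon>"
      using N \<open>\<epsilon> > 0\<close> by (auto simp: hnorm_def intro!: exI[of _ N] real_less_lsqrt)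
  qed
  then obtain f where f: "f \<in> H" "(\<lambda>i. hnorm ip (F i - f)) \<longlonglongrightarrow> 0" by auto
  have "(\<lambda>i. nsq (F i - f)) \<longlonglongrightarrow> 0"
    using tendsto_power[OF f(2), of 2] f(1) F by (simp add: hnorm_sq in_diff)
  with f(1) that show thesis by blast
qed

lemma ip_tendsto:
  assumes F: "\<And>i. F i \<in> H" and f: "f \<in> H" and g: "g \<in> H" and lim: "(\<lambda>i. nsq (F i - f)) \<longlonglongrightarrow> 0"
  shows "(\<lambda>i. ip (F i) g) \<longlonglongrightarrow> ip f g"
proof -
  have "(\<lambda>i. (cmod (ip (F i - f) g))\<^sup>2) \<longlonglongrightarrow> 0"
  proof (rule tendsto_sandwich)
    show "\<forall>\<^sub>F i in sequentially. (cmod (ip (F i - f) g))\<^sup>2 \<le> nsq (F i - f) * nsq g"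
      by (intro always_eventually allI Cauchy_Schwarz in_diff F f g)
    show "\<forall>\<^sub>F i in sequentially. 0 \<le> (cmod (ip (F i - f) g))\<^sup>2" by simp
    show "(\<lambda>i. nsq (F i - f) * nsq g) \<longlonglongrightarrow> 0"
      using tendsto_mult_right[OF lim, of "nsq g"] by simp
  qed simp
  then have "(\<lambda>i. sqrt ((cmod (ip (F i - f) g))\<^sup>2)) \<longlonglongrightarrow> sqrt 0" by (rule tendsto_real_sqrt)
  then have "(\<lambda>i. cmod (ip (F i) g - ip f g)) \<longlonglongrightarrow> 0" using F f g by (simp add: diff_left)
  then show ?thesis by (simp add: LIM_zero_iff tendsto_norm_zero_iff)
qed

text \<open>Riesz representation, by minimising \<open>\<parallel>g\<parallel>\<^sup>2 - 2 Re L(g)\<close>: the parallelogram identity makes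
  minimising sequences Cauchy.\<close>

lemma Riesz:
  assumes Ladd: "\<And>f g. f \<in> H \<Longrightarrow> g \<in> H \<Longrightarrow> L (f + g) = L f + L g"
    and Lscale: "\<And>c f. f \<in> H \<Longrightarrow> L (cscale c f) = c * L f"
    and Lbd: "\<And>f. f \<in> H \<Longrightarrow> (cmod (L f))\<^sup>2 \<le> C * nsq f" and C: "0 \<le> C"
  obtains g where "g \<in> H" "\<And>h. h \<in> H \<Longrightarrow> ip h g = L h"
proof -
  define J where "J g = nsq g - 2 * Re (L g)" for g
  define c where "c = Inf (J ` H)"
  have lower: "J g \<ge> - C" if g: "g \<in> H" for g
  proof -
    have "Re (L g) \<le> cmod (L g)" by (rule complex_Re_le_cmod)
    also have "\<dots> \<le> sqrt (C * nsq g)" using Lbd[OF g] by (rule real_le_rsqrt)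
    also have "\<dots> \<le> (C + nsq g) / 2" using C nonneg[OF g] by (rule arith_geo_mean_sqrt)
    finally show ?thesis by (simp add: J_def field_simps)
  qed
  have bdd: "bdd_below (J ` H)" using lower by (intro bdd_belowI[of _ "- C"]) auto
  have cle: "c \<le> J g" if "g \<in> H" for g
    unfolding c_def using bdd that by (intro cInf_lower) auto
  have "\<exists>g\<in>H. J g < c + 1 / real (Suc i)" for i
    using cInf_lessD[of "J ` H" "c + 1 / real (Suc i)"] in_zero by (auto simp: c_def)
  then obtain G where G: "\<And>i. G i \<in> H" "\<And>i. J (G i) < c + 1 / real (Suc i)" by metis
  have Ldiff: "L (f - g) = L f - L g" if "f \<in> H" "g \<in> H" for f g
    using Ladd[of "f - g" g] that in_diff by simp
  have par: "nsq (f - g) = 2 * J f + 2 * J g - 4 * J (cscale (1/2) (f + g))"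
    if "f \<in> H" "g \<in> H" for f g
  proof -
    have "L (cscale (1/2) (f + g)) = 1 / 2 * (L f + L g)"
      using that by (simp add: Lscale in_intros Ladd)
    then have "Re (L (cscale (1/2) (f + g))) = Re (1 / 2 * (L f + L g))" by (rule arg_cong)
    then have "4 * Re (L (cscale (1/2) (f + g))) = 2 * Re (L f) + 2 * Re (L g)"
      by (simp only: Re_divide_numeral times_divide_eq_left mult_1_left plus_complex.sel) simp
    moreover have "nsq (cscale (1/2) (f + g)) = 1 / 4 * (nsq f + 2 * Re (ip f g) + nsq g)"
      using that by (simp add: expand_scale[OF in_add] expand_add power_divide)
    ultimately show ?thesis using that by (simp add: J_def expand_diff)
  qed
  have near: "nsq (G i - G j) \<le> 2 / real (Suc i) + 2 / real (Suc j)" for i j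
    using par[OF G(1) G(1), of i j] G(2)[of i] G(2)[of j]
      cle[OF in_scale[OF in_add[OF G(1) G(1)]], of "1/2" i j] by simp
  obtain g where g: "g \<in> H" and lim: "(\<lambda>i. nsq (G i - g)) \<longlonglongrightarrow> 0"
  proof (rule complete_nsq[OF G(1)])
    fix \<epsilon> :: real assume "\<epsilon> > 0"
    then obtain N where N: "1 / real (Suc N) < \<epsilon> / 4"
      using nat_approx_posE[of "\<epsilon>/4"] by auto
    have "nsq (G i - G j) < \<epsilon>" if "i \<ge> N" "j \<ge> N" for i j
    proof -
      have "1 / real (Suc i) \<le> 1 / real (Suc N)" "1 / real (Suc j) \<le> 1 / real (Suc N)"
        using that by (auto intro!: divide_left_mono)
      then show ?thesis using near[of i j] N by simp
    qed
    then show "\<exists>N. \<forall>i\<ge>N. \<forall>j\<ge>N. nsq (G i - G j) < \<epsilon>" by blast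
  qed
  have Re_eq: "Re (ip h g) = Re (L h)" if h: "h \<in> H" for h
  proof -
    have Jg: "J g \<le> c + 0"
    proof (rule LIMSEQ_le)
      have "(\<lambda>i. nsq (G i) - 2 * Re (L (G i))) \<longlonglongrightarrow> nsq g - 2 * Re (L g)"
      proof (intro tendsto_diff tendsto_mult_left)
        have "(\<lambda>i. nsq (G i - g) + 2 * Re (ip (G i) g) - nsq g) \<longlonglongrightarrow> 0 + 2 * Re (ip g g) - nsq g"
          by (intro tendsto_intros lim tendsto_Re ip_tendsto[OF G(1) g g lim])
        then show "(\<lambda>i. nsq (G i)) \<longlonglongrightarrow> nsq g"
          using G(1) g by (simp add: expand_diff)
        have "(\<lambda>i. (cmod (L (G i - g)))\<^sup>2) \<longlonglongrightarrow> 0"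
        proof (rule tendsto_sandwich)
          show "\<forall>\<^sub>F i in sequentially. (cmod (L (G i - g)))\<^sup>2 \<le> C * nsq (G i - g)"
            by (intro always_eventually allI Lbd in_diff G g)
          show "\<forall>\<^sub>F i in sequentially. 0 \<le> (cmod (L (G i - g)))\<^sup>2" by simp
          show "(\<lambda>i. C * nsq (G i - g)) \<longlonglongrightarrow> 0"
            using tendsto_mult_left[OF lim, of C] by simp
        qed simp
        then have "(\<lambda>i. sqrt ((cmod (L (G i - g)))\<^sup>2)) \<longlonglongrightarrow> sqrt 0" by (rule tendsto_real_sqrt)
        then have "(\<lambda>i. cmod (L (G i) - L g)) \<longlonglongrightarrow> 0" using G(1) g by (simp add: Ldiff)
        then have "(\<lambda>i. L (G i)) \<longlonglongrightarrow> L g" by (simp add: LIM_zero_iff tendsto_norm_zero_iff)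
        then show "(\<lambda>i. Re (L (G i))) \<longlonglongrightarrow> Re (L g)" by (rule tendsto_Re)
      qed
      then show "(\<lambda>i. J (G i)) \<longlonglongrightarrow> J g" by (simp add: J_def)
    next
      show "(\<lambda>i. c + 1 / real (Suc i)) \<longlonglongrightarrow> c + 0"
        by (intro tendsto_intros LIMSEQ_Suc lim_1_over_n)
      show "\<exists>N. \<forall>i\<ge>N. J (G i) \<le> c + 1 / real (Suc i)"
        using G(2) less_imp_le by blast
    qed
    \<comment> \<open>First-order condition at the minimiser: along \<open>g + t h\<close> the
      excess of \<open>J\<close> is a quadratic in \<open>t\<close> whose linear coefficient is
      twice this difference.\<close>
    have "Re (ip h g) - Re (L h) = 0"
    proof (rule quadratic_minimum_at_0)
      show "0 \<le> nsq h" by (rule nonneg[OF h])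
      fix t :: real
      let ?th = "cscale (complex_of_real t) h"
      have "J g \<le> J (g + ?th)" using Jg cle[OF in_add[OF g in_scale[OF h]], of "complex_of_real t"] by simp
      also have "J (g + ?th) = nsq g + 2 * t * Re (ip h g) + t\<^sup>2 * nsq h - 2 * Re (L g) - 2 * t * Re (L h)"
      proof -
        have "Re (ip g ?th) = t * Re (ip h g)" using g h by (simp add: scale_right Re_commute[of g h])
        then show ?thesis using g h in_scale[OF h, of "complex_of_real t"]
          by (simp add: J_def expand_add Ladd Lscale expand_scale[OF h])
      qed
      finally show "0 \<le> 2 * t * (Re (ip h g) - Re (L h)) + t\<^sup>2 * nsq h"
        by (simp add: J_def algebra_simps)
    qed
    then show ?thesis by simp
  qed
  show thesis
  proof (rule that[OF g])
    fix h assume h: "h \<in> H"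
    \<comment> \<open>Only real parts are known so far; testing with i times \<open>h\<close> yields
      the imaginary parts.\<close>
    have "Re (ip (cscale \<i> h) g) = Re (L (cscale \<i> h))" by (intro Re_eq in_scale h)
    then have "Im (ip h g) = Im (L h)" using h g by (simp add: scale_left Lscale)
    with Re_eq[OF h] show "ip h g = L h" by (simp add: complex_eq_iff)
  qed
qed

end

section \<open>Eigenvectors of forms with bounded trace\<close>

lemma finite_common_subsequence:
  fixes c :: "nat \<Rightarrow> 'i \<Rightarrow> complex"
  assumes "finite I" and "\<And>n i. i \<in> I \<Longrightarrow> cmod (c n i) \<le> b"
  shows "\<exists>r::nat \<Rightarrow> nat. strict_mono r \<and> (\<forall>i\<in>I. convergent (\<lambda>n. c (r n) i))"
  using assms
proof (induction I)
  case empty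
  then show ?case using strict_mono_id by (auto intro!: exI[of _ id] strict_monoI)
next
  case (insert x I)
  then obtain r where r: "strict_mono r" "\<forall>i\<in>I. convergent (\<lambda>n. c (r n) i)" by auto
  have "bounded (range (\<lambda>n. c (r n) x))"
    using insert.prems[of x] by (auto intro!: boundedI[of _ b])
  from bounded_imp_convergent_subsequence[OF this] obtain l s
    where s: "strict_mono s" "((\<lambda>n. c (r n) x) \<circ> s) \<longlonglongrightarrow> l" by auto
  have "convergent (\<lambda>n. c ((r \<circ> s) n) i)" if "i \<in> insert x I" for i
  proof (cases "i = x")
    case True
    then show ?thesis using s(2) by (auto simp: convergent_def o_def)
  next
    case False
    with that r(2) obtain l' where "(\<lambda>n. c (r n) i) \<longlonglongrightarrow> l'" by (auto simp: convergent_def)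
    from LIMSEQ_subseq_LIMSEQ[OF this s(1)] show ?thesis by (auto simp: convergent_def o_def)
  qed
  then show ?case using strict_mono_o[OF r(1) s(1)] by blast
qed

context hilbert_function_space
begin

text \<open>On the orthogonal complement of a finite orthonormal family with almost maximal trace the form is
  at most half its supremum \<open>\<mu>\<close>. Hence a maximising sequence converges as soon as its finitely many
  coefficients do; this takes the place of compactness.\<close>

lemma form_eigenvector:
  fixes B :: "('a \<Rightarrow> complex) \<Rightarrow> ('a \<Rightarrow> complex) \<Rightarrow> complex"
  assumes "psd_form H B"
    and trace: "\<And>I u. finite I \<Longrightarrow> quasi_orthonormal (I :: nat set) u \<Longrightarrow> (\<Sum>i\<in>I. Re (B (u i) (u i))) \<le> C"
    and h0: "h0 \<in> H" "Re (B h0 h0) > 0"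
  obtains f \<mu> where "f \<in> H" "nsq f = 1" "\<mu> > 0" "\<And>h. h \<in> H \<Longrightarrow> B h f = complex_of_real \<mu> * ip h f"
proof -
  interpret B: psd_form H B by fact
  let ?S = "{f \<in> H. nsq f = 1}"
  define \<mu> where "\<mu> = (SUP f\<in>?S. Re (B f f))"
  have upC: "Re (B f f) \<le> C" if "f \<in> H" "nsq f = 1" for f
  proof -
    have "ip f f = 1" using that self_real[of f] by simp
    then have "quasi_orthonormal {0::nat} (\<lambda>_. f)" using that by (simp add: quasi_orthonormal_def)
    from trace[OF _ this] show ?thesis by simp
  qed
  have normalise: "\<exists>c. c \<noteq> 0 \<and> nsq (cscale c f) = 1" if "f \<in> H" "f \<noteq> 0" for f
  proof -
    have "nsq f > 0" using ip_pos that by blast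
    then have "nsq (cscale (complex_of_real (1 / sqrt (nsq f))) f) = 1"
      using that by (simp add: expand_scale norm_divide power_divide)
    with \<open>nsq f > 0\<close> show ?thesis by (intro exI[of _ "complex_of_real (1 / sqrt (nsq f))"]) auto
  qed
  have bdd: "bdd_above ((\<lambda>f. Re (B f f)) ` ?S)" using upC by (intro bdd_aboveI[of _ C]) auto
  have up: "Re (B f f) \<le> \<mu> * nsq f" if f: "f \<in> H" for f
  proof (cases "f = 0")
    case True
    then show ?thesis using B.zero_left[OF in_zero] zero_left[OF in_zero] by simp
  next
    case False
    then obtain c where c: "c \<noteq> 0" "nsq (cscale c f) = 1" using normalise f by blast
    have "Re (B (cscale c f) (cscale c f)) \<le> \<mu>"
      unfolding \<mu>_def using f c by (intro cSUP_upper bdd) (auto intro: in_scale)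
    then have *: "(cmod c)\<^sup>2 * Re (B f f) \<le> \<mu>" using f by (simp add: B.expand_scale)
    have **: "(cmod c)\<^sup>2 * nsq f = 1" using f c by (simp add: expand_scale)
    have "(cmod c)\<^sup>2 * Re (B f f) \<le> (cmod c)\<^sup>2 * (\<mu> * nsq f)"
      using * ** by (simp add: mult.left_commute)
    then show ?thesis using c(1) by (simp add: mult_le_cancel_left_pos)
  qed
  have h0ne: "h0 \<noteq> 0" using h0 B.zero_left[OF in_zero] by auto
  have \<mu>pos: "\<mu> > 0"
  proof -
    have "0 < \<mu> * nsq h0" using up[OF h0(1)] h0(2) by linarith
    then show ?thesis using nonneg[OF h0(1)] by (simp add: zero_less_mult_iff)
  qed
  have Sne: "?S \<noteq> {}" using normalise[OF h0(1) h0ne] h0(1) in_scale by blast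

  define TR where "TR = {(\<Sum>i\<in>I. Re (B (u i) (u i))) | (I :: nat set) u. finite I \<and> quasi_orthonormal I u}"
  have "quasi_orthonormal ({} :: nat set) (\<lambda>_. 0)" by (simp add: quasi_orthonormal_def)
  then have TRne: "TR \<noteq> {}" unfolding TR_def by blast
  have TRb: "bdd_above TR" using trace unfolding TR_def by (intro bdd_aboveI[of _ C]) auto
  have "\<exists>x\<in>TR. Sup TR - \<mu> / 2 < x"
    using less_cSupD[OF TRne, of "Sup TR - \<mu> / 2"] \<mu>pos by auto
  then obtain I :: "nat set" and u where I: "finite I" and u: "quasi_orthonormal I u"
    and Iu: "Sup TR - \<mu> / 2 < (\<Sum>i\<in>I. Re (B (u i) (u i)))"
    unfolding TR_def by auto
  note uD = quasi_orthonormalD[OF u]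
  have small: "Re (B f f) \<le> \<mu> / 2 * nsq f" if f: "f \<in> H" and orth: "\<And>i. i \<in> I \<Longrightarrow> ip f (u i) = 0" for f
  proof (cases "f = 0")
    case True
    then show ?thesis using B.zero_left[OF in_zero] zero_left[OF in_zero] by simp
  next
    case False
    then obtain c where c: "c \<noteq> 0" "nsq (cscale c f) = 1" using normalise f by blast
    \<comment> \<open>Appending the normalised \<open>f\<close> to the family at a fresh index
      raises the trace by its form value, which therefore cannot exceed the gap
      \<open>\<mu> / 2\<close> to \<open>Sup TR\<close>.\<close>
    obtain x where x: "x \<notin> I" using I ex_new_if_finite by blast
    define v where "v i = (if i = x then cscale c f else u i)" for i
    have v1: "ip (cscale c f) (cscale c f) = 1" using self_real[OF in_scale[OF f], of c] unfolding c(2) by simp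
    have "ip (u i) f = 0" if "i \<in> I" for i
      using orth[OF that] ip_cnj[OF f uD(1)[OF that]] by simp
    then have "quasi_orthonormal (insert x I) v"
      unfolding quasi_orthonormal_def v_def using x f c orth uD v1
      by (auto simp: in_scale scale_left scale_right)
    then have "(\<Sum>i\<in>insert x I. Re (B (v i) (v i))) \<in> TR" unfolding TR_def using I by blast
    then have "(\<Sum>i\<in>insert x I. Re (B (v i) (v i))) \<le> Sup TR" using TRb by (rule cSup_upper)
    moreover have "(\<Sum>i\<in>insert x I. Re (B (v i) (v i))) =
        Re (B (cscale c f) (cscale c f)) + (\<Sum>i\<in>I. Re (B (u i) (u i)))"
    proof -
      have "(\<Sum>i\<in>I. Re (B (v i) (v i))) = (\<Sum>i\<in>I. Re (B (u i) (u i)))"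
        using x by (intro sum.cong) (auto simp: v_def)
      then show ?thesis using x I by (simp add: v_def)
    qed
    ultimately have *: "(cmod c)\<^sup>2 * Re (B f f) \<le> \<mu> / 2"
      using Iu B.expand_scale[OF f] by simp
    have **: "(cmod c)\<^sup>2 * nsq f = 1" using f c by (simp add: expand_scale)
    have "(cmod c)\<^sup>2 * Re (B f f) \<le> (cmod c)\<^sup>2 * (\<mu> / 2 * nsq f)"
      using * ** by (simp add: mult.left_commute)
    then show ?thesis using c(1) by (simp add: mult_le_cancel_left_pos)
  qed

  have "\<exists>f\<in>?S. \<mu> - 1 / real (Suc n) < Re (B f f)" for n
    using less_cSupD[of "(\<lambda>f. Re (B f f)) ` ?S" "\<mu> - 1 / real (Suc n)"] Sne
    unfolding \<mu>_def by auto
  then obtain F0 where F0: "\<And>n. F0 n \<in> H" "\<And>n. nsq (F0 n) = 1" "\<And>n. \<mu> - 1 / real (Suc n) < Re (B (F0 n) (F0 n))"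
    by simp metis
  have "cmod (ip (F0 n) (u i)) \<le> 1" if "i \<in> I" for n i
  proof -
    have "(cmod (ip (F0 n) (u i)))\<^sup>2 \<le> nsq (F0 n) * nsq (u i)"
      using F0 uD(1)[OF that] by (intro Cauchy_Schwarz)
    also have "\<dots> \<le> 1" using uD(2)[OF that] zero_left[OF in_zero] F0(2)[of n] by auto
    finally show ?thesis by (simp add: abs_square_le_1)
  qed
  from finite_common_subsequence[OF I, of "\<lambda>n i. ip (F0 n) (u i)", OF this]
  obtain r :: "nat \<Rightarrow> nat" where r: "strict_mono r" "\<forall>i\<in>I. convergent (\<lambda>n. ip (F0 (r n)) (u i))" by auto
  define F where "F n = F0 (r n)" for n
  have F: "\<And>n. F n \<in> H" "\<And>n. nsq (F n) = 1" by (simp_all add: F_def F0)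
  have FB: "\<mu> - 1 / real (Suc n) \<le> Re (B (F n) (F n))" for n
  proof -
    have "1 / real (Suc (r n)) \<le> 1 / real (Suc n)"
      using seq_suble[OF r(1), of n] by (intro divide_left_mono) auto
    then show ?thesis using F0(3)[of "r n"] by (simp add: F_def)
  qed
  have BFn: "Re (B (F n) (F n)) \<le> \<mu>" for n using up[OF F(1)[of n]] F(2)[of n] by simp
  define s where "s i j = (\<Sum>k\<in>I. (cmod (ip (F i) (u k) - ip (F j) (u k)))\<^sup>2)" for i j
  \<comment> \<open>The parallelogram identity for both forms, with \<open>\<mu>\<close> bounding
    the form of \<open>F i + F j\<close>, leaves \<open>\<mu> * nsq (F i - F j)\<close> below the
    form of the difference up to the defects of \<open>F i\<close> and \<open>F j\<close>. That form
    is split at the projection \<open>p\<close>: the family part gives \<open>s i j\<close>, and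
    \<open>small\<close> lets the rest be absorbed.\<close>
  have key: "\<mu> * nsq (F i - F j) \<le> 8 * (1 / real (Suc i) + 1 / real (Suc j)) + 12 * \<mu> * s i j" for i j
  proof -
    let ?g = "F i - F j"
    have g: "?g \<in> H" using F in_diff by blast
    define p where "p = (\<Sum>k\<in>I. cscale (ip ?g (u k)) (u k))"
    note res = residual[OF u I g, folded p_def]
    have sq: "nsq p = s i j" using F uD(1) by (simp add: res(3) s_def diff_left)
    have a: "Re (B p p) \<le> \<mu> * s i j" using up[OF res(1)] sq by simp
    have b: "Re (B (?g - p) (?g - p)) \<le> \<mu> / 2 * nsq ?g"
    proof -
      have "nsq (?g - p) \<le> nsq ?g" unfolding res(4) by (simp add: sum_nonneg)
      then have "\<mu> / 2 * nsq (?g - p) \<le> \<mu> / 2 * nsq ?g" using \<mu>pos by (intro mult_left_mono) auto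
      moreover have "Re (B (?g - p) (?g - p)) \<le> \<mu> / 2 * nsq (?g - p)"
        using res(1,2) g in_diff by (intro small) auto
      ultimately show ?thesis by simp
    qed
    have "Re (B ?g ?g) \<le> 3 * Re (B p p) + 3 / 2 * Re (B (?g - p) (?g - p))"
      using B.split_bound[OF res(1) in_diff[OF g res(1)]] by simp
    then have 1: "Re (B ?g ?g) \<le> 3 * \<mu> * s i j + 3 / 4 * \<mu> * nsq ?g" using a b by simp
    have "Re (B (F i + F j) (F i + F j)) \<le> \<mu> * nsq (F i + F j)" using F by (intro up in_add)
    then have 2: "2 * Re (B (F i) (F i)) + 2 * Re (B (F j) (F j)) - Re (B ?g ?g) \<le> \<mu> * (4 - nsq ?g)"
      using F by (simp add: expand_add expand_diff B.expand_add B.expand_diff algebra_simps)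
    show ?thesis using 1 2 FB[of i] FB[of j] by (simp add: algebra_simps)
  qed
  obtain f where f: "f \<in> H" and lim: "(\<lambda>i. nsq (F i - f)) \<longlonglongrightarrow> 0"
  proof (rule complete_nsq[OF F(1)])
    fix \<epsilon> :: real assume "\<epsilon> > 0"
    then have e: "\<epsilon> * \<mu> / 4 / 8 > 0" using \<mu>pos by simp
    then obtain N1 where N1: "1 / real (Suc N1) < \<epsilon> * \<mu> / 4 / 8" using nat_approx_posE by blast
    \<comment> \<open>This choice keeps the coefficient term of \<open>key\<close> below a quarter
      of \<open>\<epsilon> * \<mu>\<close>, while \<open>N1\<close> keeps the defects below a half;
      the \<open>+ 1\<close> covers an empty family.\<close>
    define d where "d = sqrt (\<epsilon> / (48 * (real (card I) + 1)))"
    have d: "d > 0" using \<open>\<epsilon> > 0\<close> by (simp add: d_def)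
    have "\<exists>N. \<forall>k\<in>I. \<forall>i\<ge>N. \<forall>j\<ge>N. cmod (ip (F i) (u k) - ip (F j) (u k)) < d"
    proof -
      have "\<exists>N. \<forall>i\<ge>N. \<forall>j\<ge>N. cmod (ip (F i) (u k) - ip (F j) (u k)) < d" if "k \<in> I" for k
      proof -
        have "Cauchy (\<lambda>n. ip (F n) (u k))" using r(2) that convergent_Cauchy unfolding F_def by auto
        then show ?thesis using d by (simp add: Cauchy_iff)
      qed
      then obtain N where N: "\<forall>k\<in>I. \<forall>i\<ge>N k. \<forall>j\<ge>N k. cmod (ip (F i) (u k) - ip (F j) (u k)) < d" by metis
      have "N k \<le> sum N I" if "k \<in> I" for k using member_le_sum[of k I N] that I by simp
      then show ?thesis using N by (intro exI[of _ "sum N I"]) (meson order_trans)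
    qed
    then obtain N2 where N2: "\<And>k i j. k \<in> I \<Longrightarrow> i \<ge> N2 \<Longrightarrow> j \<ge> N2 \<Longrightarrow> cmod (ip (F i) (u k) - ip (F j) (u k)) < d" by blast
    have "nsq (F i - F j) < \<epsilon>" if ij: "i \<ge> max N1 N2" "j \<ge> max N1 N2" for i j
    proof -
      have "1 / real (Suc i) \<le> 1 / real (Suc N1)" "1 / real (Suc j) \<le> 1 / real (Suc N1)"
        using ij by (auto intro!: divide_left_mono)
      then have A: "8 * (1 / real (Suc i) + 1 / real (Suc j)) < \<epsilon> * \<mu> / 2" using N1 by simp
      have "s i j \<le> (\<Sum>k\<in>I. d\<^sup>2)"
        unfolding s_def using ij by (intro sum_mono power_mono less_imp_le[OF N2]) auto
      also have "\<dots> = real (card I) * (\<epsilon> / (48 * (real (card I) + 1)))"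
        using \<open>\<epsilon> > 0\<close> by (simp add: d_def)
      also have "\<dots> \<le> \<epsilon> / 48" using \<open>\<epsilon> > 0\<close> by (simp add: field_simps)
      finally have "12 * \<mu> * s i j \<le> 12 * \<mu> * (\<epsilon> / 48)" using \<mu>pos by (intro mult_left_mono) auto
      moreover have "12 * \<mu> * (\<epsilon> / 48) = \<epsilon> * \<mu> / 4" by simp
      ultimately have "\<mu> * nsq (F i - F j) < \<epsilon> * \<mu>"
        using key[of i j] A mult_pos_pos[OF \<open>\<epsilon> > 0\<close> \<mu>pos] by linarith
      then show ?thesis using \<mu>pos by (simp add: mult.commute)
    qed
    then show "\<exists>N. \<forall>i\<ge>N. \<forall>j\<ge>N. nsq (F i - F j) < \<epsilon>" by blast
  qed
  have nf: "nsq f = 1"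
  proof -
    have "(\<lambda>i. nsq (F i - f) - nsq (F i) + 2 * Re (ip (F i) f)) \<longlonglongrightarrow> 0 - 1 + 2 * Re (ip f f)"
      unfolding F(2) by (intro tendsto_intros lim tendsto_Re ip_tendsto[OF F(1) f f lim])
    moreover have "nsq (F i - f) - nsq (F i) + 2 * Re (ip (F i) f) = nsq f" for i
      using F f by (simp add: expand_diff)
    ultimately have "(\<lambda>i::nat. nsq f) \<longlonglongrightarrow> 0 - 1 + 2 * nsq f" by simp
    then have "nsq f = 0 - 1 + 2 * nsq f" by (rule LIMSEQ_unique[OF tendsto_const])
    then show ?thesis by simp
  qed
  have Bf: "Re (B f f) \<ge> \<mu>"
  proof -
    have limB: "(\<lambda>i. Re (B (F i - f) f)) \<longlonglongrightarrow> 0"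
    proof -
      have "(\<lambda>i. (cmod (B (F i - f) f))\<^sup>2) \<longlonglongrightarrow> 0"
      proof (rule tendsto_sandwich)
        show "\<forall>\<^sub>F i in sequentially. (cmod (B (F i - f) f))\<^sup>2 \<le> \<mu> * nsq (F i - f) * Re (B f f)"
          using B.Cauchy_Schwarz[OF in_diff[OF F(1) f] f] up[OF in_diff[OF F(1) f]] B.nonneg[OF f]
          by (intro always_eventually allI) (meson mult_right_mono order_trans)
        show "\<forall>\<^sub>F i in sequentially. 0 \<le> (cmod (B (F i - f) f))\<^sup>2" by simp
        show "(\<lambda>i. \<mu> * nsq (F i - f) * Re (B f f)) \<longlonglongrightarrow> 0"
          using tendsto_mult_right[OF tendsto_mult_left[OF lim, of \<mu>], of "Re (B f f)"] by simp
      qed simp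
      then have "(\<lambda>i. sqrt ((cmod (B (F i - f) f))\<^sup>2)) \<longlonglongrightarrow> sqrt 0" by (rule tendsto_real_sqrt)
      then have "(\<lambda>i. B (F i - f) f) \<longlonglongrightarrow> 0" by (simp add: tendsto_norm_zero_iff)
      from tendsto_Re[OF this] show ?thesis by simp
    qed
    have "(\<lambda>i. \<mu> - 1 / real (Suc i) - \<mu> * nsq (F i - f) - 2 * Re (B (F i - f) f)) \<longlonglongrightarrow> \<mu> - 0 - \<mu> * 0 - 2 * 0"
      by (intro tendsto_intros lim limB LIMSEQ_Suc lim_1_over_n)
    moreover have "\<mu> - 1 / real (Suc i) - \<mu> * nsq (F i - f) - 2 * Re (B (F i - f) f) \<le> Re (B f f)" for i
    proof -
      have "Re (B (F i) (F i)) = Re (B ((F i - f) + f) ((F i - f) + f))" by simp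
      also have "\<dots> = Re (B (F i - f) (F i - f)) + 2 * Re (B (F i - f) f) + Re (B f f)"
        using F f by (intro B.expand_add in_diff)
      finally show ?thesis using FB[of i] up[OF in_diff[OF F(1) f], of i] by linarith
    qed
    ultimately have "\<mu> - 0 - \<mu> * 0 - 2 * 0 \<le> Re (B f f)" by (intro LIMSEQ_le_const2) auto
    then show ?thesis by simp
  qed
  \<comment> \<open>The defect form is semidefinite and vanishes at the maximiser \<open>f\<close>,
    so by Cauchy-Schwarz it vanishes whenever one argument is \<open>f\<close>. This is the
    eigenvalue equation.\<close>
  interpret Q: psd_form H "\<lambda>g h. complex_of_real \<mu> * ip g h - B g h"
  proof
    show "0 \<le> Re (complex_of_real \<mu> * ip h h - B h h)" if "h \<in> H" for h using up[OF that] by simp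
    show "complex_of_real \<mu> * ip h g - B h g = cnj (complex_of_real \<mu> * ip g h - B g h)"
      if "g \<in> H" "h \<in> H" for g h using that ip_cnj[of g h] B.cnj_sym[of g h] by simp
  qed (simp_all add: sub add_left scale_left B.add_left B.scale_left algebra_simps)
  have "B h f = complex_of_real \<mu> * ip h f" if h: "h \<in> H" for h
  proof -
    have "Re (complex_of_real \<mu> * ip f f - B f f) \<le> 0" using Bf nf by simp
    then have "(cmod (complex_of_real \<mu> * ip h f - B h f))\<^sup>2 \<le> 0"
      using Q.Cauchy_Schwarz[OF h f] Q.nonneg[OF h] by (meson mult_nonneg_nonpos order_trans)
    then show ?thesis by simp
  qed
  with f nf \<mu>pos that show thesis by blast
qed

end

section \<open>Spectral decomposition of finite frame operators\<close>

definition cdot :: "nat \<Rightarrow> (nat \<Rightarrow> complex) \<Rightarrow> (nat \<Rightarrow> complex) \<Rightarrow> complex" where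
  "cdot d f g = (\<Sum>k<d. f k * cnj (g k))"

text \<open>The space of complex \<open>d\<close>-tuples, encoded by sequences that vanish from
  index \<open>d\<close> on; in this shape it is a \<open>hilbert_function_space\<close>, so that
  \<open>form_eigenvector\<close> also diagonalises matrices.\<close>

definition cspace :: "nat \<Rightarrow> (nat \<Rightarrow> complex) set" where
  "cspace d = {f. \<forall>k\<ge>d. f k = 0}"

lemma cdot_add_left: "cdot d (f + g) h = cdot d f h + cdot d g h"
  by (simp add: cdot_def algebra_simps sum.distrib)

lemma cdot_scale_left: "cdot d (cscale c f) g = c * cdot d f g"
  by (simp add: cdot_def cscale_def sum_distrib_left mult.assoc)

lemma cdot_cnj: "cdot d g f = cnj (cdot d f g)"
  by (simp add: cdot_def mult.commute)

lemma cdot_self: "cdot d f f = complex_of_real (\<Sum>k<d. (cmod (f k))\<^sup>2)"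
  by (simp add: cdot_def complex_norm_square flip: of_real_power)

lemma cspace_subspace: "cfun.subspace (cspace d)"
  by (simp add: cfun.subspace_def cspace_def cscale_def zero_fun_def)

lemma hilbert_cspace: "hilbert_function_space {..<d} (cspace d) (cdot d)"
proof
  show "cfun.subspace (cspace d)" by (rule cspace_subspace)
next
  fix f :: "nat \<Rightarrow> complex" assume f: "f \<in> cspace d" "f \<noteq> 0"
  then obtain k where k: "f k \<noteq> 0" by (auto simp: zero_fun_def)
  with f have "k < d" by (auto simp: cspace_def not_le[symmetric])
  have "0 < (\<Sum>k<d. (cmod (f k))\<^sup>2)"
    using k \<open>k < d\<close> by (intro sum_pos2[of _ k]) auto
  then show "0 < Re (cdot d f f)" by (simp add: cdot_self)
next
  fix F :: "nat \<Rightarrow> nat \<Rightarrow> complex"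
  assume F: "\<And>i. F i \<in> cspace d"
    and C: "\<And>\<epsilon>. \<epsilon> > 0 \<Longrightarrow> \<exists>N. \<forall>i\<ge>N. \<forall>j\<ge>N. hnorm (cdot d) (F i - F j) < \<epsilon>"
  have "convergent (\<lambda>i. F i k)" for k
  proof (cases "k < d")
    case True
    have le: "cmod (F i k - F j k) \<le> hnorm (cdot d) (F i - F j)" for i j
      unfolding hnorm_def using member_le_sum[of k "{..<d}" "\<lambda>k. (cmod (F i k - F j k))\<^sup>2"] True
      by (intro real_le_rsqrt) (simp add: cdot_self)
    have "Cauchy (\<lambda>i. F i k)"
      unfolding Cauchy_iff using C le by (meson le_less_trans)
    then show ?thesis by (rule Cauchy_convergent)
  qed (use F in \<open>simp add: cspace_def convergent_const\<close>)
  then obtain f where f: "\<And>k. (\<lambda>i. F i k) \<longlonglongrightarrow> f k" unfolding convergent_def by metis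
  have "f k = 0" if "k \<ge> d" for k
    using f[of k] F that LIMSEQ_unique[OF tendsto_const, of 0 "f k"] by (simp add: cspace_def)
  then have fC: "f \<in> cspace d" by (simp add: cspace_def)
  have "(\<lambda>i. sqrt (\<Sum>k<d. (cmod (F i k - f k))\<^sup>2)) \<longlonglongrightarrow> sqrt (\<Sum>k<d. (cmod (f k - f k))\<^sup>2)"
    by (intro tendsto_intros f)
  then show "\<exists>f\<in>cspace d. (\<lambda>i. hnorm (cdot d) (F i - f)) \<longlonglongrightarrow> 0"
    using fC by (intro bexI[of _ f]) (simp_all add: hnorm_def cdot_self)
qed (simp_all add: cdot_add_left cdot_scale_left cdot_cnj[symmetric] cspace_def)

text \<open>Orthogonal complements are closed and so inherit completeness. This allows
  \<open>form_eigenvector\<close> to be applied again after known eigenvectors are split off, both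
  in \<open>partial_eigenbasis\<close> and in \<open>complete_e\<close>.\<close>

lemma (in hilbert_function_space) hilbert_orthogonal:
  assumes u: "\<And>i. i \<in> I \<Longrightarrow> u i \<in> H"
  shows "hilbert_function_space D {f \<in> H. \<forall>i\<in>I. ip f (u i) = 0} ip" (is "hilbert_function_space D ?O ip")
proof
  show "cfun.subspace ?O"
    unfolding cfun.subspace_def using u by (auto simp: in_intros add_left scale_left zero_left)
next
  fix F assume F: "\<And>i::nat. F i \<in> ?O"
    and C: "\<And>\<epsilon>. \<epsilon> > 0 \<Longrightarrow> \<exists>N. \<forall>i\<ge>N. \<forall>j\<ge>N. hnorm ip (F i - F j) < \<epsilon>"
  have FH: "F i \<in> H" for i using F by auto
  from complete[OF FH C] obtain f where f: "f \<in> H" "(\<lambda>i. hnorm ip (F i - f)) \<longlonglongrightarrow> 0" by auto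
  have lim: "(\<lambda>i. nsq (F i - f)) \<longlonglongrightarrow> 0"
    using tendsto_power[OF f(2), of 2] f(1) FH by (simp add: hnorm_sq in_diff)
  have "ip f (u k) = 0" if "k \<in> I" for k
  proof -
    have "(\<lambda>i. ip (F i) (u k)) \<longlonglongrightarrow> ip f (u k)" by (rule ip_tendsto[OF FH f(1) u[OF that] lim])
    moreover have "ip (F i) (u k) = 0" for i using F that by auto
    ultimately show ?thesis using LIMSEQ_unique[of "\<lambda>_. 0" "ip f (u k)" 0] by simp
  qed
  with f show "\<exists>f\<in>?O. (\<lambda>i. hnorm ip (F i - f)) \<longlonglongrightarrow> 0" by blast
qed (auto simp: support ip_add ip_scale ip_pos intro: ip_cnj)

lemma psd_form_subset:
  assumes "psd_form H B" "cfun.subspace G" "G \<subseteq> H" shows "psd_form G B"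
proof -
  interpret psd_form H B by fact
  show ?thesis using assms(2,3) by unfold_locales (auto simp: add_left scale_left nonneg subset_iff intro: cnj_sym)
qed

definition frame_mat :: "'j set \<Rightarrow> ('j \<Rightarrow> nat \<Rightarrow> complex) \<Rightarrow> nat \<Rightarrow> nat \<Rightarrow> complex" where
  "frame_mat J y k l = (\<Sum>j\<in>J. y j k * cnj (y j l))"

text \<open>Both unitarity relations are recorded: the first turns traces into sums over
  eigenvalues, the second gives expansions and the Parseval identity.\<close>

definition eigenbasis :: "nat \<Rightarrow> (nat \<Rightarrow> nat \<Rightarrow> complex) \<Rightarrow> (nat \<Rightarrow> nat \<Rightarrow> complex) \<Rightarrow> (nat \<Rightarrow> real) \<Rightarrow> bool" where
  "eigenbasis d A u \<mu> \<longleftrightarrow>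
     (\<forall>i<d. \<forall>j<d. cdot d (u i) (u j) = of_bool (i = j)) \<and>
     (\<forall>k<d. \<forall>l<d. (\<Sum>i<d. u i k * cnj (u i l)) = of_bool (k = l)) \<and>
     (\<forall>i<d. \<forall>k<d. (\<Sum>l<d. A k l * u i l) = complex_of_real (\<mu> i) * u i k)"

lemma frame_form:
  "(\<Sum>j\<in>J. cdot d f (y j) * cnj (cdot d g (y j))) = cdot d (\<lambda>k. \<Sum>l<d. frame_mat J y k l * f l) g"
proof -
  have "(\<Sum>j\<in>J. cdot d f (y j) * cnj (cdot d g (y j)))
      = (\<Sum>j\<in>J. \<Sum>l<d. \<Sum>k<d. f l * cnj (y j l) * (cnj (g k) * y j k))"
    by (simp add: cdot_def sum_product)
  also have "\<dots> = (\<Sum>l<d. \<Sum>j\<in>J. \<Sum>k<d. f l * cnj (y j l) * (cnj (g k) * y j k))"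
    by (rule sum.swap)
  also have "\<dots> = (\<Sum>l<d. \<Sum>k<d. \<Sum>j\<in>J. f l * cnj (y j l) * (cnj (g k) * y j k))"
    by (intro sum.cong refl sum.swap)
  also have "\<dots> = (\<Sum>k<d. \<Sum>l<d. \<Sum>j\<in>J. f l * cnj (y j l) * (cnj (g k) * y j k))"
    by (rule sum.swap)
  also have "\<dots> = cdot d (\<lambda>k. \<Sum>l<d. frame_mat J y k l * f l) g"
    by (simp add: cdot_def frame_mat_def sum_distrib_left sum_distrib_right mult_ac)
  finally show ?thesis .
qed

lemma frame_psd: "psd_form (cspace d) (\<lambda>f g. \<Sum>j\<in>J. cdot d f (y j) * cnj (cdot d g (y j)))"
proof
  show "0 \<le> Re (\<Sum>j\<in>J. cdot d f (y j) * cnj (cdot d f (y j)))" for f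
    by (simp add: sum_nonneg)
qed (simp_all add: cspace_subspace cdot_add_left cdot_scale_left algebra_simps sum.distrib sum_distrib_left)

text \<open>Deflation: the next vector is an eigenvector of the form restricted to the orthogonal
  complement of the earlier ones. It is one on the whole space because the earlier eigenvectors are
  orthogonal to it for \<open>cdot\<close> and for the frame form alike.\<close>

lemma partial_eigenbasis:
  assumes J: "finite J" and "n \<le> d"
  shows "\<exists>u \<mu>. \<forall>i<n. u i \<in> cspace d \<and> (\<forall>j<n. cdot d (u i) (u j) = of_bool (i = j)) \<and>
    (\<forall>f\<in>cspace d. (\<Sum>j\<in>J. cdot d f (y j) * cnj (cdot d (u i) (y j))) = complex_of_real (\<mu> i) * cdot d f (u i))"
  using \<open>n \<le> d\<close>
proof (induction n)
  case (Suc n)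
  obtain u \<mu> where U: "\<forall>i<n. u i \<in> cspace d \<and> (\<forall>j<n. cdot d (u i) (u j) = of_bool (i = j)) \<and>
    (\<forall>f\<in>cspace d. (\<Sum>j\<in>J. cdot d f (y j) * cnj (cdot d (u i) (y j))) = complex_of_real (\<mu> i) * cdot d f (u i))"
    using Suc.IH[OF Suc_leD[OF Suc.prems]] by (elim exE) (rule that)
  have u: "\<And>i. i < n \<Longrightarrow> u i \<in> cspace d"
    and orth: "\<And>i j. i < n \<Longrightarrow> j < n \<Longrightarrow> cdot d (u i) (u j) = of_bool (i = j)"
    and eig: "\<And>i f. i < n \<Longrightarrow> f \<in> cspace d \<Longrightarrow>
       (\<Sum>j\<in>J. cdot d f (y j) * cnj (cdot d (u i) (y j))) = complex_of_real (\<mu> i) * cdot d f (u i)"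
    using U by simp_all
  interpret C: hilbert_function_space "{..<d}" "cspace d" "cdot d" by (rule hilbert_cspace)
  let ?B = "\<lambda>f g. \<Sum>j\<in>J. cdot d f (y j) * cnj (cdot d g (y j))"
  interpret BC: psd_form "cspace d" ?B by (rule frame_psd)
  define O' where "O' = {f \<in> cspace d. \<forall>i\<in>{..<n}. cdot d f (u i) = 0}"
  interpret O: hilbert_function_space "{..<d}" O' "cdot d"
    unfolding O'_def by (rule C.hilbert_orthogonal) (simp add: u)
  interpret BO: psd_form O' ?B
    by (rule psd_form_subset[OF frame_psd O.sub]) (auto simp: O'_def)
  have Osub: "f \<in> cspace d" if "f \<in> O'" for f using that by (simp add: O'_def)
  have qo: "C.quasi_orthonormal {..<n} u"
    unfolding C.quasi_orthonormal_def using u orth by auto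
  define unit where "unit k = (\<lambda>l. of_bool (l = k) :: complex)" for k :: nat
  have unit: "unit k \<in> cspace d" "cdot d (unit k) (unit k) = 1" "cdot d (unit k) f = cnj (f k)" if "k < d" for k f
    using that by (auto simp: unit_def cspace_def cdot_def of_bool_def if_distrib[of "\<lambda>x. x * _"] cong: if_cong)
  \<comment> \<open>Dimension count: otherwise every \<open>unit k\<close> lies in the span of the
    \<open>n < d\<close> vectors already found, and the sum of all \<open>|u i k|^2\<close> equals
    both \<open>d\<close> and \<open>n\<close>.\<close>
  have "\<exists>g\<in>O'. g \<noteq> 0"
  proof (rule ccontr)
    assume no: "\<not> (\<exists>g\<in>O'. g \<noteq> 0)"
    have one: "(\<Sum>i<n. (cmod (u i k))\<^sup>2) = 1" if k: "k < d" for k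
    proof -
      let ?r = "unit k - (\<Sum>i<n. cscale (cdot d (unit k) (u i)) (u i))"
      note res = C.residual[OF qo _ unit(1)[OF k]]
      have "?r \<in> O'" unfolding O'_def using res(1,2) unit(1)[OF k] C.in_diff by auto
      with no have "?r = 0" by blast
      then have "Re (cdot d ?r ?r) = 0" using C.zero_left[OF C.in_zero] by simp
      with res(4) unit[OF k] show ?thesis by simp
    qed
    have "real d = (\<Sum>k<d. \<Sum>i<n. (cmod (u i k))\<^sup>2)" by (simp add: one)
    also have "\<dots> = (\<Sum>i<n. \<Sum>k<d. (cmod (u i k))\<^sup>2)" by (rule sum.swap)
    also have "\<dots> = (\<Sum>i<n. 1)"
    proof (intro sum.cong refl)
      fix i assume "i \<in> {..<n}"
      then have "complex_of_real (\<Sum>k<d. (cmod (u i k))\<^sup>2) = complex_of_real 1"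
        using orth[of i i] by (simp only: cdot_self[symmetric]) simp
      then show "(\<Sum>k<d. (cmod (u i k))\<^sup>2) = 1" by (simp only: of_real_eq_iff)
    qed
    finally show False using Suc.prems by simp
  qed
  then obtain g where g: "g \<in> O'" "g \<noteq> 0" by auto
  \<comment> \<open>\<open>form_eigenvector\<close> needs a vector with positive form value. If
    there is none, Cauchy-Schwarz makes every unit vector of \<open>O'\<close> an eigenvector with
    eigenvalue 0.\<close>
  have "\<exists>v \<nu>. v \<in> O' \<and> cdot d v v = 1 \<and> (\<forall>f\<in>O'. ?B f v = complex_of_real \<nu> * cdot d f v)"
  proof (cases "\<exists>h\<in>O'. Re (?B h h) > 0")
    case True
    then obtain h where h: "h \<in> O'" "Re (?B h h) > 0" by auto
    have tr: "(\<Sum>i\<in>I. Re (?B (w i) (w i))) \<le> (\<Sum>j\<in>J. \<Sum>k<d. (cmod (y j k))\<^sup>2)"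
      if I: "finite I" and w: "O.quasi_orthonormal (I :: nat set) w" for I w
    proof -
      have w': "C.quasi_orthonormal I w"
        using w unfolding O.quasi_orthonormal_def C.quasi_orthonormal_def by (auto simp: O'_def)
      have "(\<Sum>i\<in>I. Re (?B (w i) (w i))) = (\<Sum>i\<in>I. \<Sum>j\<in>J. (cmod (cdot d (w i) (y j)))\<^sup>2)"
        by (simp add: complex_norm_square[symmetric] flip: of_real_power)
      also have "\<dots> = (\<Sum>j\<in>J. \<Sum>i\<in>I. (cmod (cdot d (w i) (y j)))\<^sup>2)" by (rule sum.swap)
      also have "\<dots> \<le> (\<Sum>j\<in>J. \<Sum>k<d. (cmod (y j k))\<^sup>2)"
      proof (rule sum_mono)
        fix j
        define z where "z k = (if k < d then y j k else 0)" for k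
        have z: "z \<in> cspace d" by (simp add: z_def cspace_def)
        have "(\<Sum>i\<in>I. (cmod (cdot d z (w i)))\<^sup>2) \<le> Re (cdot d z z)"
          using C.Bessel[OF w' I z] .
        moreover have "cdot d z (w i) = cnj (cdot d (w i) (y j))" for i
          by (simp add: cdot_def z_def mult.commute)
        ultimately show "(\<Sum>i\<in>I. (cmod (cdot d (w i) (y j)))\<^sup>2) \<le> (\<Sum>k<d. (cmod (y j k))\<^sup>2)"
          by (simp add: cdot_self z_def)
      qed
      finally show ?thesis .
    qed
    obtain v \<nu> where v: "v \<in> O'" "O.nsq v = 1" "\<And>h. h \<in> O' \<Longrightarrow> ?B h v = complex_of_real \<nu> * cdot d h v"
      using O.form_eigenvector[OF BO.psd_form_axioms tr h] by metis
    then have "cdot d v v = 1" using O.self_real[OF v(1)] by simp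
    with v show ?thesis by blast
  next
    case False
    then have B0: "Re (?B h h) = 0" if "h \<in> O'" for h using BO.nonneg[OF that] that by fastforce
    define c where "c = complex_of_real (1 / sqrt (Re (cdot d g g)))"
    have pos: "Re (cdot d g g) > 0" using O.ip_pos g by blast
    have v: "cscale c g \<in> O'" using g O.in_scale by blast
    have "Re (cdot d (cscale c g) (cscale c g)) = 1"
      using pos unfolding O.expand_scale[OF g(1)] c_def by (simp add: norm_divide power_divide)
    then have "cdot d (cscale c g) (cscale c g) = 1" using O.self_real[OF v] by simp
    moreover have "?B f (cscale c g) = complex_of_real 0 * cdot d f (cscale c g)" if "f \<in> O'" for f
      using BO.Cauchy_Schwarz[OF that v] B0[OF v] by simp
    ultimately show ?thesis using v by blast
  qed
  then obtain v \<nu> where v: "v \<in> O'" "cdot d v v = 1" "\<And>f. f \<in> O' \<Longrightarrow> ?B f v = complex_of_real \<nu> * cdot d f v"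
    by auto
  have vC: "v \<in> cspace d" and vu: "\<And>i. i < n \<Longrightarrow> cdot d v (u i) = 0" using v(1) by (auto simp: O'_def)
  have uv: "\<And>i. i < n \<Longrightarrow> cdot d (u i) v = 0" using vu by (subst cdot_cnj) simp
  have full: "?B f v = complex_of_real \<nu> * cdot d f v" if f: "f \<in> cspace d" for f
  proof -
    define p where "p = (\<Sum>i<n. cscale (cdot d f (u i)) (u i))"
    note res = C.residual[OF qo finite_lessThan f, folded p_def]
    have O: "f - p \<in> O'" unfolding O'_def using res(1,2) f C.in_diff by auto
    have uB: "?B (u i) v = 0" if "i < n" for i
    proof -
      have "?B v (u i) = 0" using eig[OF that vC] vu[OF that] by simp
      then show ?thesis using BC.cnj_sym[OF vC u[OF that]] by simp
    qed
    have "cdot d p v = (\<Sum>i<n. cdot d (cscale (cdot d f (u i)) (u i)) v)"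
      unfolding p_def by (rule C.sum_left) (auto intro: C.in_scale u vC)
    then have pv: "cdot d p v = 0" by (simp add: cdot_scale_left uv)
    have "?B p v = (\<Sum>i<n. ?B (cscale (cdot d f (u i)) (u i)) v)"
      unfolding p_def by (rule BC.sum_left) (auto intro: C.in_scale u vC)
    also have "\<dots> = (\<Sum>i<n. cdot d f (u i) * ?B (u i) v)"
      by (intro sum.cong refl BC.scale_left) (auto intro: u vC)
    also have "\<dots> = 0" using uB by (intro sum.neutral) auto
    finally have "?B p v = 0" .
    with pv have "?B (f - p) v = ?B f v" "cdot d (f - p) v = cdot d f v"
      using BC.diff_left[OF f res(1) vC] C.diff_left[OF f res(1) vC] by simp_all
    then show ?thesis using v(3)[OF O] by simp
  qed
  show ?case
  proof (intro exI[of _ "u(n := v)"] exI[of _ "\<mu>(n := \<nu>)"] allI impI conjI ballI)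
    fix i assume "i < Suc n"
    then show "(u(n := v)) i \<in> cspace d" using u vC by (auto simp: less_Suc_eq)
    show "cdot d ((u(n := v)) i) ((u(n := v)) j) = of_bool (i = j)" if "j < Suc n" for j
      using \<open>i < Suc n\<close> that orth v(2) uv vu by (auto simp: less_Suc_eq)
    show "?B f ((u(n := v)) i) = complex_of_real ((\<mu>(n := \<nu>)) i) * cdot d f ((u(n := v)) i)"
      if "f \<in> cspace d" for f
      using \<open>i < Suc n\<close> that eig full by (auto simp: less_Suc_eq)
  qed
qed simp

text \<open>Completeness comes from counting: the squared residuals of the \<open>d\<close> unit
  vectors with respect to \<open>u\<close> sum to \<open>d - d = 0\<close>, so each of them
  vanishes. The formula for \<open>\<mu>\<close> shows that the eigenvalues are nonnegative.\<close>

lemma eigenbasis_exists: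
  assumes J: "finite J"
  obtains u \<mu> where "eigenbasis d (frame_mat J y) u \<mu>"
    "\<And>i. i < d \<Longrightarrow> \<mu> i = (\<Sum>j\<in>J. (cmod (cdot d (u i) (y j)))\<^sup>2)"
proof -
  obtain u \<mu> where U: "\<forall>i<d. u i \<in> cspace d \<and> (\<forall>j<d. cdot d (u i) (u j) = of_bool (i = j)) \<and>
    (\<forall>f\<in>cspace d. (\<Sum>j\<in>J. cdot d f (y j) * cnj (cdot d (u i) (y j))) = complex_of_real (\<mu> i) * cdot d f (u i))"
    using partial_eigenbasis[OF J order_refl, of d y] by (elim exE) (rule that)
  have u: "\<And>i. i < d \<Longrightarrow> u i \<in> cspace d"
    and orth: "\<And>i j. i < d \<Longrightarrow> j < d \<Longrightarrow> cdot d (u i) (u j) = of_bool (i = j)"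
    and eig: "\<And>i f. i < d \<Longrightarrow> f \<in> cspace d \<Longrightarrow>
       (\<Sum>j\<in>J. cdot d f (y j) * cnj (cdot d (u i) (y j))) = complex_of_real (\<mu> i) * cdot d f (u i)"
    using U by simp_all
  interpret C: hilbert_function_space "{..<d}" "cspace d" "cdot d" by (rule hilbert_cspace)
  have qo: "C.quasi_orthonormal {..<d} u"
    unfolding C.quasi_orthonormal_def using u orth by auto
  define unit where "unit k = (\<lambda>l. of_bool (l = k) :: complex)" for k :: nat
  have unit: "unit k \<in> cspace d" "cdot d (unit k) (unit k) = 1" "cdot d (unit k) f = cnj (f k)" if "k < d" for k f
    using that by (auto simp: unit_def cspace_def cdot_def of_bool_def if_distrib[of "\<lambda>x. x * _"] cong: if_cong)
  define r where "r k = unit k - (\<Sum>i<d. cscale (cdot d (unit k) (u i)) (u i))" for k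
  have rC: "r k \<in> cspace d" and rn: "Re (cdot d (r k) (r k)) = 1 - (\<Sum>i<d. (cmod (u i k))\<^sup>2)" if k: "k < d" for k
    using C.residual[OF qo finite_lessThan unit(1)[OF k]] unit[OF k] C.in_diff by (auto simp: r_def)
  have "(\<Sum>k<d. Re (cdot d (r k) (r k))) = real d - (\<Sum>k<d. \<Sum>i<d. (cmod (u i k))\<^sup>2)"
    by (simp add: rn sum_subtractf)
  also have "(\<Sum>k<d. \<Sum>i<d. (cmod (u i k))\<^sup>2) = (\<Sum>i<d. \<Sum>k<d. (cmod (u i k))\<^sup>2)" by (rule sum.swap)
  also have "\<dots> = (\<Sum>i<d. 1)"
  proof (intro sum.cong refl)
    fix i assume "i \<in> {..<d}"
    then have "complex_of_real (\<Sum>k<d. (cmod (u i k))\<^sup>2) = complex_of_real 1"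
      using orth[of i i] by (simp only: cdot_self[symmetric]) simp
    then show "(\<Sum>k<d. (cmod (u i k))\<^sup>2) = 1" by (simp only: of_real_eq_iff)
  qed
  finally have "(\<Sum>k<d. Re (cdot d (r k) (r k))) = 0" by simp
  then have r0: "r k = 0" if "k < d" for k
    using that C.nonneg[OF rC] by (subst (asm) sum_nonneg_eq_0_iff) (auto simp: C.nsq_eq_0 rC)
  have compl: "(\<Sum>i<d. u i l * cnj (u i k)) = of_bool (l = k)" if "k < d" "l < d" for k l
  proof -
    have "(\<Sum>i\<in>I. f i) l = (\<Sum>i\<in>I. f i l)" for I :: "nat set" and f :: "nat \<Rightarrow> nat \<Rightarrow> complex"
      by (induction I rule: infinite_finite_induct) simp_all
    then have "r k l = of_bool (l = k) - (\<Sum>i<d. u i l * cnj (u i k))"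
      using unit(3)[OF that(1)] by (simp add: r_def unit_def cscale_def mult.commute)
    then show ?thesis using r0[OF that(1)] by simp
  qed
  have ev: "(\<Sum>l<d. frame_mat J y k l * u i l) = complex_of_real (\<mu> i) * u i k" if "i < d" "k < d" for i k
  proof -
    have "cdot d (\<lambda>k. \<Sum>l<d. frame_mat J y k l * unit k' l) (u i) = complex_of_real (\<mu> i) * cdot d (unit k') (u i)"
      if "k' < d" for k' using eig[OF \<open>i < d\<close> unit(1)[OF that]] by (simp add: frame_form)
    from this[OF \<open>k < d\<close>] have "(\<Sum>l<d. frame_mat J y l k * cnj (u i l)) = complex_of_real (\<mu> i) * cnj (u i k)"
      using unit(3)[OF \<open>k < d\<close>] \<open>k < d\<close>
      by (simp add: cdot_def unit_def of_bool_def if_distrib[of "\<lambda>x. _ * x"] cong: if_cong)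
    then have "cnj (\<Sum>l<d. frame_mat J y l k * cnj (u i l)) = cnj (complex_of_real (\<mu> i) * cnj (u i k))" by simp
    moreover have "cnj (frame_mat J y l k) = frame_mat J y k l" for l k
      by (simp add: frame_mat_def mult.commute)
    ultimately show ?thesis by simp
  qed
  have \<mu>: "\<mu> i = (\<Sum>j\<in>J. (cmod (cdot d (u i) (y j)))\<^sup>2)" if "i < d" for i
  proof -
    have "complex_of_real (\<mu> i) = (\<Sum>j\<in>J. cdot d (u i) (y j) * cnj (cdot d (u i) (y j)))"
      using eig[OF that u[OF that]] orth[OF that that] by simp
    also have "\<dots> = complex_of_real (\<Sum>j\<in>J. (cmod (cdot d (u i) (y j)))\<^sup>2)"
      by (simp add: complex_norm_square flip: of_real_power)
    finally show ?thesis by (simp only: of_real_eq_iff)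
  qed
  show thesis using that[of u \<mu>] orth compl ev \<mu> by (auto simp: eigenbasis_def)
qed

section \<open>Trace exponentials and rank-one updates\<close>

text \<open>The trapezoidal rule overestimates the integral of the convex function
  \<open>exp\<close> between \<open>a\<close> and \<open>b\<close>; the extra factor
  \<open>a - b\<close> makes the inequality independent of their order.\<close>

lemma exp_trapezoid:
  fixes a b :: real
  shows "(exp a - exp b) * (a - b) \<le> (a - b)\<^sup>2 * (exp a + exp b) / 2"
proof -
  have key: "2 * (exp t - 1) \<le> t * (exp t + 1)" if "t \<ge> 0" for t :: real
  proof -
    let ?h = "\<lambda>t::real. t * (exp t + 1) - 2 * (exp t - 1)"
    have "?h 0 \<le> ?h t"
    proof (rule DERIV_nonneg_imp_nondecreasing[OF that])
      fix x :: real assume "0 \<le> x"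
      have "1 - x \<le> exp (- x)" using exp_ge_add_one_self[of "- x"] by simp
      then have "(1 - x) * exp x \<le> exp (- x) * exp x" by (intro mult_right_mono) auto
      then have "0 \<le> 1 * (exp x + 1) + x * exp x - 2 * exp x" by (simp add: exp_minus field_simps)
      moreover have "(?h has_real_derivative 1 * (exp x + 1) + x * exp x - 2 * exp x) (at x)"
        by (auto intro!: derivative_eq_intros)
      ultimately show "\<exists>y. (?h has_real_derivative y) (at x) \<and> 0 \<le> y" by blast
    qed
    then show ?thesis by simp
  qed
  have "(exp a - exp b) * (a - b) \<le> (a - b)\<^sup>2 * (exp a + exp b) / 2" if "b \<le> a" for a b :: real
  proof -
    have ab: "exp (a - b) * exp b = exp a" by (simp add: exp_diff)
    have "2 * (exp (a - b) - 1) * exp b \<le> (a - b) * (exp (a - b) + 1) * exp b"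
      using key[of "a - b"] that by (intro mult_right_mono) auto
    also have "2 * (exp (a - b) - 1) * exp b = 2 * (exp a - exp b)"
      unfolding ab[symmetric] by (simp add: algebra_simps)
    also have "(a - b) * (exp (a - b) + 1) * exp b = (a - b) * (exp (a - b) * exp b + exp b)"
      by (simp add: algebra_simps)
    finally have "2 * (exp a - exp b) \<le> (a - b) * (exp a + exp b)" unfolding ab .
    then have "2 * (exp a - exp b) * (a - b) \<le> (a - b) * (exp a + exp b) * (a - b)"
      using that by (intro mult_right_mono) auto
    then show ?thesis by (simp add: power2_eq_square algebra_simps)
  qed
  from this[of b a] this[of a b] show ?thesis
    by (cases "b \<le> a") (simp_all add: power2_commute algebra_simps)
qed

text \<open>A convex function lies above its tangent at \<open>a\<close>. Averaged over the overlaps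
  of two eigenbases this becomes Klein's inequality.\<close>

lemma exp_tangent:
  fixes a b :: real
  shows "exp a - exp b \<le> exp a * (a - b)"
proof -
  have "exp a * (1 + (b - a)) \<le> exp a * exp (b - a)" by (intro mult_left_mono exp_ge_add_one_self) auto
  then show ?thesis by (simp add: algebra_simps exp_diff)
qed

text \<open>In the application \<open>P i k = |\<langle>u\<^sub>i, w\<^sub>k\<rangle>|\<^sup>2\<close> for eigenbases of \<open>Z\<close> and of \<open>Z + y y\<^sup>*\<close>, and
  \<open>A\<close>, \<open>B\<close> are the squared coefficients of \<open>y\<close>; then the two sums weighted by \<open>A\<close> and \<open>B\<close> are
  \<open>y\<^sup>* exp(sZ) y\<close> and \<open>y\<^sup>* exp(s(Z + y y\<^sup>*)) y\<close>.\<close>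

lemma rank_one_update_scalar:
  fixes P :: "nat \<Rightarrow> nat \<Rightarrow> real" and A B \<mu> \<nu> :: "nat \<Rightarrow> real" and s R :: real
  assumes P: "\<And>i k. i < d \<Longrightarrow> k < d \<Longrightarrow> 0 \<le> P i k"
    and row: "\<And>i. i < d \<Longrightarrow> (\<Sum>k<d. P i k) = 1" and col: "\<And>k. k < d \<Longrightarrow> (\<Sum>i<d. P i k) = 1"
    and prod: "\<And>i k. i < d \<Longrightarrow> k < d \<Longrightarrow> (\<nu> k - \<mu> i)\<^sup>2 * P i k = A i * B k"
    and A: "\<And>i. i < d \<Longrightarrow> (\<Sum>k<d. (\<nu> k - \<mu> i) * P i k) = A i"
    and B: "\<And>k. k < d \<Longrightarrow> (\<Sum>i<d. (\<nu> k - \<mu> i) * P i k) = B k"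
    and A0: "\<And>i. i < d \<Longrightarrow> 0 \<le> A i" and B0: "\<And>k. k < d \<Longrightarrow> 0 \<le> B k"
    and YA: "(\<Sum>i<d. A i) \<le> R" and YB: "(\<Sum>k<d. B k) \<le> R" and sR: "s * R < 2"
  shows "(\<Sum>k<d. exp (s * \<nu> k)) \<le> (\<Sum>i<d. exp (s * \<mu> i))
           + s * ((1 + s * R / 2) / (1 - s * R / 2)) * (\<Sum>i<d. exp (s * \<mu> i) * A i)"
proof -
  define f where "f = (\<Sum>k<d. exp (s * \<nu> k) * B k)"
  define g where "g = (\<Sum>i<d. exp (s * \<mu> i) * A i)"
  have f2: "f = (\<Sum>i<d. \<Sum>k<d. exp (s * \<nu> k) * ((\<nu> k - \<mu> i) * P i k))"
    unfolding f_def by (subst sum.swap) (simp add: B[symmetric] sum_distrib_left)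
  have g2: "g = (\<Sum>i<d. \<Sum>k<d. exp (s * \<mu> i) * ((\<nu> k - \<mu> i) * P i k))"
    unfolding g_def by (simp add: A[symmetric] sum_distrib_left)
  have "(\<Sum>k<d. exp (s * \<nu> k)) = (\<Sum>i<d. \<Sum>k<d. exp (s * \<nu> k) * P i k)"
    by (subst sum.swap) (simp add: col sum_distrib_left[symmetric])
  moreover have "(\<Sum>i<d. exp (s * \<mu> i)) = (\<Sum>i<d. \<Sum>k<d. exp (s * \<mu> i) * P i k)"
    by (simp add: row sum_distrib_left[symmetric])
  ultimately have "(\<Sum>k<d. exp (s * \<nu> k)) - (\<Sum>i<d. exp (s * \<mu> i))
      = (\<Sum>i<d. \<Sum>k<d. (exp (s * \<nu> k) - exp (s * \<mu> i)) * P i k)"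
    by (simp add: sum_subtractf left_diff_distrib)
  also have "\<dots> \<le> (\<Sum>i<d. \<Sum>k<d. exp (s * \<nu> k) * (s * \<nu> k - s * \<mu> i) * P i k)"
    using P by (intro sum_mono mult_right_mono exp_tangent) auto
  also have "\<dots> = s * f" unfolding f2 by (simp add: sum_distrib_left algebra_simps)
  finally have klein: "(\<Sum>k<d. exp (s * \<nu> k)) - (\<Sum>i<d. exp (s * \<mu> i)) \<le> s * f" .
  \<comment> \<open>Klein's inequality leaves \<open>f\<close>, which involves the unknown updated
    spectrum. The trapezoidal estimate compares it with \<open>g\<close>; by \<open>prod\<close> the
    double sum factorises, so \<open>f\<close> reappears only with the factor
    \<open>s * R / 2\<close> and is absorbed because \<open>s * R < 2\<close>.\<close>
  have "s * (f - g) = (\<Sum>i<d. \<Sum>k<d. (exp (s * \<nu> k) - exp (s * \<mu> i)) * (s * \<nu> k - s * \<mu> i) * P i k)"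
    unfolding f2 g2 by (simp add: sum_distrib_left sum_subtractf[symmetric] algebra_simps)
  also have "\<dots> \<le> (\<Sum>i<d. \<Sum>k<d. ((s * \<nu> k - s * \<mu> i)\<^sup>2 * (exp (s * \<nu> k) + exp (s * \<mu> i)) / 2) * P i k)"
    using P by (intro sum_mono mult_right_mono exp_trapezoid) auto
  also have "\<dots> = (\<Sum>i<d. \<Sum>k<d. s\<^sup>2 / 2 * (exp (s * \<nu> k) + exp (s * \<mu> i)) * (A i * B k))"
  proof (intro sum.cong refl)
    fix i k assume "i \<in> {..<d}" "k \<in> {..<d}"
    then have "A i * B k = (\<nu> k - \<mu> i)\<^sup>2 * P i k" using prod by simp
    then show "((s * \<nu> k - s * \<mu> i)\<^sup>2 * (exp (s * \<nu> k) + exp (s * \<mu> i)) / 2) * P i k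
        = s\<^sup>2 / 2 * (exp (s * \<nu> k) + exp (s * \<mu> i)) * (A i * B k)"
      by (simp add: right_diff_distrib[symmetric] power_mult_distrib)
  qed
  also have "\<dots> = s\<^sup>2 / 2 * ((\<Sum>i<d. A i) * f + (\<Sum>k<d. B k) * g)"
  proof -
    have "(\<Sum>i<d. A i) * f = (\<Sum>i<d. \<Sum>k<d. exp (s * \<nu> k) * (A i * B k))"
      unfolding f_def by (simp add: sum_product mult_ac)
    moreover have "(\<Sum>k<d. B k) * g = (\<Sum>i<d. \<Sum>k<d. exp (s * \<mu> i) * (A i * B k))"
    proof -
      have "(\<Sum>k<d. B k) * g = (\<Sum>k<d. \<Sum>i<d. exp (s * \<mu> i) * (A i * B k))"
        unfolding g_def by (simp add: sum_product mult_ac)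
      then show ?thesis by (subst sum.swap)
    qed
    ultimately show ?thesis by (simp add: sum_distrib_left sum.distrib algebra_simps)
  qed
  also have "\<dots> \<le> s\<^sup>2 / 2 * (R * f + R * g)"
  proof -
    have "f \<ge> 0" "g \<ge> 0" unfolding f_def g_def using A0 B0 by (auto intro!: sum_nonneg)
    then show ?thesis using YA YB by (intro mult_left_mono add_mono mult_right_mono) auto
  qed
  finally have "s * f * (1 - s * R / 2) \<le> s * g * (1 + s * R / 2)"
    by (simp add: algebra_simps power2_eq_square)
  then have "s * f \<le> s * g * (1 + s * R / 2) / (1 - s * R / 2)"
    using sR by (simp add: pos_le_divide_eq)
  with klein show ?thesis by (simp add: g_def mult_ac)
qed

lemma cdot_sum_left: "cdot d (\<lambda>k. \<Sum>i\<in>I. f i k) g = (\<Sum>i\<in>I. cdot d (f i) g)"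
  unfolding cdot_def by (simp add: sum_distrib_right) (rule sum.swap)

lemma cdot_cong: "(\<And>k. k < d \<Longrightarrow> f k = f' k) \<Longrightarrow> (\<And>k. k < d \<Longrightarrow> g k = g' k) \<Longrightarrow> cdot d f g = cdot d f' g'"
  by (simp add: cdot_def)

lemma cmod_cdot_commute: "cmod (cdot d f g) = cmod (cdot d g f)"
  using cdot_cnj[of d f g] by simp

lemma eigenbasis_expand:
  assumes "eigenbasis d A u \<mu>" "k < d"
  shows "f k = (\<Sum>i<d. cdot d f (u i) * u i k)"
proof -
  have "(\<Sum>i<d. cdot d f (u i) * u i k) = (\<Sum>i<d. \<Sum>l<d. f l * (u i k * cnj (u i l)))"
    by (simp add: cdot_def sum_distrib_right) (simp add: mult_ac)
  also have "\<dots> = (\<Sum>l<d. f l * (\<Sum>i<d. u i k * cnj (u i l)))"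
    by (subst sum.swap) (simp add: sum_distrib_left)
  also have "\<dots> = (\<Sum>l<d. f l * of_bool (k = l))"
    using assms by (intro sum.cong) (auto simp: eigenbasis_def)
  finally show ?thesis using assms(2) by (simp add: of_bool_def if_distrib cong: if_cong)
qed

lemma eigenbasis_parseval:
  assumes "eigenbasis d A u \<mu>"
  shows "cdot d f g = (\<Sum>i<d. cdot d f (u i) * cdot d (u i) g)"
proof -
  have "cdot d f g = cdot d (\<lambda>k. \<Sum>i<d. cdot d f (u i) * u i k) g"
    by (intro cdot_cong eigenbasis_expand[OF assms]) auto
  also have "\<dots> = (\<Sum>i<d. cdot d f (u i) * cdot d (u i) g)"
    unfolding cdot_sum_left by (simp add: cdot_def sum_distrib_left mult.assoc)
  finally show ?thesis .
qed

lemma eigenbasis_norm: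
  assumes "eigenbasis d A u \<mu>"
  shows "(\<Sum>i<d. (cmod (cdot d (u i) f))\<^sup>2) = (\<Sum>k<d. (cmod (f k))\<^sup>2)"
proof -
  have "complex_of_real (\<Sum>k<d. (cmod (f k))\<^sup>2) = (\<Sum>i<d. cnj (cdot d (u i) f) * cdot d (u i) f)"
    using eigenbasis_parseval[OF assms, of f f] by (simp add: cdot_self cdot_cnj[symmetric])
  also have "\<dots> = complex_of_real (\<Sum>i<d. (cmod (cdot d (u i) f))\<^sup>2)"
    by (simp add: complex_norm_square mult.commute del: of_real_power)
  finally show ?thesis by (simp only: of_real_eq_iff)
qed

lemma frame_quadratic_form:
  assumes "eigenbasis d (frame_mat J y) u \<mu>"
  shows "(\<Sum>j\<in>J. (cmod (cdot d v (y j)))\<^sup>2) = (\<Sum>i<d. \<mu> i * (cmod (cdot d v (u i)))\<^sup>2)"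
proof -
  have "complex_of_real (\<Sum>j\<in>J. (cmod (cdot d v (y j)))\<^sup>2) = cdot d (\<lambda>k. \<Sum>l<d. frame_mat J y k l * v l) v"
    unfolding frame_form[symmetric] by (simp add: complex_norm_square del: of_real_power)
  also have "\<dots> = cdot d (\<lambda>k. \<Sum>i<d. cdot d v (u i) * (complex_of_real (\<mu> i) * u i k)) v"
  proof (intro cdot_cong refl)
    fix k assume k: "k < d"
    have "(\<Sum>l<d. frame_mat J y k l * v l) = (\<Sum>l<d. frame_mat J y k l * (\<Sum>i<d. cdot d v (u i) * u i l))"
      by (intro sum.cong refl arg_cong2[where f="(*)"] eigenbasis_expand[OF assms]) auto
    also have "\<dots> = (\<Sum>i<d. cdot d v (u i) * (\<Sum>l<d. frame_mat J y k l * u i l))"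
      unfolding sum_distrib_left by (subst sum.swap) (simp add: mult_ac)
    also have "\<dots> = (\<Sum>i<d. cdot d v (u i) * (complex_of_real (\<mu> i) * u i k))"
      using assms k by (intro sum.cong) (auto simp: eigenbasis_def)
    finally show "(\<Sum>l<d. frame_mat J y k l * v l) = \<dots>" .
  qed
  also have "\<dots> = (\<Sum>i<d. cdot d v (u i) * complex_of_real (\<mu> i) * cdot d (u i) v)"
    unfolding cdot_sum_left by (simp add: cdot_def sum_distrib_left mult.assoc)
  also have "\<dots> = complex_of_real (\<Sum>i<d. \<mu> i * (cmod (cdot d v (u i)))\<^sup>2)"
    using cdot_cnj[of d _ v] by (auto simp: complex_norm_square mult_ac simp del: of_real_power intro!: sum.cong)
  finally show ?thesis by (simp only: of_real_eq_iff)
qed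

fun mpow :: "nat \<Rightarrow> (nat \<Rightarrow> nat \<Rightarrow> complex) \<Rightarrow> nat \<Rightarrow> nat \<Rightarrow> nat \<Rightarrow> complex" where
  "mpow d A 0 k l = of_bool (k = l)"
| "mpow d A (Suc p) k l = (\<Sum>j<d. A k j * mpow d A p j l)"

text \<open>The trace of the matrix exponential, written as a power series so that it is visibly a
  measurable function of the entries.\<close>

definition trexp :: "nat \<Rightarrow> real \<Rightarrow> (nat \<Rightarrow> nat \<Rightarrow> complex) \<Rightarrow> real" where
  "trexp d s A = (\<Sum>p. s ^ p / fact p * Re (\<Sum>k<d. mpow d A p k k))"

lemma mpow_eigenbasis:
  assumes "eigenbasis d A u \<mu>" "k < d" "l < d"
  shows "mpow d A p k l = (\<Sum>i<d. complex_of_real (\<mu> i) ^ p * (u i k * cnj (u i l)))"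
  using assms(2,3)
proof (induction p arbitrary: k l)
  case 0
  then show ?case using assms(1) by (simp add: eigenbasis_def)
next
  case (Suc p)
  have "mpow d A (Suc p) k l = (\<Sum>j<d. \<Sum>i<d. complex_of_real (\<mu> i) ^ p * cnj (u i l) * (A k j * u i j))"
    using Suc by (simp add: sum_distrib_left mult_ac)
  also have "\<dots> = (\<Sum>i<d. complex_of_real (\<mu> i) ^ p * cnj (u i l) * (\<Sum>j<d. A k j * u i j))"
    by (subst sum.swap) (simp add: sum_distrib_left)
  also have "\<dots> = (\<Sum>i<d. complex_of_real (\<mu> i) ^ p * cnj (u i l) * (complex_of_real (\<mu> i) * u i k))"
    using assms(1) Suc.prems by (intro sum.cong) (auto simp: eigenbasis_def)
  finally show ?case by (simp add: mult_ac)
qed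

lemma trexp_eigenbasis:
  assumes "eigenbasis d A u \<mu>"
  shows "trexp d s A = (\<Sum>i<d. exp (s * \<mu> i))"
proof -
  have "Re (\<Sum>k<d. mpow d A p k k) = (\<Sum>i<d. \<mu> i ^ p)" for p
  proof -
    have "(\<Sum>k<d. mpow d A p k k) = (\<Sum>k<d. \<Sum>i<d. complex_of_real (\<mu> i) ^ p * (u i k * cnj (u i k)))"
      using assms by (intro sum.cong) (auto simp: mpow_eigenbasis)
    also have "\<dots> = (\<Sum>i<d. complex_of_real (\<mu> i) ^ p * cdot d (u i) (u i))"
      by (subst sum.swap) (simp add: cdot_def sum_distrib_left)
    also have "\<dots> = complex_of_real (\<Sum>i<d. \<mu> i ^ p)"
      using assms by (simp add: eigenbasis_def)
    finally show ?thesis by simp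
  qed
  then have "trexp d s A = (\<Sum>p. \<Sum>i<d. (s * \<mu> i) ^ p /\<^sub>R fact p)"
    by (simp add: trexp_def sum_distrib_left power_mult_distrib divide_inverse mult_ac)
  also have "\<dots> = (\<Sum>i<d. \<Sum>p. (s * \<mu> i) ^ p /\<^sub>R fact p)"
    by (rule suminf_sum) (rule summable_exp_generic)
  finally show ?thesis by (simp add: exp_def)
qed

text \<open>Pairing the eigenvalue equations of the two operators and subtracting gives
  \<open>(\<nu> k - \<mu> i) * c i k = a i * cnj (b k)\<close> for the overlaps \<open>c\<close>,
  because the operators differ by one rank-one term. This identity and the Parseval identity supply
  all the hypotheses of \<open>rank_one_update_scalar\<close>.\<close>

lemma trexp_rank_one_update:
  assumes Z: "eigenbasis d (frame_mat J y) u \<mu>" and J: "finite J" "j \<notin> J"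
    and R: "(\<Sum>k<d. (cmod (y j k))\<^sup>2) \<le> R" and sR: "s * R < 2"
  shows "trexp d s (frame_mat (insert j J) y) \<le> trexp d s (frame_mat J y)
     + s * ((1 + s * R / 2) / (1 - s * R / 2)) * (\<Sum>i<d. exp (s * \<mu> i) * (cmod (cdot d (u i) (y j)))\<^sup>2)"
proof -
  obtain w \<nu> where W: "eigenbasis d (frame_mat (insert j J) y) w \<nu>"
    using eigenbasis_exists[of "insert j J" d y] J by blast
  define c where "c i k = cdot d (u i) (w k)" for i k
  define a where "a i = cdot d (u i) (y j)" for i
  define b where "b k = cdot d (w k) (y j)" for k
  have cc: "complex_of_real (\<nu> k - \<mu> i) * c i k = a i * cnj (b k)" if "i < d" "k < d" for i k
  proof -
    have "complex_of_real (\<mu> i) * c i k = cdot d (\<lambda>p. \<Sum>l<d. frame_mat J y p l * u i l) (w k)"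
    proof -
      have "cdot d (\<lambda>p. \<Sum>l<d. frame_mat J y p l * u i l) (w k) = cdot d (cscale (complex_of_real (\<mu> i)) (u i)) (w k)"
        using Z that by (intro cdot_cong) (auto simp: eigenbasis_def cscale_def)
      then show ?thesis by (simp add: cdot_scale_left c_def)
    qed
    also have "\<dots> = (\<Sum>j\<in>J. cdot d (u i) (y j) * cnj (cdot d (w k) (y j)))" by (simp add: frame_form)
    finally have 1: "complex_of_real (\<mu> i) * c i k = \<dots>" .
    have "complex_of_real (\<nu> k) * cnj (c i k) = cdot d (\<lambda>p. \<Sum>l<d. frame_mat (insert j J) y p l * w k l) (u i)"
    proof -
      have "cdot d (\<lambda>p. \<Sum>l<d. frame_mat (insert j J) y p l * w k l) (u i) = cdot d (cscale (complex_of_real (\<nu> k)) (w k)) (u i)"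
        using W that by (intro cdot_cong) (auto simp: eigenbasis_def cscale_def)
      then show ?thesis by (simp add: cdot_scale_left c_def cdot_cnj[of d "w k" "u i"])
    qed
    also have "\<dots> = (\<Sum>j\<in>insert j J. cdot d (w k) (y j) * cnj (cdot d (u i) (y j)))" by (simp only: frame_form)
    finally have "cnj (complex_of_real (\<nu> k) * cnj (c i k)) = cnj \<dots>" by simp
    then have "complex_of_real (\<nu> k) * c i k = a i * cnj (b k) + complex_of_real (\<mu> i) * c i k"
      unfolding 1 using J by (simp add: a_def b_def mult_ac)
    then show ?thesis by (simp add: algebra_simps)
  qed
  have "(\<Sum>k<d. exp (s * \<nu> k)) \<le> (\<Sum>i<d. exp (s * \<mu> i))
       + s * ((1 + s * R / 2) / (1 - s * R / 2)) * (\<Sum>i<d. exp (s * \<mu> i) * (cmod (a i))\<^sup>2)"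
  proof (rule rank_one_update_scalar[where P = "\<lambda>i k. (cmod (c i k))\<^sup>2" and B = "\<lambda>k. (cmod (b k))\<^sup>2"])
    fix i assume i: "i < d"
    show "(\<Sum>k<d. (cmod (c i k))\<^sup>2) = 1"
    proof -
      have "(\<Sum>k<d. (cmod (c i k))\<^sup>2) = (\<Sum>k<d. (cmod (u i k))\<^sup>2)"
        unfolding c_def cmod_cdot_commute[of d "u i"] by (rule eigenbasis_norm[OF W])
      moreover have "complex_of_real \<dots> = 1" unfolding cdot_self[symmetric] using Z i by (simp add: eigenbasis_def)
      ultimately show ?thesis by (metis of_real_eq_1_iff)
    qed
    show "(\<Sum>k<d. (\<nu> k - \<mu> i) * (cmod (c i k))\<^sup>2) = (cmod (a i))\<^sup>2"
    proof -
      have "complex_of_real (\<Sum>k<d. (\<nu> k - \<mu> i) * (cmod (c i k))\<^sup>2) = (\<Sum>k<d. complex_of_real (\<nu> k - \<mu> i) * c i k * cnj (c i k))"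
        by (simp add: complex_norm_square mult.assoc del: of_real_power)
      also have "\<dots> = (\<Sum>k<d. a i * cnj (b k) * cnj (c i k))" using cc i by (intro sum.cong) auto
      also have "\<dots> = a i * cnj (\<Sum>k<d. c i k * b k)" by (simp add: sum_distrib_left mult_ac)
      also have "(\<Sum>k<d. c i k * b k) = a i"
        unfolding c_def b_def a_def by (rule eigenbasis_parseval[OF W, symmetric])
      finally show ?thesis by (simp only: complex_norm_square[symmetric] of_real_eq_iff)
    qed
    fix k assume k: "k < d"
    show "(\<nu> k - \<mu> i)\<^sup>2 * (cmod (c i k))\<^sup>2 = (cmod (a i))\<^sup>2 * (cmod (b k))\<^sup>2"
      using arg_cong[OF cc[OF i k], of "\<lambda>z. (cmod z)\<^sup>2"]
      by (simp add: norm_mult power_mult_distrib del: of_real_diff)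
  next
    fix k assume k: "k < d"
    show "(\<Sum>i<d. (cmod (c i k))\<^sup>2) = 1"
    proof -
      have "(\<Sum>i<d. (cmod (c i k))\<^sup>2) = (\<Sum>i<d. (cmod (w k i))\<^sup>2)"
        unfolding c_def by (rule eigenbasis_norm[OF Z])
      moreover have "complex_of_real \<dots> = 1" unfolding cdot_self[symmetric] using W k by (simp add: eigenbasis_def)
      ultimately show ?thesis by (metis of_real_eq_1_iff)
    qed
    show "(\<Sum>i<d. (\<nu> k - \<mu> i) * (cmod (c i k))\<^sup>2) = (cmod (b k))\<^sup>2"
    proof -
      have "complex_of_real (\<Sum>i<d. (\<nu> k - \<mu> i) * (cmod (c i k))\<^sup>2) = (\<Sum>i<d. complex_of_real (\<nu> k - \<mu> i) * c i k * cnj (c i k))"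
        by (simp add: complex_norm_square mult.assoc del: of_real_power)
      also have "\<dots> = (\<Sum>i<d. a i * cnj (b k) * cnj (c i k))" using cc k by (intro sum.cong) auto
      also have "\<dots> = (\<Sum>i<d. cnj (c i k) * a i) * cnj (b k)" by (simp add: sum_distrib_right) (simp add: mult_ac)
      also have "(\<Sum>i<d. cnj (c i k) * a i) = b k"
        unfolding c_def b_def a_def cdot_cnj[symmetric] by (rule eigenbasis_parseval[OF Z, symmetric])
      finally show ?thesis by (simp only: complex_norm_square[symmetric] of_real_eq_iff)
    qed
  next
    show "(\<Sum>i<d. (cmod (a i))\<^sup>2) \<le> R" unfolding a_def eigenbasis_norm[OF Z] by (rule R)
    show "(\<Sum>i<d. (cmod (b i))\<^sup>2) \<le> R" unfolding b_def eigenbasis_norm[OF W] by (rule R)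
  qed (use sR in auto)
  then show ?thesis by (simp add: trexp_eigenbasis[OF Z] trexp_eigenbasis[OF W] a_def)
qed

lemma trexp_nonneg: "finite J \<Longrightarrow> 0 \<le> trexp d s (frame_mat J y)"
  by (rule eigenbasis_exists[of J d y]) (auto simp: trexp_eigenbasis intro!: sum_nonneg)

text \<open>A crude bound, since no eigenvalue exceeds \<open>card J * R\<close>; it serves to make
  \<open>trexp\<close> bounded on the sample space and hence integrable.\<close>

lemma trexp_upper:
  assumes J: "finite J" and R: "\<And>j. j \<in> J \<Longrightarrow> (\<Sum>k<d. (cmod (y j k))\<^sup>2) \<le> R"
  shows "trexp d s (frame_mat J y) \<le> real d * exp (\<bar>s\<bar> * (real (card J) * R))"
proof -
  obtain u \<mu> where E: "eigenbasis d (frame_mat J y) u \<mu>"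
    and \<mu>: "\<And>i. i < d \<Longrightarrow> \<mu> i = (\<Sum>j\<in>J. (cmod (cdot d (u i) (y j)))\<^sup>2)"
    using eigenbasis_exists[OF J] by blast
  have "s * \<mu> i \<le> \<bar>s\<bar> * (real (card J) * R)" if i: "i < d" for i
  proof -
    have "\<mu> i \<le> (\<Sum>j\<in>J. R)" unfolding \<mu>[OF i]
    proof (intro sum_mono)
      fix j assume j: "j \<in> J"
      have "(cmod (cdot d (u i) (y j)))\<^sup>2 \<le> (\<Sum>i<d. (cmod (cdot d (u i) (y j)))\<^sup>2)"
        using i by (intro member_le_sum) auto
      then show "(cmod (cdot d (u i) (y j)))\<^sup>2 \<le> R" unfolding eigenbasis_norm[OF E] using R[OF j] by linarith
    qed
    moreover have "0 \<le> \<mu> i" unfolding \<mu>[OF i] by (intro sum_nonneg) auto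
    ultimately have "\<bar>s\<bar> * \<mu> i \<le> \<bar>s\<bar> * (real (card J) * R)" by (intro mult_left_mono) auto
    moreover have "s * \<mu> i \<le> \<bar>s\<bar> * \<mu> i" using \<open>0 \<le> \<mu> i\<close> by (intro mult_right_mono) auto
    ultimately show ?thesis by linarith
  qed
  then have "(\<Sum>i<d. exp (s * \<mu> i)) \<le> (\<Sum>i<d. exp (\<bar>s\<bar> * (real (card J) * R)))" by (intro sum_mono) auto
  then show ?thesis by (simp add: trexp_eigenbasis[OF E])
qed

text \<open>Each \<open>exp (- \<theta> * \<mu> i)\<close> is one summand of a positive sum, so a
  small trace forces every eigenvalue to be at least \<open>t\<close>.\<close>

lemma frame_lower_bound:
  assumes J: "finite J" and \<theta>: "\<theta> > 0" and small: "trexp d (- \<theta>) (frame_mat J y) < exp (- \<theta> * t)"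
  shows "t * (\<Sum>k<d. (cmod (v k))\<^sup>2) \<le> (\<Sum>j\<in>J. (cmod (cdot d v (y j)))\<^sup>2)"
proof -
  obtain u \<mu> where E: "eigenbasis d (frame_mat J y) u \<mu>" using eigenbasis_exists[OF J] by blast
  have "t \<le> \<mu> i" if "i < d" for i
  proof -
    have "exp (- \<theta> * \<mu> i) \<le> (\<Sum>i<d. exp (- \<theta> * \<mu> i))" using that by (intro member_le_sum) auto
    then have "exp (- \<theta> * \<mu> i) < exp (- \<theta> * t)" using small unfolding trexp_eigenbasis[OF E] by linarith
    then have "- \<theta> * \<mu> i < - \<theta> * t" by (simp only: exp_less_cancel_iff)
    then show ?thesis using \<theta> by simp
  qed
  then have "(\<Sum>i<d. t * (cmod (cdot d v (u i)))\<^sup>2) \<le> (\<Sum>i<d. \<mu> i * (cmod (cdot d v (u i)))\<^sup>2)"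
    by (intro sum_mono mult_right_mono) auto
  moreover have n: "(\<Sum>i<d. (cmod (cdot d v (u i)))\<^sup>2) = (\<Sum>k<d. (cmod (v k))\<^sup>2)"
    using eigenbasis_norm[OF E, of v] by (simp add: cmod_cdot_commute[of d v])
  ultimately show ?thesis unfolding frame_quadratic_form[OF E] n[symmetric]
    by (simp add: sum_distrib_left)
qed

text \<open>Since the eigenvalues are nonnegative, the summands
  \<open>exp (\<theta> * \<mu> i) - 1\<close> are nonnegative, and each is bounded by their sum.
  Subtracting \<open>d\<close> thus loses nothing and keeps the dimension out of the
  condition.\<close>

lemma frame_upper_bound:
  assumes J: "finite J" and \<theta>: "\<theta> > 0" and small: "trexp d \<theta> (frame_mat J y) - real d < exp (\<theta> * t) - 1"
  shows "(\<Sum>j\<in>J. (cmod (cdot d v (y j)))\<^sup>2) \<le> t * (\<Sum>k<d. (cmod (v k))\<^sup>2)"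
proof -
  obtain u \<mu> where E: "eigenbasis d (frame_mat J y) u \<mu>"
    and \<mu>: "\<And>i. i < d \<Longrightarrow> \<mu> i = (\<Sum>j\<in>J. (cmod (cdot d (u i) (y j)))\<^sup>2)"
    using eigenbasis_exists[OF J] by blast
  have "\<mu> i \<le> t" if i: "i < d" for i
  proof -
    have "exp (\<theta> * \<mu> i) - 1 \<le> (\<Sum>i<d. exp (\<theta> * \<mu> i) - 1)"
      using that \<theta> by (intro member_le_sum) (auto simp: \<mu> intro!: mult_nonneg_nonneg sum_nonneg)
    then have "exp (\<theta> * \<mu> i) < exp (\<theta> * t)" using small unfolding trexp_eigenbasis[OF E] sum_subtractf by (simp del: exp_less_cancel_iff)
    then have "\<theta> * \<mu> i < \<theta> * t" by (simp only: exp_less_cancel_iff)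
    then show ?thesis using \<theta> by simp
  qed
  then have "(\<Sum>i<d. \<mu> i * (cmod (cdot d v (u i)))\<^sup>2) \<le> (\<Sum>i<d. t * (cmod (cdot d v (u i)))\<^sup>2)"
    by (intro sum_mono mult_right_mono) auto
  moreover have n: "(\<Sum>i<d. (cmod (cdot d v (u i)))\<^sup>2) = (\<Sum>k<d. (cmod (v k))\<^sup>2)"
    using eigenbasis_norm[OF E, of v] by (simp add: cmod_cdot_commute[of d v])
  ultimately show ?thesis unfolding frame_quadratic_form[OF E] n[symmetric]
    by (simp add: sum_distrib_left)
qed

section \<open>Concentration of random frame operators\<close>

lemma borel_measurable_cnj [measurable (raw)]:
  "f \<in> borel_measurable M \<Longrightarrow> (\<lambda>x. cnj (f x)) \<in> borel_measurable M"
  by (rule measurable_compose[OF _ borel_measurable_continuous_onI]) (auto intro: continuous_intros)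

text \<open>A bounded random vector whose second moment matrix is diagonal. It is used twice: with
  \<open>\<Lambda> = 1\<close> for the functions \<open>eta\<close>, and with
  \<open>\<Lambda> k = lam (k + m)\<close> for truncations of the tail.\<close>

locale frame_sampling = prob_space P for P :: "'a measure" +
  fixes y :: "'a \<Rightarrow> nat \<Rightarrow> complex" and d :: nat and R :: real and \<Lambda> :: "nat \<Rightarrow> real"
  assumes measurable_y: "k < d \<Longrightarrow> (\<lambda>x. y x k) \<in> borel_measurable P"
    and bound: "x \<in> space P \<Longrightarrow> (\<Sum>k<d. (cmod (y x k))\<^sup>2) \<le> R"
    and second_moment: "k < d \<Longrightarrow> l < d \<Longrightarrow> (\<integral>x. y x k * cnj (y x l) \<partial>P) = complex_of_real (of_bool (k = l) * \<Lambda> k)"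
begin

abbreviation Q :: "nat \<Rightarrow> (nat \<Rightarrow> 'a) measure" where
  "Q n \<equiv> PiM {..<n} (\<lambda>_. P)"

abbreviation Z :: "nat \<Rightarrow> (nat \<Rightarrow> 'a) \<Rightarrow> nat \<Rightarrow> nat \<Rightarrow> complex" where
  "Z n X \<equiv> frame_mat {..<n} (\<lambda>j. y (X j))"

sublocale product: product_prob_space "\<lambda>_ :: nat. P" UNIV
  by unfold_locales

lemma prob_space_Q: "prob_space (Q n)"
  by (intro prob_space_PiM) unfold_locales

lemma R_nonneg: "0 \<le> R"
proof -
  obtain x where "x \<in> space P" using not_empty by blast
  from bound[OF this] show ?thesis using sum_nonneg[of "{..<d}" "\<lambda>k. (cmod (y x k))\<^sup>2"] by simp
qed

lemma cmod_y_le: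
  assumes "x \<in> space P" "k < d" shows "cmod (y x k) \<le> sqrt R"
proof -
  have "(cmod (y x k))\<^sup>2 \<le> (\<Sum>k<d. (cmod (y x k))\<^sup>2)" using assms by (intro member_le_sum) auto
  then show ?thesis using bound[OF assms(1)] by (intro real_le_rsqrt) simp
qed

lemma integrable_product:
  assumes "k < d" "l < d" shows "integrable P (\<lambda>x. y x k * cnj (y x l))"
proof (rule integrable_const_bound[of _ R])
  show "AE x in P. norm (y x k * cnj (y x l)) \<le> R"
  proof (intro AE_I2)
    fix x assume x: "x \<in> space P"
    have "cmod (y x k) * cmod (y x l) \<le> sqrt R * sqrt R"
      using cmod_y_le[OF x] assms by (intro mult_mono) (auto simp: R_nonneg)
    then show "norm (y x k * cnj (y x l)) \<le> R" using R_nonneg by (simp add: norm_mult)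
  qed
  show "(\<lambda>x. y x k * cnj (y x l)) \<in> borel_measurable P"
    using measurable_y[OF assms(1)] measurable_y[OF assms(2)] by measurable
qed

lemma integrable_cdot: "integrable P (\<lambda>x. (cmod (cdot d v (y x)))\<^sup>2)"
  and integral_cdot: "(\<integral>x. (cmod (cdot d v (y x)))\<^sup>2 \<partial>P) = (\<Sum>k<d. \<Lambda> k * (cmod (v k))\<^sup>2)"
proof -
  have e: "complex_of_real ((cmod (cdot d v (y x)))\<^sup>2)
      = (\<Sum>k<d. \<Sum>l<d. v k * cnj (v l) * (y x l * cnj (y x k)))" for x
    unfolding complex_norm_square by (simp add: cdot_def sum_product mult_ac)
  have i: "integrable P (\<lambda>x. complex_of_real ((cmod (cdot d v (y x)))\<^sup>2))"
    unfolding e by (intro Bochner_Integration.integrable_sum integrable_mult_right integrable_product) auto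
  then show "integrable P (\<lambda>x. (cmod (cdot d v (y x)))\<^sup>2)" by (rule complex_of_real_integrable_eq[THEN iffD1])
  have "complex_of_real (\<integral>x. (cmod (cdot d v (y x)))\<^sup>2 \<partial>P) = (\<integral>x. complex_of_real ((cmod (cdot d v (y x)))\<^sup>2) \<partial>P)"
    by (rule integral_complex_of_real[symmetric])
  also have "\<dots> = (\<Sum>k<d. \<Sum>l<d. v k * cnj (v l) * complex_of_real (of_bool (l = k) * \<Lambda> l))"
    unfolding e by (subst Bochner_Integration.integral_sum,
        intro Bochner_Integration.integrable_sum integrable_mult_right integrable_product; simp)
      (intro sum.cong refl, subst Bochner_Integration.integral_sum,
        intro integrable_mult_right integrable_product; simp add: second_moment integrable_product)
  also have "\<dots> = complex_of_real (\<Sum>k<d. \<Lambda> k * (cmod (v k))\<^sup>2)"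
    by (simp add: complex_norm_square of_bool_def if_distrib[of "\<lambda>x. _ * x"] if_distrib[of complex_of_real] mult_ac
        del: of_real_power cong: if_cong)
  finally show "(\<integral>x. (cmod (cdot d v (y x)))\<^sup>2 \<partial>P) = (\<Sum>k<d. \<Lambda> k * (cmod (v k))\<^sup>2)"
    by (simp only: of_real_eq_iff)
qed

lemma measurable_Z:
  assumes "k < d" "l < d" shows "(\<lambda>X. Z n X k l) \<in> borel_measurable (Q n)"
proof -
  have "(\<lambda>X. y (X j) k) \<in> borel_measurable (Q n)" if "j < n" "k < d" for j k
    by (rule measurable_compose[OF measurable_component_singleton[of j "{..<n}" "\<lambda>_. P"] measurable_y])
      (use that in auto)
  with assms show ?thesis unfolding frame_mat_def
    by (intro borel_measurable_sum borel_measurable_times borel_measurable_cnj) auto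
qed

lemma measurable_mpow: "k < d \<Longrightarrow> l < d \<Longrightarrow> (\<lambda>X. mpow d (Z n X) p k l) \<in> borel_measurable (Q n)"
  by (induction p arbitrary: k l) (auto intro!: borel_measurable_sum borel_measurable_times measurable_Z)

lemma measurable_trexp: "(\<lambda>X. trexp d s (Z n X)) \<in> borel_measurable (Q n)"
  unfolding trexp_def
  by (intro borel_measurable_suminf borel_measurable_times borel_measurable_const
      measurable_compose[OF _ borel_measurable_Re] borel_measurable_sum measurable_mpow) auto

lemma integrable_trexp: "integrable (Q n) (\<lambda>X. trexp d s (Z n X))"
proof -
  interpret Q: prob_space "Q n" by (rule prob_space_Q)
  show ?thesis
  proof (rule Q.integrable_const_bound[OF _ measurable_trexp])
    show "AE X in Q n. norm (trexp d s (Z n X)) \<le> real d * exp (\<bar>s\<bar> * (real n * R))"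
    proof (intro AE_I2)
      fix X assume "X \<in> space (Q n)"
      then have "X j \<in> space P" if "j < n" for j using that by (auto simp: space_PiM)
      then show "norm (trexp d s (Z n X)) \<le> real d * exp (\<bar>s\<bar> * (real n * R))"
        using trexp_upper[where J = "{..<n}" and y = "\<lambda>j. y (X j)" and d = d and R = R and s = s] trexp_nonneg[of "{..<n}" d s "\<lambda>j. y (X j)"] bound
        by simp
    qed
  qed
qed

text \<open>\<open>trexp_rank_one_update\<close> integrated over the new sample while the earlier
  ones stay fixed. As the bound is linear in the squared coefficients of the new vector, only its
  second moments enter.\<close>

lemma trexp_step:
  assumes sR: "s * R < 2" and X: "X \<in> space (Q n)"
    and E: "eigenbasis d (Z n X) u \<mu>"
  shows "(\<integral>x. trexp d s (Z (Suc n) (X(n := x))) \<partial>P) \<le> trexp d s (Z n X)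
     + s * ((1 + s * R / 2) / (1 - s * R / 2)) * (\<Sum>i<d. exp (s * \<mu> i) * (\<Sum>k<d. \<Lambda> k * (cmod (u i k))\<^sup>2))"
    (is "_ \<le> _ + ?c * _")
proof -
  have Zn: "Z n (X(n := x)) = Z n X" for x by (auto simp: frame_mat_def fun_eq_iff intro!: sum.cong)
  have ins: "{..<Suc n} = insert n {..<n}" by auto
  have "(\<integral>x. trexp d s (Z (Suc n) (X(n := x))) \<partial>P)
     \<le> (\<integral>x. trexp d s (Z n X) + ?c * (\<Sum>i<d. exp (s * \<mu> i) * (cmod (cdot d (u i) (y x)))\<^sup>2) \<partial>P)"
  proof (rule integral_mono)
    show "integrable P (\<lambda>x. trexp d s (Z (Suc n) (X(n := x))))"
    proof (rule integrable_const_bound)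
      have XP: "X(n := x) \<in> space (Q (Suc n))" if "x \<in> space P" for x
        using X that by (auto simp: space_PiM PiE_iff extensional_def less_Suc_eq)
      have upd: "(\<lambda>x. X(n := x)) \<in> measurable P (Q (Suc n))"
        unfolding ins using X by (intro measurable_fun_upd[where J = "{..<n}"]) auto
      show "(\<lambda>x. trexp d s (Z (Suc n) (X(n := x)))) \<in> borel_measurable P"
        by (rule measurable_compose[OF upd measurable_trexp])
      show "AE x in P. norm (trexp d s (Z (Suc n) (X(n := x)))) \<le> real d * exp (\<bar>s\<bar> * (real (Suc n) * R))"
      proof (intro AE_I2)
        fix x assume "x \<in> space P"
        from XP[OF this] have "(X(n := x)) j \<in> space P" if "j < Suc n" for j
          using that by (auto simp: space_PiM PiE_iff)
        then have "(\<Sum>k<d. (cmod (y ((X(n := x)) j) k))\<^sup>2) \<le> R" if "j < Suc n" for j using that bound by blast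
        then show "norm (trexp d s (Z (Suc n) (X(n := x)))) \<le> real d * exp (\<bar>s\<bar> * (real (Suc n) * R))"
          using trexp_upper[where J = "{..<Suc n}" and y = "\<lambda>j. y ((X(n := x)) j)" and d = d and R = R and s = s]
            trexp_nonneg[of "{..<Suc n}" d s "\<lambda>j. y ((X(n := x)) j)"] by simp
      qed
    qed
    show "integrable P (\<lambda>x. trexp d s (Z n X) + ?c * (\<Sum>i<d. exp (s * \<mu> i) * (cmod (cdot d (u i) (y x)))\<^sup>2))"
      by (intro Bochner_Integration.integrable_add integrable_const integrable_mult_right
          Bochner_Integration.integrable_sum integrable_cdot)
    fix x assume x: "x \<in> space P"
    show "trexp d s (Z (Suc n) (X(n := x))) \<le> trexp d s (Z n X) + ?c * (\<Sum>i<d. exp (s * \<mu> i) * (cmod (cdot d (u i) (y x)))\<^sup>2)"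
      using trexp_rank_one_update[where J = "{..<n}" and y = "\<lambda>j. y ((X(n := x)) j)" and j = n and d = d and R = R and s = s and u = u and \<mu> = \<mu>] E bound[OF x] sR
      unfolding ins Zn by simp
  qed
  also have "\<dots> = trexp d s (Z n X) + ?c * (\<Sum>i<d. exp (s * \<mu> i) * (\<Sum>k<d. \<Lambda> k * (cmod (u i k))\<^sup>2))"
    by (subst Bochner_Integration.integral_add)
      (auto intro!: Bochner_Integration.integrable_sum integrable_mult_right integrable_cdot
        simp: integral_cdot Bochner_Integration.integral_sum integrable_cdot prob_space)
  finally show ?thesis .
qed

text \<open>Fubini, integrating coordinate \<open>n\<close> first: an affine recursion that holds
  for fixed earlier samples passes to the expectations.\<close>

lemma trexp_integral_step:
  assumes "\<And>X. X \<in> space (Q n) \<Longrightarrow> (\<integral>x. trexp d s (Z (Suc n) (X(n := x))) \<partial>P) \<le> a * trexp d s (Z n X) + b"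
  shows "(\<integral>X. trexp d s (Z (Suc n) X) \<partial>Q (Suc n)) \<le> a * (\<integral>X. trexp d s (Z n X) \<partial>Q n) + b"
proof -
  interpret Qn: prob_space "Q n" by (rule prob_space_Q)
  have ins: "{..<Suc n} = insert n {..<n}" by auto
  have *: "(\<integral>X. trexp d s (Z (Suc n) X) \<partial>Q (Suc n)) = (\<integral>X. (\<integral>x. trexp d s (Z (Suc n) (X(n := x))) \<partial>P) \<partial>Q n)"
    using product.product_integral_insert[of "{..<n}" n "\<lambda>X. trexp d s (Z (Suc n) X)"] integrable_trexp[of "Suc n" s]
    unfolding ins by simp
  have nn: "0 \<le> (\<integral>x. trexp d s (Z (Suc n) (X(n := x))) \<partial>P)" for X
    by (intro Bochner_Integration.integral_nonneg trexp_nonneg) auto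
  have i: "integrable (Q n) (\<lambda>X. a * trexp d s (Z n X) + b)"
    by (intro Bochner_Integration.integrable_add integrable_mult_right integrable_trexp) auto
  \<comment> \<open>Only the majorant has to be integrable and nonnegative here; its nonnegativity
    follows from \<open>nn\<close> and the assumption.\<close>
  have "(\<integral>X. (\<integral>x. trexp d s (Z (Suc n) (X(n := x))) \<partial>P) \<partial>Q n) \<le> (\<integral>X. a * trexp d s (Z n X) + b \<partial>Q n)"
    using assms by (intro integral_mono_AE' i AE_I2 order_trans[OF nn assms])
  also have "\<dots> = a * (\<integral>X. trexp d s (Z n X) \<partial>Q n) + b"
    using integrable_trexp[of n s] by (simp add: Qn.prob_space)
  finally show ?thesis unfolding * .
qed

lemma trexp_integral_0: "(\<integral>X. trexp d s (Z 0 X) \<partial>Q 0) = real d"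
proof -
  interpret Q0: prob_space "Q 0" by (rule prob_space_Q)
  have "trexp d s (Z 0 X) = real d" for X
  proof -
    obtain u \<mu> where "eigenbasis d (Z 0 X) u \<mu>" "\<And>i. i < d \<Longrightarrow> \<mu> i = (\<Sum>j\<in>{..<0::nat}. (cmod (cdot d (u i) (y (X j))))\<^sup>2)"
      using eigenbasis_exists[of "{..<0::nat}" d "\<lambda>j. y (X j)"] by blast
    then show ?thesis by (simp add: trexp_eigenbasis)
  qed
  then show ?thesis using Q0.prob_space by simp
qed

lemma eigenbasis_unit:
  assumes "eigenbasis d A u \<mu>"
  shows "i < d \<Longrightarrow> (\<Sum>k<d. (cmod (u i k))\<^sup>2) = 1" "k < d \<Longrightarrow> (\<Sum>i<d. (cmod (u i k))\<^sup>2) = 1"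
proof -
  assume "i < d"
  then have "complex_of_real (\<Sum>k<d. (cmod (u i k))\<^sup>2) = 1"
    using assms by (simp only: cdot_self[symmetric]) (simp add: eigenbasis_def)
  then show "(\<Sum>k<d. (cmod (u i k))\<^sup>2) = 1" by (metis of_real_eq_1_iff)
next
  assume "k < d"
  then have "complex_of_real (\<Sum>i<d. (cmod (u i k))\<^sup>2) = 1"
    using assms by (simp add: eigenbasis_def complex_norm_square del: of_real_power)
  then show "(\<Sum>i<d. (cmod (u i k))\<^sup>2) = 1" by (metis of_real_eq_1_iff)
qed

text \<open>With \<open>\<theta> R = 2/3\<close> the factor in \<open>trexp_step\<close> is \<open>-\<theta>/2\<close> for \<open>s = -\<theta>\<close> and \<open>2 \<theta>\<close> for \<open>s = \<theta>\<close>.\<close>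

lemma lower_tail:
  assumes iso: "\<And>k. k < d \<Longrightarrow> \<Lambda> k = 1" and R: "R > 0"
  defines "\<theta> \<equiv> 2 / (3 * R)"
  shows "measure (Q n) {X \<in> space (Q n). exp (- \<theta> * t) \<le> trexp d (- \<theta>) (Z n X)}
    \<le> real d * exp (\<theta> * t - \<theta> / 2 * real n)"
proof -
  interpret Qn: prob_space "Q n" by (rule prob_space_Q)
  have c: "- \<theta> * ((1 + - \<theta> * R / 2) / (1 - - \<theta> * R / 2)) = - \<theta> / 2" and \<theta>R: "- \<theta> * R < 2"
    using R by (simp_all add: \<theta>_def)
  have step: "(\<integral>x. trexp d (- \<theta>) (Z (Suc n) (X(n := x))) \<partial>P) \<le> exp (- \<theta> / 2) * trexp d (- \<theta>) (Z n X) + 0"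
    if X: "X \<in> space (Q n)" for n X
  proof -
    obtain u \<mu> where E: "eigenbasis d (Z n X) u \<mu>" using eigenbasis_exists[of "{..<n}" d "\<lambda>j. y (X j)"] by blast
    \<comment> \<open>Isotropy turns the weighted sum back into \<open>trexp\<close>, so each sample
      contracts the expectation by the factor \<open>1 - \<theta> / 2\<close>.\<close>
    have "(\<Sum>i<d. exp (- \<theta> * \<mu> i) * (\<Sum>k<d. \<Lambda> k * (cmod (u i k))\<^sup>2)) = trexp d (- \<theta>) (Z n X)"
      using eigenbasis_unit(1)[OF E] iso by (simp add: trexp_eigenbasis[OF E])
    then have "(\<integral>x. trexp d (- \<theta>) (Z (Suc n) (X(n := x))) \<partial>P) \<le> (1 + (- \<theta> / 2)) * trexp d (- \<theta>) (Z n X)"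
      using trexp_step[OF \<theta>R X E] unfolding c by (simp add: algebra_simps)
    also have "\<dots> \<le> exp (- \<theta> / 2) * trexp d (- \<theta>) (Z n X)"
      using exp_ge_add_one_self[of "- \<theta> / 2"] trexp_nonneg[of "{..<n}"] by (intro mult_right_mono) auto
    finally show ?thesis by simp
  qed
  have E: "(\<integral>X. trexp d (- \<theta>) (Z n X) \<partial>Q n) \<le> real d * exp (- \<theta> / 2 * real n)" for n
  proof (induction n)
    case 0
    then show ?case unfolding trexp_integral_0 by simp
  next
    case (Suc n)
    have "(\<integral>X. trexp d (- \<theta>) (Z (Suc n) X) \<partial>Q (Suc n)) \<le> exp (- \<theta> / 2) * (\<integral>X. trexp d (- \<theta>) (Z n X) \<partial>Q n) + 0"
      by (rule trexp_integral_step[OF step])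
    also have "\<dots> \<le> exp (- \<theta> / 2) * (real d * exp (- \<theta> / 2 * real n))" using Suc by simp
    also have "\<dots> = real d * exp (- \<theta> / 2 * real (Suc n))" by (simp add: exp_add[symmetric] field_simps)
    finally show ?case .
  qed
  have "measure (Q n) {X \<in> space (Q n). exp (- \<theta> * t) \<le> trexp d (- \<theta>) (Z n X)}
      \<le> (\<integral>X. trexp d (- \<theta>) (Z n X) \<partial>Q n) / exp (- \<theta> * t)"
    by (rule integral_Markov_inequality_measure[where A = "{}", OF integrable_trexp]) (auto intro!: AE_I2 trexp_nonneg)
  also have "\<dots> \<le> real d * exp (- \<theta> / 2 * real n) / exp (- \<theta> * t)" by (intro divide_right_mono E) auto
  also have "\<dots> = real d * (exp (- \<theta> / 2 * real n) / exp (- \<theta> * t))" by simp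
  also have "exp (- \<theta> / 2 * real n) / exp (- \<theta> * t) = exp (\<theta> * t - \<theta> / 2 * real n)"
    by (subst exp_diff[symmetric]) simp
  finally show ?thesis .
qed

text \<open>The bound depends on the truncation \<open>d\<close> only through \<open>T\<close> and
  \<open>L\<close>, which can be chosen for all truncations at once.\<close>

lemma upper_tail:
  assumes \<Lambda>: "\<And>k. k < d \<Longrightarrow> 0 \<le> \<Lambda> k" "\<And>k. k < d \<Longrightarrow> \<Lambda> k \<le> L" and L: "0 \<le> L"
    and T: "(\<Sum>k<d. \<Lambda> k) \<le> T" and R: "R > 0" and t: "t > 0"
  defines "\<theta> \<equiv> 2 / (3 * R)"
  shows "measure (Q n) {X \<in> space (Q n). exp (\<theta> * t) - 1 \<le> trexp d \<theta> (Z n X) - real d}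
    \<le> 2 * \<theta> * T * real n * exp (2 * \<theta> * L * real n) / (exp (\<theta> * t) - 1)"
proof -
  interpret Qn: prob_space "Q n" by (rule prob_space_Q)
  have c: "\<theta> * ((1 + \<theta> * R / 2) / (1 - \<theta> * R / 2)) = 2 * \<theta>" and \<theta>R: "\<theta> * R < 2" and \<theta>: "\<theta> > 0"
    using R by (simp_all add: \<theta>_def)
  have T0: "0 \<le> T" using \<Lambda> sum_nonneg[of "{..<d}" \<Lambda>] T by force
  have step: "(\<integral>x. trexp d \<theta> (Z (Suc n) (X(n := x))) \<partial>P)
      \<le> (1 + 2 * \<theta> * L) * trexp d \<theta> (Z n X) + 2 * \<theta> * (T - L * real d)"
    if X: "X \<in> space (Q n)" for n X
  proof -
    obtain u \<mu> where E: "eigenbasis d (Z n X) u \<mu>"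
      and \<mu>: "\<And>i. i < d \<Longrightarrow> \<mu> i = (\<Sum>j\<in>{..<n}. (cmod (cdot d (u i) (y (X j))))\<^sup>2)"
      using eigenbasis_exists[of "{..<n}" d "\<lambda>j. y (X j)"] by blast
    let ?q = "\<lambda>i. \<Sum>k<d. \<Lambda> k * (cmod (u i k))\<^sup>2"
    have q: "?q i \<le> L" if "i < d" for i
    proof -
      have "?q i \<le> (\<Sum>k<d. L * (cmod (u i k))\<^sup>2)" using \<Lambda> by (intro sum_mono mult_right_mono) auto
      then show ?thesis using eigenbasis_unit(1)[OF E that] by (simp add: sum_distrib_left[symmetric])
    qed
    have \<mu>0: "0 \<le> \<mu> i" if "i < d" for i unfolding \<mu>[OF that] by (intro sum_nonneg) auto
    \<comment> \<open>Split off 1 from each exponential: the constant part sums to the trace of the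
      second moment matrix, at most \<open>T\<close>, and the rest is at most \<open>L\<close> times
      \<open>trexp - d\<close>.\<close>
    have "(\<Sum>i<d. exp (\<theta> * \<mu> i) * ?q i) = (\<Sum>i<d. ?q i) + (\<Sum>i<d. (exp (\<theta> * \<mu> i) - 1) * ?q i)"
      by (simp add: sum.distrib[symmetric] algebra_simps)
    also have "\<dots> \<le> T + (\<Sum>i<d. (exp (\<theta> * \<mu> i) - 1) * L)"
    proof (intro add_mono sum_mono mult_left_mono)
      have "(\<Sum>i<d. ?q i) = (\<Sum>k<d. \<Lambda> k * (\<Sum>i<d. (cmod (u i k))\<^sup>2))"
        by (subst sum.swap) (simp add: sum_distrib_left)
      then show "(\<Sum>i<d. ?q i) \<le> T" using T eigenbasis_unit(2)[OF E] by simp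
    qed (use q \<mu>0 \<theta> in auto)
    also have "\<dots> = T + L * (trexp d \<theta> (Z n X) - real d)"
      by (simp add: trexp_eigenbasis[OF E] sum_distrib_right[symmetric] sum_subtractf)
    finally have "2 * \<theta> * (\<Sum>i<d. exp (\<theta> * \<mu> i) * ?q i) \<le> 2 * \<theta> * (T + L * (trexp d \<theta> (Z n X) - real d))"
      using \<theta> by (intro mult_left_mono) auto
    then show ?thesis using trexp_step[OF \<theta>R X E] unfolding c by (simp add: algebra_simps)
  qed
  \<comment> \<open>Discrete Gronwall argument for \<open>x n\<close>, the expectation of
    \<open>trexp - d\<close>: it starts at 0 and satisfies
    \<open>x (n + 1) \<le> (1 + 2 \<theta> L) x n + 2 \<theta> T\<close>.\<close>
  have E: "(\<integral>X. trexp d \<theta> (Z n X) \<partial>Q n) - real d \<le> 2 * \<theta> * T * real n * exp (2 * \<theta> * L * real n)" for n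
  proof (induction n)
    case 0
    then show ?case unfolding trexp_integral_0 by simp
  next
    case (Suc n)
    let ?b = "2 * \<theta> * T" let ?e = "\<lambda>n. exp (2 * \<theta> * L * real n)"
    have b: "0 \<le> ?b" using \<theta> T0 by simp
    have "(\<integral>X. trexp d \<theta> (Z (Suc n) X) \<partial>Q (Suc n))
        \<le> (1 + 2 * \<theta> * L) * (\<integral>X. trexp d \<theta> (Z n X) \<partial>Q n) + 2 * \<theta> * (T - L * real d)"
      by (rule trexp_integral_step[OF step])
    then have "(\<integral>X. trexp d \<theta> (Z (Suc n) X) \<partial>Q (Suc n)) - real d
        \<le> (1 + 2 * \<theta> * L) * ((\<integral>X. trexp d \<theta> (Z n X) \<partial>Q n) - real d) + ?b"
      by (simp add: algebra_simps)
    also have "\<dots> \<le> (1 + 2 * \<theta> * L) * (?b * real n * ?e n) + ?b"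
      using Suc \<theta> L by (intro add_right_mono mult_left_mono) auto
    also have "\<dots> \<le> exp (2 * \<theta> * L) * (?b * real n * ?e n) + ?b * ?e (Suc n)"
    proof (intro add_mono mult_right_mono exp_ge_add_one_self)
      show "0 \<le> ?b * real n * ?e n" using b by simp
      have "1 \<le> ?e (Suc n)" using \<theta> L by simp
      from mult_left_mono[OF this b] show "?b \<le> ?b * ?e (Suc n)" by (simp only: mult_1_right)
    qed
    also have "\<dots> = ?b * real (Suc n) * ?e (Suc n)"
      by (simp add: exp_add[symmetric] algebra_simps)
    finally show ?case .
  qed
  have pos: "exp (\<theta> * t) - 1 > 0" using \<theta> t by simp
  have nn: "0 \<le> trexp d \<theta> (Z n X) - real d" for X
  proof -
    obtain u \<mu> where E: "eigenbasis d (Z n X) u \<mu>"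
      and \<mu>: "\<And>i. i < d \<Longrightarrow> \<mu> i = (\<Sum>j\<in>{..<n}. (cmod (cdot d (u i) (y (X j))))\<^sup>2)"
      using eigenbasis_exists[of "{..<n}" d "\<lambda>j. y (X j)"] by blast
    have "(\<Sum>i<d. 1) \<le> (\<Sum>i<d. exp (\<theta> * \<mu> i))"
      using \<theta> by (intro sum_mono) (auto simp: \<mu> intro!: mult_nonneg_nonneg sum_nonneg)
    then show ?thesis by (simp add: trexp_eigenbasis[OF E])
  qed
  have "measure (Q n) {X \<in> space (Q n). exp (\<theta> * t) - 1 \<le> trexp d \<theta> (Z n X) - real d}
      \<le> (\<integral>X. trexp d \<theta> (Z n X) - real d \<partial>Q n) / (exp (\<theta> * t) - 1)"
    using integrable_trexp[of n \<theta>] pos nn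
    by (intro integral_Markov_inequality_measure[where A = "{}"]) auto
  also have "(\<integral>X. trexp d \<theta> (Z n X) - real d \<partial>Q n) = (\<integral>X. trexp d \<theta> (Z n X) \<partial>Q n) - real d"
    using integrable_trexp[of n \<theta>] by (simp add: Qn.prob_space)
  also have "\<dots> / (exp (\<theta> * t) - 1) \<le> 2 * \<theta> * T * real n * exp (2 * \<theta> * L * real n) / (exp (\<theta> * t) - 1)"
    using E pos by (intro divide_right_mono) auto
  finally show ?thesis .
qed

end

section \<open>The embedding into the space of square-integrable functions\<close>

lemma infsum_atLeast:
  fixes f :: "nat \<Rightarrow> 'a :: banach"
  assumes "summable (\<lambda>k. norm (f (k + m)))"
  shows "infsum f {m..} = (\<Sum>k. f (k + m))"
proof -
  have "((\<lambda>k. f (k + m)) has_sum (\<Sum>k. f (k + m))) UNIV"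
    by (rule norm_summable_imp_has_sum[OF assms summable_sums[OF summable_norm_cancel[OF assms]]])
  moreover have "range (\<lambda>k. k + m) = {m..}"
    by (auto simp: image_iff) (metis le_add_diff_inverse2)
  ultimately have "(f has_sum (\<Sum>k. f (k + m))) {m..}"
    using has_sum_reindex[of "\<lambda>k. k + m" UNIV f "\<Sum>k. f (k + m)"] by (simp add: inj_on_def o_def)
  then show ?thesis by (rule infsumI)
qed

locale rkhs_embedding = rkhs D H ip K
  for D :: "'a set" and H :: "('a \<Rightarrow> complex) set"
    and ip :: "('a \<Rightarrow> complex) \<Rightarrow> ('a \<Rightarrow> complex) \<Rightarrow> complex" and K :: "'a \<Rightarrow> 'a \<Rightarrow> complex" +
  fixes M :: "'a measure" and lam :: "nat \<Rightarrow> real" and e :: "nat \<Rightarrow> 'a \<Rightarrow> complex"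
  assumes space_M: "space M = D"
    and measurable_K: "(\<lambda>(x, y). K x y) \<in> borel_measurable (M \<Otimes>\<^sub>M M)"
    and finite_trace: "integrable M (\<lambda>x. Re (K x x))"
    and eigen: "eigensystem M H ip lam e"
begin

definition kf :: "'a \<Rightarrow> 'a \<Rightarrow> complex" where
  "kf y = (\<lambda>x. if x \<in> D then K x y else 0)"

lemma kf_in: "y \<in> D \<Longrightarrow> kf y \<in> H"
  unfolding kf_def by (rule kernel_in)

lemma eval_ip: "f \<in> H \<Longrightarrow> y \<in> D \<Longrightarrow> f y = ip f (kf y)"
  unfolding kf_def by (rule reproducing)

lemma K_ip: "x \<in> D \<Longrightarrow> y \<in> D \<Longrightarrow> K x y = ip (kf y) (kf x)"
  using eval_ip[OF kf_in, of y x] by (simp add: kf_def)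

lemma Kxx: "x \<in> D \<Longrightarrow> Re (K x x) = nsq (kf x)" "x \<in> D \<Longrightarrow> 0 \<le> Re (K x x)"
  by (simp_all add: K_ip nonneg kf_in)

lemma eval_bound: "f \<in> H \<Longrightarrow> x \<in> D \<Longrightarrow> (cmod (f x))\<^sup>2 \<le> nsq f * Re (K x x)"
  using Cauchy_Schwarz[OF _ kf_in, of f x] by (simp add: eval_ip[of f x] Kxx)

lemma eval_tendsto:
  assumes "\<And>i. F i \<in> H" "f \<in> H" "(\<lambda>i. nsq (F i - f)) \<longlonglongrightarrow> 0"
  shows "(\<lambda>i. F i x) \<longlonglongrightarrow> f x"
proof (cases "x \<in> D")
  case True
  then show ?thesis using ip_tendsto[OF assms(1,2) kf_in[OF True] assms(3)] assms(1,2) by (simp add: eval_ip[of _ x])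
next
  case False
  then show ?thesis by (simp add: support[OF assms(1)] support[OF assms(2)])
qed

lemma measurable_kf: "y \<in> D \<Longrightarrow> kf y \<in> borel_measurable M"
proof -
  assume y: "y \<in> D"
  have "(\<lambda>x. (\<lambda>(x, y). K x y) (x, y)) \<in> borel_measurable M"
    by (rule measurable_compose[OF _ measurable_K]) (use y space_M in simp)
  then show ?thesis by (subst measurable_cong[where g = "\<lambda>x. K x y"]) (auto simp: kf_def space_M)
qed

text \<open>The measurable members form a closed subspace \<open>V\<close> that contains all kernel
  sections. The Riesz representer in \<open>V\<close> of the functional given by \<open>f\<close> is
  the projection of \<open>f\<close> onto \<open>V\<close>; it has the same inner products with
  kernel sections as \<open>f\<close>, so it agrees with \<open>f\<close> pointwise. No countable
  expansion is needed.\<close>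

lemma measurable_H:
  assumes f: "f \<in> H" shows "f \<in> borel_measurable M"
proof -
  define V where "V = {f \<in> H. f \<in> borel_measurable M}"
  interpret V: hilbert_function_space D V ip
  proof
    have "cscale c f \<in> borel_measurable M" if "f \<in> borel_measurable M" for c f
      using that unfolding cscale_def by measurable
    moreover have "f + g \<in> borel_measurable M" if "f \<in> borel_measurable M" "g \<in> borel_measurable M" for f g :: "'a \<Rightarrow> complex"
      using that unfolding plus_fun_def by measurable
    ultimately show "cfun.subspace V"
      unfolding cfun.subspace_def V_def using in_intros by (auto simp: zero_fun_def)
  next
    fix F assume F: "\<And>i::nat. F i \<in> V"
      and C: "\<And>\<epsilon>. \<epsilon> > 0 \<Longrightarrow> \<exists>N. \<forall>i\<ge>N. \<forall>j\<ge>N. hnorm ip (F i - F j) < \<epsilon>"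
    have FH: "F i \<in> H" for i using F by (auto simp: V_def)
    from complete[OF FH C] obtain g where g: "g \<in> H" "(\<lambda>i. hnorm ip (F i - g)) \<longlonglongrightarrow> 0" by auto
    have lim: "(\<lambda>i. nsq (F i - g)) \<longlonglongrightarrow> 0"
      using tendsto_power[OF g(2), of 2] g(1) FH by (simp add: hnorm_sq in_diff)
    have "g \<in> borel_measurable M"
      by (rule borel_measurable_LIMSEQ_metric[of F]) (use F eval_tendsto[OF FH g(1) lim] in \<open>auto simp: V_def\<close>)
    with g show "\<exists>f\<in>V. (\<lambda>i. hnorm ip (F i - f)) \<longlonglongrightarrow> 0" by (auto simp: V_def)
  qed (auto simp: V_def support ip_add ip_scale ip_pos intro: ip_cnj)
  obtain g where g: "g \<in> V" "\<And>h. h \<in> V \<Longrightarrow> ip h g = ip h f"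
  proof (rule V.Riesz[of "\<lambda>h. ip h f" "nsq f"])
    show "(cmod (ip h f))\<^sup>2 \<le> nsq f * nsq h" if "h \<in> V" for h
      using Cauchy_Schwarz[of h f] that f by (simp add: V_def mult.commute)
  qed (use f in \<open>auto simp: V_def add_left scale_left nonneg\<close>)
  have "g x = f x" for x
  proof (cases "x \<in> D")
    case True
    have "ip (kf x) g = ip (kf x) f" using g(2)[of "kf x"] kf_in[OF True] measurable_kf[OF True] by (simp add: V_def)
    then have "ip g (kf x) = ip f (kf x)" using ip_cnj[OF kf_in[OF True]] g(1) f by (simp add: V_def)
    then show ?thesis using eval_ip[OF f True] eval_ip[of g x] g(1) True by (simp add: V_def)
  next
    case False
    then show ?thesis using g(1) support[of g x] support[OF f] by (simp add: V_def)
  qed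
  then have "g = f" by auto
  with g(1) show ?thesis by (simp add: V_def)
qed

lemma L2_bound:
  assumes "f \<in> H" shows "integrable M (\<lambda>x. (cmod (f x))\<^sup>2)" "(\<integral>x. (cmod (f x))\<^sup>2 \<partial>M) \<le> nsq f * kernel_trace M K"
proof -
  have i: "integrable M (\<lambda>x. nsq f * Re (K x x))" using finite_trace by simp
  show 1: "integrable M (\<lambda>x. (cmod (f x))\<^sup>2)"
    by (rule Bochner_Integration.integrable_bound[OF i])
      (use measurable_H[OF assms] eval_bound[OF assms] space_M in \<open>auto intro!: AE_I2 intro: order_trans[OF _ abs_ge_self]\<close>)
  show "(\<integral>x. (cmod (f x))\<^sup>2 \<partial>M) \<le> nsq f * kernel_trace M K"
    unfolding kernel_trace_def integral_mult_right_zero[symmetric]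
    by (rule integral_mono[OF 1 i]) (use eval_bound[OF assms] space_M in auto)
qed

lemma integrable_mult:
  assumes "f \<in> H" "g \<in> H" shows "integrable M (\<lambda>x. f x * cnj (g x))"
proof (rule Bochner_Integration.integrable_bound)
  show "integrable M (\<lambda>x. (cmod (f x))\<^sup>2 + (cmod (g x))\<^sup>2)"
    using assms by (intro Bochner_Integration.integrable_add L2_bound)
  show "(\<lambda>x. f x * cnj (g x)) \<in> borel_measurable M"
    using measurable_H[OF assms(1)] measurable_H[OF assms(2)] by measurable
  have "a * b \<le> a\<^sup>2 + b\<^sup>2" if "0 \<le> a" "0 \<le> b" for a b :: real
    using sum_squares_bound[of a b] mult_nonneg_nonneg[OF that] by simp
  then show "AE x in M. norm (f x * cnj (g x)) \<le> norm ((cmod (f x))\<^sup>2 + (cmod (g x))\<^sup>2)"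
    by (intro AE_I2) (simp add: norm_mult)
qed

sublocale L2: psd_form H "L2_inner M"
proof
  show "L2_inner M (f + g) h = L2_inner M f h + L2_inner M g h" if "f \<in> H" "g \<in> H" "h \<in> H" for f g h
    using that by (simp add: L2_inner_def distrib_right integrable_mult)
  show "L2_inner M (cscale c f) g = c * L2_inner M f g" for c f g
    by (simp add: L2_inner_def cscale_def mult.assoc)
  show "L2_inner M g f = cnj (L2_inner M f g)" for f g
    unfolding L2_inner_def by (subst Bochner_Integration.integral_cnj[symmetric]) (simp add: mult.commute)
  show "0 \<le> Re (L2_inner M f f)" for f
    unfolding L2_inner_def complex_norm_square[symmetric] integral_complex_of_real by simp
qed (rule sub)

lemma L2_self: "Re (L2_inner M f f) = (\<integral>x. (cmod (f x))\<^sup>2 \<partial>M)"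
  unfolding L2_inner_def complex_norm_square[symmetric] integral_complex_of_real by simp

text \<open>Bessel's inequality for the kernel section at \<open>x\<close>, whose coefficients are
  the conjugates of the values \<open>u i x\<close>.\<close>

lemma quasi_orthonormal_pointwise:
  assumes "quasi_orthonormal I u" "finite I" "x \<in> D"
  shows "(\<Sum>i\<in>I. (cmod (u i x))\<^sup>2) \<le> Re (K x x)"
proof -
  have "(\<Sum>i\<in>I. (cmod (ip (kf x) (u i)))\<^sup>2) \<le> nsq (kf x)"
    using Bessel[OF assms(1,2) kf_in[OF assms(3)]] .
  moreover have "cmod (ip (kf x) (u i)) = cmod (u i x)" if "i \<in> I" for i
    using eval_ip[of "u i" x] ip_cnj[of "u i" "kf x"] quasi_orthonormalD(1)[OF assms(1) that] assms(3) kf_in by simp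
  ultimately show ?thesis using assms(3) by (simp add: Kxx)
qed

lemma trace_bound:
  assumes "quasi_orthonormal I u" "finite I"
  shows "(\<Sum>i\<in>I. Re (L2_inner M (u i) (u i))) \<le> kernel_trace M K"
proof -
  have i: "integrable M (\<lambda>x. (cmod (u i x))\<^sup>2)" if "i \<in> I" for i
    using quasi_orthonormalD(1)[OF assms(1) that] by (rule L2_bound)
  have "(\<Sum>i\<in>I. Re (L2_inner M (u i) (u i))) = (\<integral>x. (\<Sum>i\<in>I. (cmod (u i x))\<^sup>2) \<partial>M)"
    by (simp add: L2_self Bochner_Integration.integral_sum i)
  also have "\<dots> \<le> kernel_trace M K"
    unfolding kernel_trace_def
    by (intro integral_mono Bochner_Integration.integrable_sum i finite_trace quasi_orthonormal_pointwise[OF assms])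
      (auto simp: space_M)
  finally show ?thesis .
qed

text \<open>Justifies the definite description: Riesz representation gives existence, definiteness
  of \<open>ip\<close> gives uniqueness.\<close>

lemma embedding_adjoint:
  assumes f: "f \<in> H"
  shows "embedding_adjoint M H ip f \<in> H" "h \<in> H \<Longrightarrow> ip h (embedding_adjoint M H ip f) = L2_inner M h f"
proof -
  have tr: "0 \<le> kernel_trace M K" using trace_bound[of "{}" "\<lambda>_. 0"] by (simp add: quasi_orthonormal_def)
  obtain g where g: "g \<in> H" "\<And>h. h \<in> H \<Longrightarrow> ip h g = L2_inner M h f"
  proof (rule Riesz[of "\<lambda>h. L2_inner M h f" "kernel_trace M K * Re (L2_inner M f f)"])
    show "(cmod (L2_inner M h f))\<^sup>2 \<le> kernel_trace M K * Re (L2_inner M f f) * nsq h" if h: "h \<in> H" for h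
    proof -
      have "(cmod (L2_inner M h f))\<^sup>2 \<le> Re (L2_inner M h h) * Re (L2_inner M f f)"
        by (rule L2.Cauchy_Schwarz[OF h f])
      also have "\<dots> \<le> (nsq h * kernel_trace M K) * Re (L2_inner M f f)"
        using L2_bound(2)[OF h] L2.nonneg[OF f] by (intro mult_right_mono) (simp_all add: L2_self)
      finally show ?thesis by (simp add: mult_ac)
    qed
  qed (use f tr L2.nonneg[OF f] in \<open>auto simp: L2.add_left L2.scale_left\<close>)
  have "\<exists>!g. g \<in> H \<and> (\<forall>h\<in>H. ip h g = L2_inner M h f)"
  proof (rule ex1I[of _ g])
    fix g' assume g': "g' \<in> H \<and> (\<forall>h\<in>H. ip h g' = L2_inner M h f)"
    then have "ip (g' - g) (g' - g) = 0"
      using g in_diff[of g' g] by (simp add: diff_right)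
    then have "g' - g = 0" using nsq_eq_0[OF in_diff[of g' g]] g g' by simp
    then show "g' = g" by simp
  qed (use g in auto)
  from theI'[OF this] show "embedding_adjoint M H ip f \<in> H"
      "h \<in> H \<Longrightarrow> ip h (embedding_adjoint M H ip f) = L2_inner M h f"
    unfolding embedding_adjoint_def by auto
qed

section \<open>Eigenfunctions of the embedding, their completeness, and the kernel part\<close>

lemma lam_nonneg: "1 \<le> k \<Longrightarrow> 0 \<le> lam k"
  and lam_Suc: "1 \<le> k \<Longrightarrow> lam (Suc k) \<le> lam k"
  and e_zero: "1 \<le> k \<Longrightarrow> lam k = 0 \<Longrightarrow> e k = 0"
  and e_orth: "1 \<le> k \<Longrightarrow> 1 \<le> l \<Longrightarrow> 0 < lam k \<Longrightarrow> 0 < lam l \<Longrightarrow> ip (e k) (e l) = (if k = l then 1 else 0)"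
  and eigenspace: "\<mu> > 0 \<Longrightarrow> {f \<in> H. embedding_adjoint M H ip f = cscale (complex_of_real \<mu>) f}
              = cfun.span {e k |k. 1 \<le> k \<and> lam k = \<mu>}"
  using eigen unfolding eigensystem_def by auto

lemma lam_mono:
  assumes "1 \<le> k" "k \<le> l" shows "lam l \<le> lam k"
  using assms(2)
proof (induction l rule: dec_induct)
  case (step l)
  then show ?case using lam_Suc[of l] assms(1) by simp
qed simp

text \<open>Membership in \<open>H\<close> is not a separate clause of \<open>eigensystem\<close>:
  for a positive eigenvalue it follows because \<open>e k\<close> lies in the span that equals the
  eigenspace, and otherwise \<open>e k = 0\<close>.\<close>

lemma e_in: "1 \<le> k \<Longrightarrow> e k \<in> H"
  and L2_e: "1 \<le> k \<Longrightarrow> h \<in> H \<Longrightarrow> L2_inner M h (e k) = complex_of_real (lam k) * ip h (e k)"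
proof -
  assume k: "1 \<le> k"
  have "e k \<in> H \<and> (\<forall>h\<in>H. L2_inner M h (e k) = complex_of_real (lam k) * ip h (e k))"
  proof (cases "lam k = 0")
    case True
    then show ?thesis using e_zero[OF k] in_zero L2.zero_right by simp
  next
    case False
    then have pos: "lam k > 0" using lam_nonneg[OF k] by simp
    have "e k \<in> cfun.span {e i |i. 1 \<le> i \<and> lam i = lam k}" by (rule cfun.span_base) (use k in auto)
    then have ek: "e k \<in> H" "embedding_adjoint M H ip (e k) = cscale (complex_of_real (lam k)) (e k)"
      using eigenspace[OF pos] by auto
    then show ?thesis using embedding_adjoint(2)[OF ek(1)] by (simp add: scale_right)
  qed
  then show "e k \<in> H" "h \<in> H \<Longrightarrow> L2_inner M h (e k) = complex_of_real (lam k) * ip h (e k)" by auto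
qed

lemma quasi_orthonormal_e: "quasi_orthonormal {1..} e"
  unfolding quasi_orthonormal_def
proof (intro conjI ballI impI)
  fix k :: nat assume k: "k \<in> {1..}"
  then show "e k \<in> H" using e_in by simp
  show "e k = 0 \<or> ip (e k) (e k) = 1" using k e_zero e_orth[of k k] lam_nonneg[of k] by fastforce
  fix l :: nat assume l: "l \<in> {1..}" "k \<noteq> l"
  show "ip (e k) (e l) = 0"
  proof (cases "lam k = 0 \<or> lam l = 0")
    case True
    then show ?thesis using k l e_zero e_in zero_left zero_right by auto
  next
    case False
    then show ?thesis using k l e_orth[of k l] lam_nonneg[of k] lam_nonneg[of l] by simp
  qed
qed

lemma lam_L2: "1 \<le> k \<Longrightarrow> complex_of_real (lam k) = L2_inner M (e k) (e k)"
  using L2_e[of k "e k"] e_in[of k] e_orth[of k k] lam_nonneg[of k] e_zero[of k] L2.zero_left[of 0] in_zero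
  by (cases "lam k = 0") auto

lemma lam_Re: "1 \<le> k \<Longrightarrow> Re (L2_inner M (e k) (e k)) = lam k"
  by (simp only: lam_L2[symmetric] Re_complex_of_real)

lemma summable_lam: "summable (\<lambda>k. lam (k + m))" if "1 \<le> m"
proof (rule bounded_imp_summable)
  fix n
  have "quasi_orthonormal {m..n + m} e" by (rule quasi_orthonormal_subset[OF quasi_orthonormal_e]) (use that in auto)
  from trace_bound[OF this] have "(\<Sum>k=m..n+m. Re (L2_inner M (e k) (e k))) \<le> kernel_trace M K" by simp
  moreover have "(\<Sum>k=m..n+m. Re (L2_inner M (e k) (e k))) = (\<Sum>k=m..n+m. lam k)"
    using that by (intro sum.cong refl lam_Re) auto
  moreover have "(\<Sum>k\<le>n. lam (k + m)) = (\<Sum>k=m..n+m. lam k)"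
    using sum.shift_bounds_cl_nat_ivl[of lam 0 m n] by (simp add: atMost_atLeast0)
  ultimately show "(\<Sum>k\<le>n. lam (k + m)) \<le> kernel_trace M K" by simp
qed (use that lam_nonneg in auto)

text \<open>If the L2 form were positive somewhere on the complement \<open>O'\<close> of all
  \<open>e k\<close>, \<open>form_eigenvector\<close> would give an eigenvector there. As the
  adjoint maps it into \<open>O'\<close> again, it is an eigenvector in \<open>H\<close> and so lies
  in a span of the \<open>e k\<close>, to which it is orthogonal.\<close>

lemma complete_e:
  assumes f: "f \<in> H" and orth: "\<And>k. 1 \<le> k \<Longrightarrow> ip f (e k) = 0"
  shows "AE x in M. f x = 0"
proof -
  define O' where "O' = {f \<in> H. \<forall>i\<in>{1..}. ip f (e i) = 0}"
  interpret O: hilbert_function_space D O' ip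
    unfolding O'_def by (rule hilbert_orthogonal) (auto intro: e_in)
  have psd: "psd_form O' (L2_inner M)"
    by (rule psd_form_subset[OF L2.psd_form_axioms O.sub]) (auto simp: O'_def)
  have no: "Re (L2_inner M h0 h0) \<le> 0" if h0: "h0 \<in> O'" for h0
  proof (rule ccontr)
    assume "\<not> ?thesis"
    then have pos: "Re (L2_inner M h0 h0) > 0" by simp
    have tr: "(\<Sum>i\<in>I. Re (L2_inner M (u i) (u i))) \<le> kernel_trace M K"
      if "finite I" "O.quasi_orthonormal I u" for I :: "nat set" and u
    proof (rule trace_bound[OF _ that(1)])
      show "quasi_orthonormal I u"
        using that(2) unfolding O.quasi_orthonormal_def quasi_orthonormal_def by (simp add: O'_def)
    qed
    obtain g \<mu> where g: "g \<in> O'" "O.nsq g = 1" "\<mu> > 0"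
        "\<And>h. h \<in> O' \<Longrightarrow> L2_inner M h g = complex_of_real \<mu> * ip h g"
      by (rule O.form_eigenvector[OF psd _ h0 pos], rule tr) (assumption+, rule that)
    have gH: "g \<in> H" and ge: "\<And>k. 1 \<le> k \<Longrightarrow> ip g (e k) = 0" using g(1) by (auto simp: O'_def)
    let ?a = "embedding_adjoint M H ip g"
    note a = embedding_adjoint[OF gH]
    have "ip ?a (e k) = 0" if k: "1 \<le> k" for k
    proof -
      have "ip (e k) ?a = cnj (L2_inner M g (e k))" using a(2)[OF e_in[OF k]] L2.cnj_sym[OF gH e_in[OF k]] by simp
      also have "\<dots> = 0" using L2_e[OF k gH] ge[OF k] by simp
      finally show ?thesis using ip_cnj[OF e_in[OF k] a(1)] by simp
    qed
    then have aO: "?a \<in> O'" using a(1) by (simp add: O'_def)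
    \<comment> \<open>The defect of the eigenvalue equation in \<open>H\<close>. It lies in
      \<open>O'\<close>, where the equation for \<open>g\<close> may be tested, so it can be tested
      against itself.\<close>
    define w where "w = ?a - cscale (complex_of_real \<mu>) g"
    have w: "w \<in> O'" unfolding w_def by (intro O.in_diff O.in_scale aO g(1))
    then have wH: "w \<in> H" by (simp add: O'_def)
    have "ip w w = ip w ?a - complex_of_real \<mu> * ip w g"
      using wH a(1) gH by (subst (2) w_def) (simp add: diff_right scale_right in_scale)
    also have "\<dots> = 0" using a(2)[OF wH] g(4)[OF w] by simp
    finally have "w = 0" using nsq_eq_0[OF wH] by simp
    then have "?a = cscale (complex_of_real \<mu>) g" by (simp add: w_def)
    then have "g \<in> cfun.span {e k |k. 1 \<le> k \<and> lam k = \<mu>}" using eigenspace[OF g(3)] gH by auto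
    moreover have "cfun.span {e k |k. 1 \<le> k \<and> lam k = \<mu>} \<subseteq> {h \<in> H. ip h g = 0}"
    proof (rule cfun.span_minimal)
      show "{e k |k. 1 \<le> k \<and> lam k = \<mu>} \<subseteq> {h \<in> H. ip h g = 0}"
        using ge e_in ip_cnj[OF gH e_in] by auto
      show "cfun.subspace {h \<in> H. ip h g = 0}"
        unfolding cfun.subspace_def using gH by (auto simp: in_intros add_left scale_left zero_left)
    qed
    ultimately have "ip g g = 0" by auto
    with g(2) show False by simp
  qed
  have "f \<in> O'" using f orth by (simp add: O'_def)
  from no[OF this] have "(\<integral>x. (cmod (f x))\<^sup>2 \<partial>M) = 0" using L2.nonneg[OF f] unfolding L2_self by linarith
  then show ?thesis using integral_nonneg_eq_0_iff_AE[OF L2_bound(1)[OF f]] by simp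
qed

text \<open>Bessel's inequality makes the partial sums of the Fourier series Cauchy; their limit
  \<open>s\<close> is the projection of \<open>f\<close> onto the closed span of the
  \<open>e k\<close>, and \<open>g = f - s\<close>. The properties are bundled in one existential
  because \<open>kernel_part\<close> selects \<open>g\<close> by \<open>SOME\<close>.\<close>

lemma decomposition:
  assumes f: "f \<in> H"
  shows "\<exists>g. g \<in> H \<and> (\<forall>k\<ge>1. ip g (e k) = 0) \<and>
    (\<forall>h\<in>H. (\<forall>k\<ge>1. ip h (e k) = 0) \<longrightarrow> ip h f = ip h g) \<and>
    (\<forall>x. (\<lambda>N. \<Sum>k<N. ip f (e (Suc k)) * e (Suc k) x) \<longlonglongrightarrow> f x - g x) \<and>
    (\<lambda>k. (cmod (ip f (e (Suc k))))\<^sup>2) sums (nsq f - nsq g)"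
proof -
  define c where "c k = ip f (e (Suc k))" for k
  have qo: "quasi_orthonormal I (\<lambda>k. e (Suc k))" for I
    using quasi_orthonormal_e unfolding quasi_orthonormal_def by auto
  note qD = quasi_orthonormalD[OF qo[of UNIV], simplified]
  define S where "S N = (\<Sum>k<N. cscale (c k) (e (Suc k)))" for N
  have S: "S N \<in> H" for N unfolding S_def by (intro in_sum in_scale e_in) auto
  note res = residual[OF qo finite_lessThan f, folded c_def, folded S_def]
  have le: "(\<Sum>k<N. (cmod (c k))\<^sup>2) \<le> nsq f" for N
    using Bessel[OF qo finite_lessThan f, of N] by (simp add: c_def)
  have sm: "summable (\<lambda>k. (cmod (c k))\<^sup>2)"
    by (rule bounded_imp_summable[where B = "nsq f"]) (use le[of "Suc _"] in \<open>auto simp: lessThan_Suc_atMost\<close>)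
  have SN: "nsq (S j - S i) = (\<Sum>k\<in>{i..<j}. (cmod (c k))\<^sup>2)" if "i \<le> j" for i j
  proof -
    have "S j - S i = (\<Sum>k\<in>{i..<j}. cscale (c k) (e (Suc k)))"
      unfolding S_def lessThan_atLeast0 using sum_diff_nat_ivl[of 0 i j] that by simp
    then have "nsq (S j - S i) = (\<Sum>k\<in>{i..<j}. if e (Suc k) \<noteq> 0 then (cmod (c k))\<^sup>2 else 0)"
      using norm_comb[OF qo, of "{i..<j}" c] by simp
    also have "\<dots> = (\<Sum>k\<in>{i..<j}. (cmod (c k))\<^sup>2)"
      by (intro sum.cong) (auto simp: c_def zero_right f)
    finally show ?thesis .
  qed
  have sym: "nsq (a - b) = nsq (b - a)" if "a \<in> H" "b \<in> H" for a b
    using that by (simp add: expand_diff Re_commute[of a b])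
  obtain s where s: "s \<in> H" "(\<lambda>N. nsq (S N - s)) \<longlonglongrightarrow> 0"
  proof (rule complete_nsq[OF S])
    fix \<epsilon> :: real assume "\<epsilon> > 0"
    with sm obtain N where N: "\<And>i j. i \<ge> N \<Longrightarrow> norm (\<Sum>k\<in>{i..<j}. (cmod (c k))\<^sup>2) < \<epsilon>"
      unfolding summable_Cauchy by blast
    have "nsq (S i - S j) < \<epsilon>" if "i \<ge> N" "j \<ge> N" for i j
    proof (cases "i \<le> j")
      case True
      then show ?thesis using N[OF that(1), of j] SN[OF True] sym[OF S S, of i j] by simp
    next
      case False
      then show ?thesis using N[OF that(2), of i] SN[of j i] by simp
    qed
    then show "\<exists>N. \<forall>i\<ge>N. \<forall>j\<ge>N. nsq (S i - S j) < \<epsilon>" by blast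
  qed
  have evalS: "S N x = (\<Sum>k<N. c k * e (Suc k) x)" for N x
    unfolding S_def by (induction N) (simp_all add: cscale_def)
  have se: "ip s (e (Suc k)) = c k" for k
  proof (rule LIMSEQ_unique)
    show "(\<lambda>N. ip (S N) (e (Suc k))) \<longlonglongrightarrow> ip s (e (Suc k))"
      by (rule ip_tendsto[OF S s(1) e_in s(2)]) simp
    have "ip (S N) (e (Suc k)) = c k" if "N \<ge> Suc k" for N
      unfolding S_def using ip_comb[OF qo finite_lessThan order_refl, of k N c] that
      by (auto simp: c_def zero_right f)
    then show "(\<lambda>N. ip (S N) (e (Suc k))) \<longlonglongrightarrow> c k"
      by (intro tendsto_eventually) (auto simp: eventually_sequentially)
  qed
  have "ip (f - s) (e k) = 0" if "1 \<le> k" for k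
    using se[of "k - 1"] that f s(1) e_in[OF that] by (simp add: diff_left c_def)
  moreover have "ip h f = ip h (f - s)" if h: "h \<in> H" "\<forall>k\<ge>1. ip h (e k) = 0" for h
  proof -
    have "ip (S N) h = 0" for N
    proof -
      have "ip (S N) h = (\<Sum>k<N. c k * ip (e (Suc k)) h)"
        unfolding S_def using h e_in by (subst sum_left) (auto intro!: in_scale simp: scale_left)
      also have "\<dots> = 0" using h e_in ip_cnj[OF h(1) e_in] by (intro sum.neutral) auto
      finally show ?thesis .
    qed
    then have "(\<lambda>N. 0) \<longlonglongrightarrow> ip s h" using ip_tendsto[OF S s(1) h(1) s(2)] by simp
    then have "ip s h = 0" using LIMSEQ_unique[OF tendsto_const] by metis
    then have "ip h s = 0" using ip_cnj[OF s(1) h(1)] by simp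
    then show ?thesis using h f s by (simp add: diff_right)
  qed
  moreover have "(\<lambda>N. \<Sum>k<N. ip f (e (Suc k)) * e (Suc k) x) \<longlonglongrightarrow> f x - (f - s) x" for x
    using eval_tendsto[OF S s, of x] by (simp add: evalS c_def)
  moreover have "(\<lambda>k. (cmod (c k))\<^sup>2) sums (nsq f - nsq (f - s))"
  proof -
    have "(\<lambda>N. nsq (S N)) \<longlonglongrightarrow> nsq s"
    proof -
      have "(\<lambda>i. nsq (S i - s) + 2 * Re (ip (S i) s) - nsq s) \<longlonglongrightarrow> 0 + 2 * Re (ip s s) - nsq s"
        by (intro tendsto_intros s tendsto_Re ip_tendsto[OF S s(1) s(1) s(2)])
      then show ?thesis using S s(1) by (simp add: expand_diff)
    qed
    moreover have "nsq (S N) = (\<Sum>k<N. (cmod (c k))\<^sup>2)" for N using res(3) .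
    moreover have "nsq (f - s) = nsq f - nsq s"
    proof -
      have "ip (S N) s = ip (S N) f" for N
      proof -
        have "ip (S N) (f - s) = (\<Sum>k<N. c k * ip (e (Suc k)) (f - s))"
          unfolding S_def using f s(1) in_diff e_in by (subst sum_left) (auto intro!: in_scale simp: scale_left)
        also have "\<dots> = 0"
        proof (intro sum.neutral ballI)
          fix k
          have "ip (f - s) (e (Suc k)) = 0" using se[of k] f s(1) e_in[of "Suc k"] by (simp add: diff_left c_def)
          then show "c k * ip (e (Suc k)) (f - s) = 0"
            using ip_cnj[OF in_diff[OF f s(1)] e_in[of "Suc k"]] by simp
        qed
        finally show ?thesis using S f s(1) by (simp add: diff_right)
      qed
      then have "(\<lambda>N. ip (S N) s) \<longlonglongrightarrow> ip s f" using ip_tendsto[OF S s(1) f s(2)] by simp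
      then have "ip s f = ip s s" using LIMSEQ_unique ip_tendsto[OF S s(1) s(1) s(2)] by blast
      then show ?thesis using f s(1) by (simp add: expand_diff Re_commute[of s f])
    qed
    ultimately show ?thesis by (simp add: sums_def)
  qed
  ultimately show ?thesis using in_diff[OF f s(1)] unfolding c_def by (intro exI[of _ "f - s"]) auto
qed

text \<open>The component of \<open>f\<close> in the kernel of the embedding.\<close>

definition kernel_part :: "('a \<Rightarrow> complex) \<Rightarrow> 'a \<Rightarrow> complex" where
  "kernel_part f = (SOME g. g \<in> H \<and> (\<forall>k\<ge>1. ip g (e k) = 0) \<and>
    (\<forall>h\<in>H. (\<forall>k\<ge>1. ip h (e k) = 0) \<longrightarrow> ip h f = ip h g) \<and>
    (\<forall>x. (\<lambda>N. \<Sum>k<N. ip f (e (Suc k)) * e (Suc k) x) \<longlonglongrightarrow> f x - g x) \<and>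
    (\<lambda>k. (cmod (ip f (e (Suc k))))\<^sup>2) sums (nsq f - nsq g))"

lemma kernel_part:
  assumes "f \<in> H"
  shows "kernel_part f \<in> H" "\<And>k. 1 \<le> k \<Longrightarrow> ip (kernel_part f) (e k) = 0"
    "\<And>h. h \<in> H \<Longrightarrow> (\<And>k. 1 \<le> k \<Longrightarrow> ip h (e k) = 0) \<Longrightarrow> ip h f = ip h (kernel_part f)"
    "\<And>x. (\<lambda>N. \<Sum>k<N. ip f (e (Suc k)) * e (Suc k) x) \<longlonglongrightarrow> f x - kernel_part f x"
    "(\<lambda>k. (cmod (ip f (e (Suc k))))\<^sup>2) sums (nsq f - nsq (kernel_part f))"
  using someI_ex[OF decomposition[OF assms]] unfolding kernel_part_def by blast+

end

section \<open>The sampling density\<close>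

context rkhs_embedding
begin

lemma measurable_e: "1 \<le> k \<Longrightarrow> e k \<in> borel_measurable M"
  by (intro measurable_H e_in)

lemma ip_kf_e: "x \<in> D \<Longrightarrow> 1 \<le> k \<Longrightarrow> ip (kf x) (e k) = cnj (e k x)"
  using eval_ip[OF e_in, of k x] ip_cnj[OF e_in kf_in, of k x] by simp

text \<open>Parseval for the kernel section at \<open>x\<close>: its coefficients are the conjugates
  of the values of the \<open>e k\<close> at \<open>x\<close>.\<close>

lemma e_sums: "x \<in> D \<Longrightarrow> (\<lambda>k. (cmod (e (Suc k) x))\<^sup>2) sums (Re (K x x) - nsq (kernel_part (kf x)))"
  using kernel_part(5)[OF kf_in, of x] by (simp add: ip_kf_e Kxx)

lemma summable_e: "x \<in> D \<Longrightarrow> 1 \<le> m \<Longrightarrow> summable (\<lambda>k. (cmod (e (k + m) x))\<^sup>2)"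
  using summable_ignore_initial_segment[OF sums_summable[OF e_sums], of x "m - 1"] by simp

lemma K1_summable: "x \<in> D \<Longrightarrow> y \<in> D \<Longrightarrow> summable (\<lambda>k. norm (e (Suc k) x * cnj (e (Suc k) y)))"
proof (rule summable_comparison_test'[where N = 0])
  assume "x \<in> D" "y \<in> D"
  then show "summable (\<lambda>k. (cmod (e (Suc k) x))\<^sup>2 + (cmod (e (Suc k) y))\<^sup>2)"
    by (intro summable_add sums_summable[OF e_sums])
  have "a * b \<le> a\<^sup>2 + b\<^sup>2" if "0 \<le> a" "0 \<le> b" for a b :: real
    using sum_squares_bound[of a b] mult_nonneg_nonneg[OF that] by simp
  then show "norm (norm (e (Suc k) x * cnj (e (Suc k) y))) \<le> (cmod (e (Suc k) x))\<^sup>2 + (cmod (e (Suc k) y))\<^sup>2" for k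
    by (simp add: norm_mult)
qed

lemma K1_suminf:
  assumes "x \<in> D" "y \<in> D" shows "K1 e x y = (\<Sum>k. e (Suc k) x * cnj (e (Suc k) y))"
  unfolding K1_def using infsum_atLeast[of "\<lambda>k. e k x * cnj (e k y)" 1] K1_summable[OF assms] by simp

text \<open>Identifies \<open>K0\<close> as the reproducing kernel of the orthogonal complement of
  the \<open>e k\<close>, which makes its values inner products in \<open>H\<close>.\<close>

lemma K0_kernel_part:
  assumes "x \<in> D" "y \<in> D" shows "K0 K e x y = kernel_part (kf y) x"
proof -
  have "(\<lambda>k. e (Suc k) x * cnj (e (Suc k) y)) sums (K x y - kernel_part (kf y) x)"
    using kernel_part(4)[OF kf_in[OF assms(2)], of x] assms
    by (simp add: sums_def ip_kf_e mult.commute) (simp add: kf_def)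
  then show ?thesis by (simp add: K0_def K1_suminf[OF assms] sums_iff)
qed

lemma K0_ip:
  assumes "x \<in> D" "y \<in> D" shows "K0 K e x y = ip (kernel_part (kf y)) (kernel_part (kf x))"
proof -
  note kp = kernel_part[OF kf_in]
  show ?thesis unfolding K0_kernel_part[OF assms]
    using eval_ip[OF kp(1)[OF assms(2)] assms(1)] kp(3)[OF assms(1) kp(1)[OF assms(2)]] kp(2)[OF assms(2)] by simp
qed

lemma K0_diag: "x \<in> D \<Longrightarrow> Re (K0 K e x x) = nsq (kernel_part (kf x))"
  and K0_nonneg: "x \<in> D \<Longrightarrow> 0 \<le> Re (K0 K e x x)"
  and K0_le: "x \<in> D \<Longrightarrow> Re (K0 K e x x) \<le> Re (K x x)"
proof -
  assume x: "x \<in> D"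
  show d: "Re (K0 K e x x) = nsq (kernel_part (kf x))" by (simp add: K0_ip x)
  show "0 \<le> Re (K0 K e x x)" unfolding d by (intro nonneg kernel_part kf_in x)
  have "0 \<le> Re (K x x) - nsq (kernel_part (kf x))"
    using sums_le[OF _ sums_zero e_sums[OF x]] by simp
  then show "Re (K0 K e x x) \<le> Re (K x x)" unfolding d by simp
qed

lemma K0_sum: "x \<in> D \<Longrightarrow> Re (K0 K e x x) = Re (K x x) - (\<Sum>k. (cmod (e (Suc k) x))\<^sup>2)"
  using e_sums[of x] by (simp add: K0_diag sums_iff)

lemma measurable_Kxx: "(\<lambda>x. K x x) \<in> borel_measurable M"
proof -
  have "(\<lambda>x. (\<lambda>(x, y). K x y) (x, x)) \<in> borel_measurable M"
    by (rule measurable_compose[OF _ measurable_K]) measurable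
  then show ?thesis by simp
qed

lemma measurable_K0_diag: "(\<lambda>x. Re (K0 K e x x)) \<in> borel_measurable M"
proof -
  have "(\<lambda>x. Re (K x x) - (\<Sum>k. (cmod (e (Suc k) x))\<^sup>2)) \<in> borel_measurable M"
  proof (intro borel_measurable_diff borel_measurable_suminf)
    show "(\<lambda>x. Re (K x x)) \<in> borel_measurable M" using measurable_Kxx by measurable
    have "e (Suc k) \<in> borel_measurable M" for k by (rule measurable_e) simp
    then show "(\<lambda>x. (cmod (e (Suc k) x))\<^sup>2) \<in> borel_measurable M" for k by measurable
  qed
  then show ?thesis by (subst measurable_cong[OF K0_sum]) (simp_all add: space_M)
qed

lemma measurable_K0: "(\<lambda>(x, y). K0 K e x y) \<in> borel_measurable (M \<Otimes>\<^sub>M M)"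
proof -
  have "(\<lambda>p. e (Suc k) (fst p) * cnj (e (Suc k) (snd p))) \<in> borel_measurable (M \<Otimes>\<^sub>M M)" for k
    by (intro borel_measurable_times borel_measurable_cnj measurable_compose[OF measurable_fst measurable_e]
        measurable_compose[OF measurable_snd measurable_e]) simp_all
  then have "(\<lambda>p. (case p of (x, y) \<Rightarrow> K x y) - (\<Sum>k. e (Suc k) (fst p) * cnj (e (Suc k) (snd p))))
      \<in> borel_measurable (M \<Otimes>\<^sub>M M)"
    using measurable_K by (intro borel_measurable_diff borel_measurable_suminf)
  then show ?thesis
    by (rule measurable_cong[THEN iffD1, rotated]) (auto simp: space_pair_measure space_M K0_def K1_suminf)
qed

lemma integrable_K0: "integrable M (\<lambda>x. Re (K0 K e x x))"
  by (rule Bochner_Integration.integrable_bound[OF finite_trace measurable_K0_diag])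
    (auto intro!: AE_I2 simp: space_M K0_nonneg K0_le Kxx(2))

lemma tr0_nonneg: "0 \<le> tr0 M K e"
  unfolding tr0_def kernel_trace_def by (intro Bochner_Integration.integral_nonneg) (simp add: K0_nonneg space_M)

text \<open>The exceptional null set depends on \<open>y\<close>; hence the diagonal values of
  \<open>K0\<close> are not covered, and \<open>tr0\<close> may be positive.\<close>

lemma AE_K0: "y \<in> D \<Longrightarrow> AE x in M. K0 K e x y = 0"
proof -
  assume y: "y \<in> D"
  have "AE x in M. kernel_part (kf y) x = 0"
    by (rule complete_e) (use kernel_part(1,2)[OF kf_in[OF y]] in auto)
  then show ?thesis by (rule AE_mp) (auto intro!: AE_I2 simp: K0_kernel_part space_M y)
qed

lemma AE_K0_diag: "tr0 M K e = 0 \<Longrightarrow> AE x in M. Re (K0 K e x x) = 0"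
  unfolding tr0_def kernel_trace_def
  by (subst (asm) integral_nonneg_eq_0_iff_AE[OF integrable_K0]) (auto intro!: AE_I2 simp: space_M K0_nonneg)

lemma integral_e: "1 \<le> k \<Longrightarrow> (\<integral>x. (cmod (e k x))\<^sup>2 \<partial>M) = lam k"
  using lam_Re[of k] by (simp add: L2_self)

lemma tail_integral:
  assumes "1 \<le> m"
  shows "integrable M (\<lambda>x. \<Sum>k. (cmod (e (k + m) x))\<^sup>2)"
    "(\<integral>x. (\<Sum>k. (cmod (e (k + m) x))\<^sup>2) \<partial>M) = (\<Sum>k. lam (k + m))"
proof -
  have i: "integrable M (\<lambda>x. (cmod (e (k + m) x))\<^sup>2)" for k using assms by (intro L2_bound e_in) simp
  have s: "AE x in M. summable (\<lambda>k. norm ((cmod (e (k + m) x))\<^sup>2))"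
    using summable_e assms by (intro AE_I2) (simp add: space_M)
  have t: "summable (\<lambda>k. \<integral>x. norm ((cmod (e (k + m) x))\<^sup>2) \<partial>M)"
    using summable_lam[OF assms] integral_e assms by simp
  show "integrable M (\<lambda>x. \<Sum>k. (cmod (e (k + m) x))\<^sup>2)" by (rule integrable_suminf[OF i s t])
  show "(\<integral>x. (\<Sum>k. (cmod (e (k + m) x))\<^sup>2) \<partial>M) = (\<Sum>k. lam (k + m))"
    using integral_suminf[OF i s t] integral_e assms by simp
qed

lemma kernel_trace_split: "kernel_trace M K = (\<Sum>k. lam (Suc k)) + tr0 M K e"
proof -
  have "tr0 M K e = (\<integral>x. Re (K x x) - (\<Sum>k. (cmod (e (Suc k) x))\<^sup>2) \<partial>M)"
    unfolding tr0_def kernel_trace_def by (intro Bochner_Integration.integral_cong) (auto simp: K0_sum space_M)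
  then show ?thesis using tail_integral[of 1] finite_trace by (simp add: kernel_trace_def)
qed

lemma infsum_lam: "1 \<le> m \<Longrightarrow> (\<Sum>\<^sub>\<infinity>j\<in>{m..}. lam j) = (\<Sum>k. lam (k + m))"
  using infsum_atLeast[of lam m] summable_lam[of m] lam_nonneg by simp

lemma infsum_e: "1 \<le> m \<Longrightarrow> x \<in> D \<Longrightarrow> (\<Sum>\<^sub>\<infinity>j\<in>{m..}. (cmod (e j x))\<^sup>2) = (\<Sum>k. (cmod (e (k + m) x))\<^sup>2)"
  using infsum_atLeast[of "\<lambda>j. (cmod (e j x))\<^sup>2" m] summable_e[of x m] by simp

end

text \<open>\<open>trace_pos\<close> ensures that at least one summand of the density survives when
  \<open>m = 1\<close>; \<open>lam_pos\<close> makes the functions \<open>eta\<close> with index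
  below \<open>m\<close> genuine unit vectors in L2.\<close>

locale rkhs_sampling = rkhs_embedding D H ip K M lam e
  for D :: "'a set" and H ip K M lam e +
  fixes m :: nat
  assumes trace_pos: "kernel_trace M K > 0" and m: "1 \<le> m" and lam_pos: "k \<in> {1..<m} \<Longrightarrow> lam k > 0"
begin

definition \<rho> :: "'a \<Rightarrow> real" where "\<rho> = sampling_density M lam K e m"
definition T :: real where "T = (\<Sum>k. lam (k + m))"
definition b :: "'a \<Rightarrow> real" where "b x = (\<Sum>k. (cmod (e (k + m) x))\<^sup>2)"
definition a :: "'a \<Rightarrow> real" where "a x = (\<Sum>j=1..m-1. (cmod (eta lam e j x))\<^sup>2)"
abbreviation "S \<equiv> density_summands M lam K e m"

lemma \<rho>_eq: "x \<in> D \<Longrightarrow> \<rho> x = 1 / real S * (a x / real (m - 1) + b x / T + Re (K0 K e x x) / tr0 M K e)"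
  using m by (simp add: \<rho>_def sampling_density_def a_def b_def T_def infsum_e infsum_lam)

lemma T_nonneg: "0 \<le> T"
  unfolding T_def using m lam_nonneg by (intro suminf_nonneg summable_lam) auto

lemma S_eq: "real S = of_bool (m - 1 \<noteq> 0) + of_bool (T \<noteq> 0) + of_bool (tr0 M K e \<noteq> 0)"
  using m by (simp add: density_summands_def infsum_lam T_def)

lemma S_bounds: "1 \<le> real S" "real S \<le> 3"
proof -
  show "real S \<le> 3" unfolding S_eq by (simp add: of_bool_def)
  show "1 \<le> real S"
  proof (cases "m = 1")
    case True
    have "T + tr0 M K e > 0" unfolding T_def using True kernel_trace_split trace_pos by simp
    then show ?thesis unfolding S_eq by (cases "T = 0") auto
  next
    case False
    then show ?thesis unfolding S_eq using m by simp
  qed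
qed

lemma eta_in: "1 \<le> k \<Longrightarrow> eta lam e k \<in> H"
  unfolding eta_def by (intro in_scale e_in)

lemma L2_eta: "k \<in> {1..<m} \<Longrightarrow> l \<in> {1..<m} \<Longrightarrow> L2_inner M (eta lam e k) (eta lam e l) = of_bool (k = l)"
proof -
  assume kl: "k \<in> {1..<m}" "l \<in> {1..<m}"
  have "L2_inner M (eta lam e k) (eta lam e l)
      = complex_of_real (1 / sqrt (lam k)) * (complex_of_real (1 / sqrt (lam l)) * (complex_of_real (lam l) * ip (e k) (e l)))"
    unfolding eta_def singular_number_def using kl e_in by (simp add: L2.scale_left L2.scale_right in_scale L2_e scale_left)
  also have "\<dots> = of_bool (k = l)"
    using kl lam_pos[OF kl(1)] lam_pos[OF kl(2)] e_orth[of k l] by (simp flip: of_real_mult)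
  finally show ?thesis .
qed

lemma integral_eta: "k \<in> {1..<m} \<Longrightarrow> (\<integral>x. (cmod (eta lam e k x))\<^sup>2 \<partial>M) = 1"
  using L2_eta[of k k] L2_self[of "eta lam e k"] by simp

lemma a_integral: "integrable M a" "(\<integral>x. a x \<partial>M) = real (m - 1)"
proof -
  have i: "integrable M (\<lambda>x. (cmod (eta lam e k x))\<^sup>2)" if "k \<in> {1..m-1}" for k
    using that by (intro L2_bound eta_in) simp
  then show "integrable M a" unfolding a_def by (intro Bochner_Integration.integrable_sum)
  show "(\<integral>x. a x \<partial>M) = real (m - 1)"
    unfolding a_def using i m by (subst Bochner_Integration.integral_sum) (auto simp: integral_eta intro!: trans[OF sum.cong[OF refl integral_eta]])
qed

lemma b_integral: "integrable M b" "(\<integral>x. b x \<partial>M) = T"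
  unfolding b_def T_def using tail_integral[OF m] by auto

lemma a_nonneg: "0 \<le> a x" and b_nonneg: "x \<in> D \<Longrightarrow> 0 \<le> b x"
  unfolding a_def b_def using m by (auto intro!: sum_nonneg suminf_nonneg summable_e)

lemma \<rho>_nonneg: "x \<in> D \<Longrightarrow> 0 \<le> \<rho> x"
  unfolding \<rho>_eq using T_nonneg tr0_nonneg a_nonneg[of x] b_nonneg[of x] K0_nonneg[of x] by simp

lemma integrable_\<rho>_sum: "integrable M (\<lambda>x. 1 / real S * (a x / real (m - 1) + b x / T + Re (K0 K e x x) / tr0 M K e))"
  using a_integral b_integral integrable_K0 by simp

lemma integrable_\<rho>: "integrable M \<rho>"
  using integrable_\<rho>_sum by (subst Bochner_Integration.integrable_cong[OF refl \<rho>_eq]) (simp_all add: space_M)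

lemma integral_\<rho>: "(\<integral>x. \<rho> x \<partial>M) = 1"
proof -
  have "(\<integral>x. \<rho> x \<partial>M) = (\<integral>x. 1 / real S * (a x / real (m - 1) + b x / T + Re (K0 K e x x) / tr0 M K e) \<partial>M)"
    by (intro Bochner_Integration.integral_cong) (simp_all add: \<rho>_eq space_M)
  also have "\<dots> = 1 / real S * (real (m - 1) / real (m - 1) + T / T + tr0 M K e / tr0 M K e)"
    using a_integral b_integral integrable_K0 by (simp add: tr0_def kernel_trace_def)
  \<comment> \<open>With \<open>0 / 0 = 0\<close> an omitted summand contributes 0 and every other
    one contributes 1, so the sum counts the summands.\<close>
  also have "real (m - 1) / real (m - 1) + T / T + tr0 M K e / tr0 M K e = real S"
    unfolding S_eq by simp
  finally show ?thesis using S_bounds by simp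
qed

abbreviation P :: "'a measure" where "P \<equiv> density M (\<lambda>x. ennreal (\<rho> x))"

lemma measurable_\<rho>: "\<rho> \<in> borel_measurable M"
  using integrable_\<rho> by auto

lemma space_P: "space P = D" by (simp add: space_M)

lemma prob_space_P: "prob_space P"
proof
  have "emeasure P (space P) = (\<integral>\<^sup>+x. ennreal (\<rho> x) \<partial>M)"
    using measurable_\<rho> by (subst emeasure_density) (auto intro!: nn_integral_cong simp: indicator_def)
  also have "\<dots> = 1"
    by (subst nn_integral_eq_integral[OF integrable_\<rho>]) (auto intro!: AE_I2 simp: \<rho>_nonneg space_M integral_\<rho>)
  finally show "emeasure P (space P) = 1" .
qed

lemma AE_P: "AE x in M. Q x \<Longrightarrow> AE x in P. Q x"
  using measurable_\<rho> by (subst AE_density) (auto elim: eventually_mono)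

text \<open>Recovers one numerator \<open>c\<close> from a density \<open>q / s\<close> in which
  \<open>c / t\<close> is only one part of \<open>q\<close>. The case \<open>t = 0\<close> is that
  of an omitted summand, which is harmless if \<open>c\<close> vanishes as well.\<close>

lemma scaled_le:
  fixes c t q s :: real
  assumes "0 \<le> c" "c / t \<le> q" "t > 0 \<or> (t = 0 \<and> c = 0)" "1 \<le> s" "s \<le> 3"
  shows "c \<le> 3 * t * (1 / s * q)"
proof (cases "t = 0")
  case False
  then have t: "t > 0" using assms by simp
  have "c \<le> t * q" using assms(2) t by (simp add: field_simps)
  moreover have "0 \<le> t * q" using calculation assms(1) by simp
  then have "(t * q) * s \<le> (t * q) * 3" using assms by (intro mult_left_mono) auto
  ultimately have "c * s \<le> 3 * (t * q)" using mult_right_mono[of c "t * q" s] assms(4) by linarith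
  then show ?thesis using assms by (simp add: field_simps)
qed (use assms in auto)

text \<open>The third bound is conditional because \<open>tr0 = 0\<close> makes the diagonal of
  \<open>K0\<close> vanish only almost everywhere, whereas the other numerators vanish identically
  with their denominators.\<close>

lemma \<rho>_bounds:
  assumes x: "x \<in> D"
  shows "a x \<le> 3 * real (m - 1) * \<rho> x" "b x \<le> 3 * T * \<rho> x"
    "tr0 M K e \<noteq> 0 \<or> Re (K0 K e x x) = 0 \<Longrightarrow> Re (K0 K e x x) \<le> 3 * tr0 M K e * \<rho> x"
proof -
  have nn: "0 \<le> a x / real (m - 1)" "0 \<le> b x / T" "0 \<le> Re (K0 K e x x) / tr0 M K e"
    using T_nonneg tr0_nonneg a_nonneg[of x] b_nonneg[of x] K0_nonneg[of x] x by auto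
  have a0: "a x = 0" if "m - 1 = 0" using that by (simp add: a_def)
  have b0: "b x = 0" if "T = 0"
  proof -
    have "lam (k + m) = 0" for k
      using that suminf_eq_zero_iff[of "\<lambda>k. lam (k + m)"] summable_lam[OF m] lam_nonneg m by (simp add: T_def)
    then have "e (k + m) = 0" for k using e_zero[of "k + m"] m by simp
    then show ?thesis by (simp add: b_def)
  qed
  show "a x \<le> 3 * real (m - 1) * \<rho> x" unfolding \<rho>_eq[OF x]
    using nn a0 a_nonneg[of x] by (intro scaled_le S_bounds) auto
  show "b x \<le> 3 * T * \<rho> x" unfolding \<rho>_eq[OF x]
    using nn b0 b_nonneg[OF x] T_nonneg by (intro scaled_le S_bounds) auto
  show "Re (K0 K e x x) \<le> 3 * tr0 M K e * \<rho> x" if "tr0 M K e \<noteq> 0 \<or> Re (K0 K e x x) = 0"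
    unfolding \<rho>_eq[OF x] using nn K0_nonneg[OF x] tr0_nonneg that by (intro scaled_le S_bounds) auto
qed

text \<open>Division by the root of the density compensates the change of measure: on functions that
  vanish where \<open>\<rho>\<close> does, it preserves L2 inner products from \<open>M\<close> to
  \<open>P\<close>, see \<open>wt_moment\<close>.\<close>

definition wt :: "('a \<Rightarrow> complex) \<Rightarrow> 'a \<Rightarrow> complex" where
  "wt f x = (if \<rho> x \<noteq> 0 then f x / complex_of_real (sqrt (\<rho> x)) else 0)"

lemma measurable_wt: "f \<in> borel_measurable M \<Longrightarrow> wt f \<in> borel_measurable P"
proof -
  assume [measurable]: "f \<in> borel_measurable M"
  note [measurable] = measurable_\<rho>
  have "(\<lambda>x. complex_of_real (sqrt (\<rho> x))) \<in> borel_measurable M" by measurable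
  then have "wt f \<in> borel_measurable M" unfolding wt_def by measurable
  then show ?thesis by simp
qed

lemma cmod_wt: "x \<in> D \<Longrightarrow> (cmod (wt f x))\<^sup>2 = (if \<rho> x \<noteq> 0 then (cmod (f x))\<^sup>2 / \<rho> x else 0)"
  using \<rho>_nonneg[of x] by (simp add: wt_def norm_divide power_divide)

lemma wt_moment:
  assumes f: "f \<in> H" and g: "g \<in> H" and zero: "\<And>x. x \<in> D \<Longrightarrow> \<rho> x = 0 \<Longrightarrow> f x = 0"
  shows "(\<integral>x. wt f x * cnj (wt g x) \<partial>P) = L2_inner M f g"
proof -
  have "(\<integral>x. wt f x * cnj (wt g x) \<partial>P) = (\<integral>x. \<rho> x *\<^sub>R (wt f x * cnj (wt g x)) \<partial>M)"
    using measurable_\<rho> \<rho>_nonneg measurable_wt[OF measurable_H[OF f]] measurable_wt[OF measurable_H[OF g]]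
    by (intro integral_density) (auto intro!: AE_I2 borel_measurable_times borel_measurable_cnj simp: space_M)
  also have "\<dots> = (\<integral>x. f x * cnj (g x) \<partial>M)"
  proof (intro Bochner_Integration.integral_cong refl)
    fix x assume "x \<in> space M"
    then have x: "x \<in> D" by (simp add: space_M)
    show "\<rho> x *\<^sub>R (wt f x * cnj (wt g x)) = f x * cnj (g x)"
    proof (cases "\<rho> x = 0")
      case False
      have "complex_of_real (sqrt (\<rho> x)) * complex_of_real (sqrt (\<rho> x)) = complex_of_real (\<rho> x)"
        using \<rho>_nonneg[OF x] by (simp flip: of_real_mult)
      then show ?thesis using False by (simp add: wt_def scaleR_conv_of_real)
    qed (simp add: zero[OF x])
  qed
  finally show ?thesis by (simp add: L2_inner_def)
qed

end

section \<open>The favourable event\<close>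

text \<open>The event is the increasing union of the intersections of \<open>B N\<close> over
  \<open>N \<ge> N0\<close>, each of probability at most \<open>p\<close>, so continuity from below
  applies. This handles all truncations at once, without a union bound and without monotonicity in
  \<open>N\<close>.\<close>

lemma (in prob_space) prob_eventually_le:
  assumes B: "\<And>N. B N \<in> events" and p: "\<And>N. prob (B N) \<le> p"
  shows "{x \<in> space M. \<exists>N0. \<forall>N\<ge>N0::nat. x \<in> B N} \<in> events"
    "prob {x \<in> space M. \<exists>N0. \<forall>N\<ge>N0. x \<in> B N} \<le> p"
proof -
  define A where "A N0 = (\<Inter>N\<in>{N0..}. B N)" for N0
  have A: "A N0 \<in> events" for N0 unfolding A_def using B by (intro sets.countable_INT) auto
  have eq: "{x \<in> space M. \<exists>N0. \<forall>N\<ge>N0. x \<in> B N} = (\<Union>N0. A N0)"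
    using sets.sets_into_space[OF B] by (fastforce simp: A_def)
  show "{x \<in> space M. \<exists>N0. \<forall>N\<ge>N0. x \<in> B N} \<in> events" unfolding eq using A by auto
  have "(\<lambda>N. prob (A N)) \<longlonglongrightarrow> prob (\<Union>N0. A N0)"
    by (rule finite_Lim_measure_incseq) (use A in \<open>auto simp: incseq_def A_def\<close>)
  moreover have "prob (A N) \<le> p" for N
    using finite_measure_mono[OF _ B, of "A N" N] p[of N] by (fastforce simp: A_def)
  ultimately show "prob {x \<in> space M. \<exists>N0. \<forall>N\<ge>N0. x \<in> B N} \<le> p"
    unfolding eq by (intro LIMSEQ_le_const2) auto
qed

context rkhs_sampling
begin

text \<open>\<open>yL x\<close> is the row of the least squares matrix that belongs to a node
  \<open>x\<close>; \<open>yT x\<close> is its infinite counterpart for the tail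
  \<open>e m, e (m + 1), ...\<close>.\<close>

definition yL :: "'a \<Rightarrow> nat \<Rightarrow> complex" where "yL x k = wt (eta lam e (Suc k)) x"
definition yT :: "'a \<Rightarrow> nat \<Rightarrow> complex" where "yT x k = wt (e (k + m)) x"

lemma a_shift: "a x = (\<Sum>k<m-1. (cmod (eta lam e (Suc k) x))\<^sup>2)"
  unfolding a_def by (rule sum.reindex_bij_witness[of _ Suc "\<lambda>i. i - 1"]) auto

lemma yL_bound: "x \<in> D \<Longrightarrow> (\<Sum>k<m-1. (cmod (yL x k))\<^sup>2) \<le> 3 * real (m - 1)"
proof -
  assume x: "x \<in> D"
  have "(\<Sum>k<m-1. (cmod (yL x k))\<^sup>2) = (if \<rho> x \<noteq> 0 then a x / \<rho> x else 0)"
    unfolding a_shift yL_def using x by (simp add: cmod_wt sum_divide_distrib)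
  also have "\<dots> \<le> 3 * real (m - 1)"
    using \<rho>_bounds(1)[OF x] \<rho>_nonneg[OF x] by (auto simp: pos_divide_le_eq)
  finally show ?thesis .
qed

lemma b_ge: "x \<in> D \<Longrightarrow> (\<Sum>k<N. (cmod (e (k + m) x))\<^sup>2) \<le> b x"
  unfolding b_def using m by (intro sum_le_suminf summable_e) auto

lemma yT_bound: "x \<in> D \<Longrightarrow> (\<Sum>k<N. (cmod (yT x k))\<^sup>2) \<le> 3 * T"
proof -
  assume x: "x \<in> D"
  have "(\<Sum>k<N. (cmod (yT x k))\<^sup>2) = (if \<rho> x \<noteq> 0 then (\<Sum>k<N. (cmod (e (k + m) x))\<^sup>2) / \<rho> x else 0)"
    unfolding yT_def using x by (simp add: cmod_wt sum_divide_distrib)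
  also have "\<dots> \<le> 3 * T"
  proof -
    have "(\<Sum>k<N. (cmod (e (k + m) x))\<^sup>2) \<le> 3 * T * \<rho> x"
      using b_ge[OF x, of N] \<rho>_bounds(2)[OF x] by linarith
    then show ?thesis using \<rho>_nonneg[OF x] T_nonneg by (auto simp: pos_divide_le_eq)
  qed
  finally show ?thesis .
qed

lemma eta_zero: "x \<in> D \<Longrightarrow> \<rho> x = 0 \<Longrightarrow> k < m - 1 \<Longrightarrow> eta lam e (Suc k) x = 0"
proof -
  assume x: "x \<in> D" "\<rho> x = 0" "k < m - 1"
  have "(cmod (eta lam e (Suc k) x))\<^sup>2 \<le> a x" unfolding a_shift using x by (intro member_le_sum) auto
  also have "\<dots> \<le> 0" using \<rho>_bounds(1)[OF x(1)] x(2) by simp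
  finally show ?thesis by simp
qed

lemma e_tail_zero: "x \<in> D \<Longrightarrow> \<rho> x = 0 \<Longrightarrow> e (k + m) x = 0"
proof -
  assume x: "x \<in> D" "\<rho> x = 0"
  have "(cmod (e (k + m) x))\<^sup>2 \<le> (\<Sum>k<Suc k. (cmod (e (k + m) x))\<^sup>2)" by (intro member_le_sum) auto
  also have "\<dots> \<le> b x" by (rule b_ge[OF x(1)])
  also have "\<dots> \<le> 0" using \<rho>_bounds(2)[OF x(1)] x(2) by simp
  finally show ?thesis by simp
qed

lemma frame_yL: "frame_sampling P yL (m - 1) (3 * real (m - 1)) (\<lambda>_. 1)"
proof (intro frame_sampling.intro frame_sampling_axioms.intro prob_space_P)
  fix k l assume k: "k < m - 1" and l: "l < m - 1"
  show "(\<integral>x. yL x k * cnj (yL x l) \<partial>P) = complex_of_real (of_bool (k = l) * 1)"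
    unfolding yL_def using k l by (subst wt_moment) (auto intro: eta_in eta_zero simp: L2_eta)
next
  fix k show "(\<lambda>x. yL x k) \<in> borel_measurable P"
    unfolding yL_def by (intro measurable_wt measurable_H eta_in) simp
qed (use yL_bound in \<open>simp add: space_M\<close>)

text \<open>The norm bound \<open>3 * T\<close> is the same for every truncation \<open>N\<close>,
  which is what makes the tail estimate uniform.\<close>

lemma frame_yT: "frame_sampling P yT N (3 * T) (\<lambda>k. lam (k + m))"
proof (intro frame_sampling.intro frame_sampling_axioms.intro prob_space_P)
  fix k l assume "k < N" and "l < N"
  have "L2_inner M (e (k + m)) (e (l + m)) = complex_of_real (lam (l + m)) * ip (e (k + m)) (e (l + m))"
    using m by (intro L2_e e_in) auto
  also have "\<dots> = complex_of_real (of_bool (k = l) * lam (k + m))"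
    using quasi_orthonormalD(3)[OF quasi_orthonormal_e, of "k + m" "l + m"] m
      lam_L2[of "k + m"] L2_e[of "k + m" "e (k + m)"] e_in[of "k + m"]
    by (cases "k = l") auto
  finally show "(\<integral>x. yT x k * cnj (yT x l) \<partial>P) = complex_of_real (of_bool (k = l) * lam (k + m))"
    unfolding yT_def using m by (subst wt_moment) (auto intro: e_in e_tail_zero)
next
  fix k show "(\<lambda>x. yT x k) \<in> borel_measurable P"
    unfolding yT_def using m by (intro measurable_wt measurable_H e_in) simp
qed (simp add: yT_bound space_M)

abbreviation Q :: "nat \<Rightarrow> (nat \<Rightarrow> 'a) measure" where "Q n \<equiv> PiM {..<n} (\<lambda>_. P)"

lemma prob_space_Q: "prob_space (Q n)"
  by (intro prob_space_PiM prob_space_P)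

lemma Q_in_D: "X \<in> space (Q n) \<Longrightarrow> j < n \<Longrightarrow> X j \<in> D"
  using space_P by (auto simp: space_PiM PiE_iff)

lemma AE_coordinate:
  assumes "AE x in P. R x" "j < n" shows "AE X in Q n. R (X j)"
  by (rule AE_PiM_component[OF prob_space_P _ assms(1)]) (use assms(2) in auto)

lemma measurable_K0_pair:
  assumes "i < n" "j < n" shows "(\<lambda>X. K0 K e (X i) (X j)) \<in> borel_measurable (Q n)"
proof -
  have "(\<lambda>X. (X i, X j)) \<in> measurable (Q n) (M \<Otimes>\<^sub>M M)"
  proof (rule measurable_Pair)
    have "(\<lambda>X. X i) \<in> measurable (Q n) P" if "i < n" for i
      using that by (intro measurable_component_singleton) simp
    then show "(\<lambda>X. X i) \<in> measurable (Q n) M" "(\<lambda>X. X j) \<in> measurable (Q n) M" using assms by auto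
  qed
  from measurable_compose[OF this measurable_K0] show ?thesis by simp
qed

lemma AE_K0_offdiag:
  assumes "i < n" "j < n" "i \<noteq> j" shows "AE X in Q n. K0 K e (X i) (X j) = 0"
proof -
  interpret P: prob_space P by (rule prob_space_P)
  interpret product: product_prob_space "\<lambda>_ :: nat. P" UNIV by unfold_locales
  define I where "I = {..<n} - {i}"
  have I: "{..<n} = insert i I" "finite I" "i \<notin> I" "j \<in> I" using assms by (auto simp: I_def)
  define B where "B = {X \<in> space (Q n). K0 K e (X i) (X j) \<noteq> 0}"
  have B: "B \<in> sets (Q n)" unfolding B_def using measurable_K0_pair[OF assms(1,2)] by measurable
  have "emeasure (Q n) B = (\<integral>\<^sup>+X. indicator B X \<partial>Q n)" using B by simp
  \<comment> \<open>Coordinate \<open>i\<close> is integrated first, with \<open>X j\<close> fixed,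
    so that \<open>AE_K0\<close> applies with \<open>y = X j\<close>.\<close>
  also have "\<dots> = (\<integral>\<^sup>+X. (\<integral>\<^sup>+x. indicator B (X(i := x)) \<partial>P) \<partial>PiM I (\<lambda>_. P))"
    using B unfolding I(1) by (intro product.product_nn_integral_insert[OF I(2,3)]) auto
  also have "\<dots> = (\<integral>\<^sup>+X. 0 \<partial>PiM I (\<lambda>_. P))"
  proof (intro nn_integral_cong)
    fix X assume "X \<in> space (PiM I (\<lambda>_. P))"
    then have "X j \<in> D" using I(4) space_P by (auto simp: space_PiM PiE_iff)
    from AE_P[OF AE_K0[OF this]] have "AE x in P. indicator B (X(i := x)) = (0 :: ennreal)"
      by (rule AE_mp) (use assms(3) in \<open>auto intro!: AE_I2 simp: B_def\<close>)
    then have "(\<integral>\<^sup>+x. indicator B (X(i := x)) \<partial>P) = (\<integral>\<^sup>+x. 0 \<partial>P)" by (rule nn_integral_cong_AE)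
    then show "(\<integral>\<^sup>+x. indicator B (X(i := x)) \<partial>P) = 0" by simp
  qed
  finally have "B \<in> null_sets (Q n)" using B by auto
  then show ?thesis by (rule AE_I') (auto simp: B_def)
qed

lemma AE_K0_diag_bound:
  assumes "j < n" shows "AE X in Q n. Re (K0 K e (X j) (X j)) \<le> 3 * tr0 M K e * \<rho> (X j)"
proof (rule AE_coordinate[OF AE_P assms])
  show "AE x in M. Re (K0 K e x x) \<le> 3 * tr0 M K e * \<rho> x"
  proof (cases "tr0 M K e = 0")
    case True
    show ?thesis
      by (rule AE_mp[OF AE_K0_diag[OF True]]) (auto intro!: AE_I2 mult_nonneg_nonneg tr0_nonneg \<rho>_nonneg simp: space_M)
  next
    case False
    then show ?thesis using \<rho>_bounds(3) by (intro AE_I2) (simp add: space_M)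
  qed
qed

text \<open>The factors \<open>11\<close> and, in \<open>good\<close>, \<open>1/6\<close> are not optimised: they lead to the constant \<open>169\<close> in place
  of \<open>441\<close>.\<close>

definition upper_level :: "nat \<Rightarrow> real \<Rightarrow> real" where
  "upper_level n r = 11 * max (real n * lam m) (r * ln (real n) * T)"

definition good :: "nat \<Rightarrow> real \<Rightarrow> (nat \<Rightarrow> 'a) \<Rightarrow> bool" where
  "good n r X \<longleftrightarrow>
    (\<forall>v. real n / 6 * (\<Sum>k<m-1. (cmod (v k))\<^sup>2) \<le> (\<Sum>j<n. (cmod (cdot (m-1) v (yL (X j))))\<^sup>2)) \<and>
    (\<forall>N v. (\<Sum>j<n. (cmod (cdot N v (yT (X j))))\<^sup>2) \<le> upper_level n r * (\<Sum>k<N. (cmod (v k))\<^sup>2)) \<and>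
    (\<forall>i<n. \<forall>j<n. i \<noteq> j \<longrightarrow> K0 K e (X i) (X j) = 0) \<and>
    (\<forall>j<n. Re (K0 K e (X j) (X j)) \<le> 3 * tr0 M K e * \<rho> (X j))"

lemma goodD:
  assumes "good n r X"
  shows "real n / 6 * (\<Sum>k<m-1. (cmod (v k))\<^sup>2) \<le> (\<Sum>j<n. (cmod (cdot (m-1) v (yL (X j))))\<^sup>2)"
    "(\<Sum>j<n. (cmod (cdot N v (yT (X j))))\<^sup>2) \<le> upper_level n r * (\<Sum>k<N. (cmod (v k))\<^sup>2)"
    "i < n \<Longrightarrow> j < n \<Longrightarrow> i \<noteq> j \<Longrightarrow> K0 K e (X i) (X j) = 0"
    "j < n \<Longrightarrow> Re (K0 K e (X j) (X j)) \<le> 3 * tr0 M K e * \<rho> (X j)"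
proof -
  note g = assms[unfolded good_def]
  show "real n / 6 * (\<Sum>k<m-1. (cmod (v k))\<^sup>2) \<le> (\<Sum>j<n. (cmod (cdot (m-1) v (yL (X j))))\<^sup>2)"
    by (rule conjunct1[OF g, THEN spec])
  show "(\<Sum>j<n. (cmod (cdot N v (yT (X j))))\<^sup>2) \<le> upper_level n r * (\<Sum>k<N. (cmod (v k))\<^sup>2)"
    by (rule conjunct1[OF conjunct2[OF g], THEN spec, THEN spec])
  show "i < n \<Longrightarrow> j < n \<Longrightarrow> i \<noteq> j \<Longrightarrow> K0 K e (X i) (X j) = 0"
    using conjunct1[OF conjunct2[OF conjunct2[OF g]]] by blast
  show "j < n \<Longrightarrow> Re (K0 K e (X j) (X j)) \<le> 3 * tr0 M K e * \<rho> (X j)"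
    using conjunct2[OF conjunct2[OF conjunct2[OF g]]] by blast
qed

text \<open>The expected trace starts at \<open>d = m - 1\<close>; as \<open>d \<le> n\<close>, this
  prefactor costs one power of \<open>n\<close> and accounts for the exponent \<open>1 - r\<close>.
  For \<open>m = 1\<close> there are no columns and the estimate is trivial.\<close>

lemma lower_event:
  assumes r: "r > 1" and n: "n \<ge> 3" and mn: "real m * (14 * r * ln (real n)) \<le> real n"
  obtains B where "B \<in> sets (Q n)" "measure (Q n) B \<le> real n powr (1 - r)"
    "\<And>X v. X \<in> space (Q n) \<Longrightarrow> X \<notin> B \<Longrightarrow>
       real n / 6 * (\<Sum>k<m-1. (cmod (v k))\<^sup>2) \<le> (\<Sum>j<n. (cmod (cdot (m-1) v (yL (X j))))\<^sup>2)"
proof (cases "m - 1 = 0")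
  case True
  show ?thesis by (rule that[of "{}"]) (simp_all only: True, simp_all add: sum_nonneg)
next
  case False
  interpret F: frame_sampling P yL "m - 1" "3 * real (m - 1)" "\<lambda>_. 1" by (rule frame_yL)
  define d where "d = real (m - 1)"
  have d: "d > 0" using False by (simp add: d_def)
  define \<theta> where "\<theta> = 2 / (3 * (3 * d))"
  have \<theta>: "\<theta> > 0" using d by (simp add: \<theta>_def)
  define B where "B = {X \<in> space (Q n). exp (- \<theta> * (real n / 6)) \<le> trexp (m - 1) (- \<theta>) (F.Z n X)}"
  have l: "ln (real n) > 0" using n by simp
  show ?thesis
  proof (rule that[of B])
    show "B \<in> sets (Q n)" unfolding B_def using F.measurable_trexp[of "- \<theta>" n] by measurable
    have "measure (Q n) B \<le> d * exp (\<theta> * (real n / 6) - \<theta> / 2 * real n)"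
      unfolding B_def \<theta>_def d_def by (rule F.lower_tail) (use False in auto)
    also have "\<theta> * (real n / 6) - \<theta> / 2 * real n = - (2 * real n / (27 * d))"
      using d by (simp add: \<theta>_def field_simps)
    also have "d * exp (- (2 * real n / (27 * d))) \<le> real n * exp (- (r * ln (real n)))"
    proof (intro mult_mono)
      have md: "d \<le> real m" by (simp add: d_def)
      have "1 \<le> 14 * r * ln (real n)"
      proof -
        have "exp 1 \<le> (3::real)" using exp_le by simp
        then have "1 \<le> ln (real n)" using n by (subst ln_ge_iff) auto
        then have "1 * 1 \<le> r * ln (real n)" using r by (intro mult_mono) auto
        then show ?thesis by simp
      qed
      then have "real m * 1 \<le> real m * (14 * r * ln (real n))" by (intro mult_left_mono) auto
      then show "d \<le> real n" using md mn by simp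
      have "d * (14 * r * ln (real n)) \<le> real m * (14 * r * ln (real n))"
        using md r l by (intro mult_right_mono) auto
      also have "\<dots> \<le> real n" by (rule mn)
      finally have "14 * (r * ln (real n)) * d \<le> real n" by (simp add: mult_ac)
      then have "14 * (r * ln (real n)) \<le> real n / d" using d by (simp add: pos_le_divide_eq)
      moreover have "0 \<le> r * ln (real n)" using r l by simp
      \<comment> \<open>Uses \<open>14 * 2 / 27 = 28 / 27\<close>, which is only slightly above
        1.\<close>
      ultimately have "r * ln (real n) \<le> 2 / 27 * (real n / d)" by simp
      then show "exp (- (2 * real n / (27 * d))) \<le> exp (- (r * ln (real n)))" by simp
    qed (use d in auto)
    also have "real n * exp (- (r * ln (real n))) = real n powr (1 - r)"
      using n by (simp add: powr_def left_diff_distrib exp_diff exp_minus divide_inverse)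
    finally show "measure (Q n) B \<le> real n powr (1 - r)" .
    fix X v assume X: "X \<in> space (Q n)" "X \<notin> B"
    show "real n / 6 * (\<Sum>k<m-1. (cmod (v k))\<^sup>2) \<le> (\<Sum>j<n. (cmod (cdot (m-1) v (yL (X j))))\<^sup>2)"
      by (rule frame_lower_bound[OF _ \<theta>, of "{..<n}"]) (use X in \<open>auto simp: B_def\<close>)
  qed
qed

lemma tail_zero: "T = 0 \<Longrightarrow> e (k + m) = 0"
proof -
  assume "T = 0"
  then have "lam (k + m) = 0"
    using suminf_eq_zero_iff[of "\<lambda>k. lam (k + m)"] summable_lam[OF m] lam_nonneg m by (simp add: T_def)
  then show ?thesis using e_zero[of "k + m"] m by simp
qed

text \<open>\<open>upper_tail\<close> bounds the failure probability for each truncation by the same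
  number, and failure for one \<open>N\<close> persists for larger ones, so the event that fails for
  all large \<open>N\<close> is the one to exclude. If \<open>T = 0\<close>, the tail functions
  vanish identically.\<close>

lemma upper_event:
  assumes r: "r > 1" and n: "n \<ge> 3"
  obtains B where "B \<in> sets (Q n)" "measure (Q n) B \<le> 4 / 9 * real n powr (1 - r)"
    "\<And>X N v. X \<in> space (Q n) \<Longrightarrow> X \<notin> B \<Longrightarrow>
       (\<Sum>j<n. (cmod (cdot N v (yT (X j))))\<^sup>2) \<le> upper_level n r * (\<Sum>k<N. (cmod (v k))\<^sup>2)"
proof (cases "T = 0")
  case True
  have "yT x k = 0" for x k unfolding yT_def wt_def by (simp add: tail_zero[OF True])
  then have "cdot N v (yT x) = 0" for N v x by (simp add: cdot_def)
  moreover have "0 \<le> upper_level n r" unfolding upper_level_def using lam_nonneg[OF m] by (simp add: le_max_iff_disj)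
  ultimately show ?thesis by (intro that[of "{}"]) (auto intro!: mult_nonneg_nonneg sum_nonneg)
next
  case False
  then have T: "T > 0" using T_nonneg by simp
  interpret Qn: prob_space "Q n" by (rule prob_space_Q)
  have l: "ln (real n) > 0" using n by simp
  define t where "t = upper_level n r"
  have t: "t > 0" unfolding t_def upper_level_def using T r l by (simp add: less_max_iff_disj)
  define \<theta> where "\<theta> = 2 / (3 * (3 * T))"
  have \<theta>: "\<theta> > 0" using T by (simp add: \<theta>_def)
  define B where "B N = {X \<in> space (Q n). exp (\<theta> * t) - 1 \<le> trexp N \<theta> (frame_mat {..<n} (\<lambda>j. yT (X j))) - real N}" for N
  have B: "B N \<in> sets (Q n)" for N
  proof -
    interpret F: frame_sampling P yT N "3 * T" "\<lambda>k. lam (k + m)" by (rule frame_yT)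
    show ?thesis unfolding B_def using F.measurable_trexp[of \<theta> n] by measurable
  qed
  have p: "measure (Q n) (B N) \<le> 4 / 9 * real n powr (1 - r)" for N
  proof -
    interpret F: frame_sampling P yT N "3 * T" "\<lambda>k. lam (k + m)" by (rule frame_yT)
    have "measure (Q n) (B N) \<le> 2 * \<theta> * T * real n * exp (2 * \<theta> * lam m * real n) / (exp (\<theta> * t) - 1)"
      unfolding B_def \<theta>_def
    proof (rule F.upper_tail)
      show "(\<Sum>k<N. lam (k + m)) \<le> T"
        unfolding T_def using m lam_nonneg by (intro sum_le_suminf summable_lam) auto
    qed (use m lam_nonneg lam_mono T t in auto)
    also have "2 * \<theta> * T = 4 / 9" using T by (simp add: \<theta>_def)
    also have "4 / 9 * real n * exp (2 * \<theta> * lam m * real n) / (exp (\<theta> * t) - 1) \<le> 4 / 9 * real n / exp (r * ln (real n))"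
    proof -
      define u where "u = exp (2 * \<theta> * lam m * real n)"
      define w where "w = exp (r * ln (real n))"
      have u: "u \<ge> 1" unfolding u_def using \<theta> lam_nonneg[OF m] by simp
      \<comment> \<open>The exponential will dominate \<open>u * w * w\<close>. One factor
        \<open>w\<close> is the desired decay; the other, being at least 2, pays for the subtracted
        1 in the denominator.\<close>
      have w: "w \<ge> 2"
      proof -
        have "real n \<le> exp (r * ln (real n))"
          using n r l by (subst (1) exp_ln[of "real n", symmetric]) (auto simp del: exp_ln)
        then show ?thesis unfolding w_def using n by simp
      qed
      have "2 * \<theta> * lam m * real n + 2 * (r * ln (real n)) \<le> \<theta> * t"
      proof -
        \<comment> \<open>Origin of the factor 11: each product on the left is at most the maximum
          in \<open>upper_level\<close>, and \<open>4/9 + 2 = 2/9 * 11\<close>.\<close>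
        have "4 / 9 * (real n * lam m) + 2 * (r * ln (real n) * T) \<le> 2 / 9 * t"
          using max.cobounded1[of "real n * lam m" "r * ln (real n) * T"]
            max.cobounded2[of "r * ln (real n) * T" "real n * lam m"]
          unfolding t_def upper_level_def by linarith
        then have "(4 / 9 * (real n * lam m) + 2 * (r * ln (real n) * T)) / T \<le> 2 / 9 * t / T"
          using T by (intro divide_right_mono) auto
        then show ?thesis using T by (simp add: \<theta>_def field_simps)
      qed
      then have "exp (2 * \<theta> * lam m * real n + (r * ln (real n) + r * ln (real n))) \<le> exp (\<theta> * t)" by simp
      then have "u * (w * w) \<le> exp (\<theta> * t)" unfolding u_def w_def by (simp only: exp_add)
      moreover have "u * w + 1 \<le> u * (w * w)"
      proof -
        have "1 * 2 \<le> u * w" using u w by (intro mult_mono) auto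
        moreover have "u * w * 2 \<le> u * w * w" using u w by (intro mult_left_mono) auto
        ultimately show ?thesis by (simp add: mult_ac)
      qed
      ultimately have k: "u * w \<le> exp (\<theta> * t) - 1" by linarith
      have pos: "0 < u * w" using u w by simp
      have "u / (exp (\<theta> * t) - 1) \<le> u / (u * w)"
        using k pos u w by (intro divide_left_mono mult_pos_pos; linarith)
      also have "\<dots> = 1 / w" using u by simp
      finally have "4 / 9 * real n * (u / (exp (\<theta> * t) - 1)) \<le> 4 / 9 * real n * (1 / w)"
        by (intro mult_left_mono) auto
      then show ?thesis unfolding u_def[symmetric] w_def[symmetric] by simp
    qed
    also have "4 / 9 * real n / exp (r * ln (real n)) = 4 / 9 * real n powr (1 - r)"
      using n by (simp add: powr_def left_diff_distrib exp_diff)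
    finally show ?thesis .
  qed
  show ?thesis
  proof (rule that[OF Qn.prob_eventually_le[OF B p]])
    fix X N and v :: "nat \<Rightarrow> complex"
    assume X: "X \<in> space (Q n)" and "X \<notin> {x \<in> space (Q n). \<exists>N0. \<forall>N\<ge>N0. x \<in> B N}"
    then obtain N' where N': "N' \<ge> N" "X \<notin> B N'" by auto
    \<comment> \<open>Padding with zeros transfers the estimate from a good truncation
      \<open>N'\<close> beyond \<open>N\<close> back to \<open>N\<close>.\<close>
    define v' where "v' k = (if k < N then v k else 0)" for k
    have c: "cdot N' v' y = cdot N v y" for y
      unfolding cdot_def v'_def using N'(1) by (intro sum.mono_neutral_cong_right) auto
    have s: "(\<Sum>k<N'. (cmod (v' k))\<^sup>2) = (\<Sum>k<N. (cmod (v k))\<^sup>2)"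
      unfolding v'_def using N'(1) by (intro sum.mono_neutral_cong_right) auto
    have "(\<Sum>j<n. (cmod (cdot N' v' (yT (X j))))\<^sup>2) \<le> t * (\<Sum>k<N'. (cmod (v' k))\<^sup>2)"
      by (rule frame_upper_bound[OF _ \<theta>, of "{..<n}"]) (use X N' in \<open>auto simp: B_def\<close>)
    then show "(\<Sum>j<n. (cmod (cdot N v (yT (X j))))\<^sup>2) \<le> upper_level n r * (\<Sum>k<N. (cmod (v k))\<^sup>2)"
      unfolding c s t_def .
  qed
qed

lemma good_event:
  assumes r: "r > 1" and n: "n \<ge> 3" and mn: "real m * (14 * r * ln (real n)) \<le> real n"
  obtains G where "G \<in> sets (Q n)" "measure (Q n) G \<ge> 1 - 13 / 9 * real n powr (1 - r)"
    "\<And>X. X \<in> G \<Longrightarrow> good n r X"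
proof -
  interpret Qn: prob_space "Q n" by (rule prob_space_Q)
  obtain B1 where B1: "B1 \<in> sets (Q n)" "measure (Q n) B1 \<le> real n powr (1 - r)"
    "\<And>X v. X \<in> space (Q n) \<Longrightarrow> X \<notin> B1 \<Longrightarrow>
       real n / 6 * (\<Sum>k<m-1. (cmod (v k))\<^sup>2) \<le> (\<Sum>j<n. (cmod (cdot (m-1) v (yL (X j))))\<^sup>2)"
    using lower_event[OF assms] by metis
  obtain B2 where B2: "B2 \<in> sets (Q n)" "measure (Q n) B2 \<le> 4 / 9 * real n powr (1 - r)"
    "\<And>X N v. X \<in> space (Q n) \<Longrightarrow> X \<notin> B2 \<Longrightarrow>
       (\<Sum>j<n. (cmod (cdot N v (yT (X j))))\<^sup>2) \<le> upper_level n r * (\<Sum>k<N. (cmod (v k))\<^sup>2)"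
    using upper_event[OF r n] by metis
  have "AE X in Q n. (\<forall>i\<in>{..<n}. \<forall>j\<in>{..<n}. i \<noteq> j \<longrightarrow> K0 K e (X i) (X j) = 0) \<and>
      (\<forall>j\<in>{..<n}. Re (K0 K e (X j) (X j)) \<le> 3 * tr0 M K e * \<rho> (X j))"
  proof (intro AE_conjI AE_finite_allI finite_lessThan)
    fix i j assume "i \<in> {..<n}" "j \<in> {..<n}"
    then show "AE X in Q n. i \<noteq> j \<longrightarrow> K0 K e (X i) (X j) = 0"
      using AE_K0_offdiag[of i n j] by (cases "i = j") auto
  qed (auto intro: AE_K0_diag_bound)
  then obtain B3 where B3: "B3 \<in> null_sets (Q n)"
    and B3': "{X \<in> space (Q n). \<not> ((\<forall>i\<in>{..<n}. \<forall>j\<in>{..<n}. i \<noteq> j \<longrightarrow> K0 K e (X i) (X j) = 0) \<and>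
      (\<forall>j\<in>{..<n}. Re (K0 K e (X j) (X j)) \<le> 3 * tr0 M K e * \<rho> (X j)))} \<subseteq> B3"
    unfolding eventually_ae_filter by blast
  define B where "B = B1 \<union> B2 \<union> B3"
  have B: "B \<in> sets (Q n)" using B1(1) B2(1) B3 by (auto simp: B_def)
  have "measure (Q n) B \<le> measure (Q n) (B1 \<union> B2) + measure (Q n) B3"
    unfolding B_def using B1(1) B2(1) B3 by (intro measure_Un_le) auto
  also have "measure (Q n) B3 = 0" using B3 by (simp add: measure_def null_sets_def)
  also have "measure (Q n) (B1 \<union> B2) \<le> measure (Q n) B1 + measure (Q n) B2"
    using B1(1) B2(1) by (intro measure_Un_le) auto
  finally have mB: "measure (Q n) B \<le> 13 / 9 * real n powr (1 - r)" using B1(2) B2(2) by simp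
  show ?thesis
  proof (rule that[of "space (Q n) - B"])
    show "space (Q n) - B \<in> sets (Q n)" using B by auto
    show "1 - 13 / 9 * real n powr (1 - r) \<le> measure (Q n) (space (Q n) - B)"
      using Qn.prob_compl[OF B] mB by simp
    fix X assume "X \<in> space (Q n) - B"
    then have X: "X \<in> space (Q n)" "X \<notin> B1" "X \<notin> B2" "X \<notin> B3" by (auto simp: B_def)
    from X(1,4) B3' have "(\<forall>i\<in>{..<n}. \<forall>j\<in>{..<n}. i \<noteq> j \<longrightarrow> K0 K e (X i) (X j) = 0) \<and>
      (\<forall>j\<in>{..<n}. Re (K0 K e (X j) (X j)) \<le> 3 * tr0 M K e * \<rho> (X j))" by blast
    with B1(3)[OF X(1,2)] B2(3)[OF X(1,3)] show "good n r X" unfolding good_def by simp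
  qed
qed

end

section \<open>Least squares matrices\<close>

abbreviation gram_mat :: "complex mat \<Rightarrow> complex mat" where
  "gram_mat A \<equiv> mat_adjoint A * A"

lemma mat_adjoint_carrier: "A \<in> carrier_mat n d \<Longrightarrow> mat_adjoint A \<in> carrier_mat d n"
  unfolding mat_adjoint_def by (auto simp: mat_of_rows_def)

lemma mat_adjoint_index:
  "A \<in> carrier_mat n d \<Longrightarrow> k < d \<Longrightarrow> j < n \<Longrightarrow> mat_adjoint A $$ (k, j) = cnj (A $$ (j, k))"
  unfolding mat_adjoint_def by (auto simp: mat_of_rows_def conjugate_complex_def)

lemma mult_vec_index:
  "A \<in> carrier_mat n d \<Longrightarrow> v \<in> carrier_vec d \<Longrightarrow> j < n \<Longrightarrow> vec_index (A *\<^sub>v v) j = (\<Sum>k<d. A $$ (j, k) * vec_index v k)"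
  by (auto simp: scalar_prod_def atLeast0LessThan intro!: sum.cong)

lemma gram_carrier: "A \<in> carrier_mat n d \<Longrightarrow> gram_mat A \<in> carrier_mat d d"
  using mat_adjoint_carrier[of A n d] by auto

lemma gram_index:
  assumes "A \<in> carrier_mat n d" "k < d" "l < d"
  shows "gram_mat A $$ (k, l) = (\<Sum>j<n. cnj (A $$ (j, k)) * A $$ (j, l))"
  using assms mat_adjoint_carrier[OF assms(1)] mat_adjoint_index[OF assms(1,2)]
  by (auto simp: scalar_prod_def atLeast0LessThan intro!: sum.cong)

lemma adjoint_pairing:
  assumes A: "A \<in> carrier_mat n d" and u: "u \<in> carrier_vec d" and g: "g \<in> carrier_vec n"
  shows "(\<Sum>k<d. cnj (vec_index u k) * vec_index (mat_adjoint A *\<^sub>v g) k) = (\<Sum>j<n. cnj (vec_index (A *\<^sub>v u) j) * vec_index g j)"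
proof -
  have "(\<Sum>k<d. cnj (vec_index u k) * vec_index (mat_adjoint A *\<^sub>v g) k)
      = (\<Sum>k<d. \<Sum>j<n. cnj (vec_index u k) * (cnj (A $$ (j, k)) * vec_index g j))"
    using mult_vec_index[OF mat_adjoint_carrier[OF A] g] mat_adjoint_index[OF A] by (simp add: sum_distrib_left)
  also have "\<dots> = (\<Sum>j<n. \<Sum>k<d. cnj (vec_index u k) * (cnj (A $$ (j, k)) * vec_index g j))" by (rule sum.swap)
  also have "\<dots> = (\<Sum>j<n. cnj (vec_index (A *\<^sub>v u) j) * vec_index g j)"
    using mult_vec_index[OF A u] by (simp add: sum_distrib_right sum_distrib_left mult_ac)
  finally show ?thesis .
qed

lemma gram_kernel:
  assumes A: "A \<in> carrier_mat n d" and v: "v \<in> carrier_vec d"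
  shows "gram_mat A *\<^sub>v v = 0\<^sub>v d \<longleftrightarrow> A *\<^sub>v v = 0\<^sub>v n"
proof
  note AC = mat_adjoint_carrier[OF A]
  have Av: "A *\<^sub>v v \<in> carrier_vec n" using A v by simp
  have assoc: "gram_mat A *\<^sub>v v = mat_adjoint A *\<^sub>v (A *\<^sub>v v)" by (rule assoc_mult_mat_vec[OF AC A v])
  show "gram_mat A *\<^sub>v v = 0\<^sub>v d" if "A *\<^sub>v v = 0\<^sub>v n" unfolding assoc that using AC by auto
  assume "gram_mat A *\<^sub>v v = 0\<^sub>v d"
  then have "(\<Sum>j<n. cnj (vec_index (A *\<^sub>v v) j) * vec_index (A *\<^sub>v v) j) = 0"
    unfolding adjoint_pairing[OF A v Av, symmetric] assoc[symmetric] by simp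
  then have "complex_of_real (\<Sum>j<n. (cmod (vec_index (A *\<^sub>v v) j))\<^sup>2) = 0"
    by (simp add: complex_norm_square mult.commute del: of_real_power)
  then have "(\<Sum>j<n. (cmod (vec_index (A *\<^sub>v v) j))\<^sup>2) = 0" by (simp only: of_real_eq_0_iff)
  then have "\<forall>j<n. vec_index (A *\<^sub>v v) j = 0" by (subst (asm) sum_nonneg_eq_0_iff) auto
  then show "A *\<^sub>v v = 0\<^sub>v n" using Av A by (intro eq_vecI) auto
qed

text \<open>Linear independence is a property of the set of columns and does not see repetitions,
  hence the case split. With a repeated column the rank stays below \<open>d\<close>, and the
  difference of two unit vectors lies in the kernel.\<close>

lemma full_column_rank_iff:
  assumes A: "A \<in> carrier_mat n d"
  shows "vec_space.rank n A = d \<longleftrightarrow> det (gram_mat A) \<noteq> 0"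
proof -
  interpret V: vec_space "TYPE(complex)" n .
  have det: "det (gram_mat A) = 0 \<longleftrightarrow> (\<exists>v. v \<in> carrier_vec d \<and> v \<noteq> 0\<^sub>v d \<and> A *\<^sub>v v = 0\<^sub>v n)"
    using det_0_iff_vec_prod_zero_field[OF gram_carrier[OF A]] gram_kernel[OF A] by blast
  show ?thesis
  proof (cases "distinct (cols A)")
    case True
    have "V.rank A = d \<longleftrightarrow> V.lin_indpt (set (cols A))"
      using V.lin_indpt_full_rank[OF A True] V.full_rank_lin_indpt[OF A _ True] by blast
    also have "\<dots> \<longleftrightarrow> \<not> (\<exists>v. v \<in> carrier_vec d \<and> v \<noteq> 0\<^sub>v d \<and> A *\<^sub>v v = 0\<^sub>v n)"
      using V.lin_depI[OF A _ _ _ True] V.lin_depE[OF A _ True] by blast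
    finally show ?thesis using det by blast
  next
    case False
    obtain S where S: "maximal S (\<lambda>T. T \<subseteq> set (cols A) \<and> V.lin_indpt T)"
      using maximal_exists[of "(\<lambda>T. T \<subseteq> set (cols A) \<and> V.lin_indpt T)" "card (set (cols A))" "{}"]
      by (meson List.finite_set card_mono empty_iff empty_subsetI V.finite_lin_indpt2 rev_finite_subset)
    then have "card S \<le> card (set (cols A))" by (simp add: card_mono maximal_def)
    moreover have "card (set (cols A)) < d"
      using A False card_distinct[of "cols A"] card_length[of "cols A"] by (auto simp: less_le)
    ultimately have "V.rank A \<noteq> d" using V.rank_card_indpt[OF A S] by simp
    moreover have "det (gram_mat A) = 0"
    proof -
      obtain i j where ij: "i < d" "j < d" "i \<noteq> j" "cols A ! i = cols A ! j"
        using False A unfolding distinct_conv_nth by auto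
      then have c: "A $$ (p, i) = A $$ (p, j)" if "p < n" for p
        using that A by (metis carrier_matD cols_nth index_col)
      define v where "v = Matrix.vec d (\<lambda>k. of_bool (k = i) - of_bool (k = j) :: complex)"
      have v: "v \<in> carrier_vec d" by (simp add: v_def)
      have "vec_index v i = 1" using ij by (simp add: v_def)
      then have "v \<noteq> 0\<^sub>v d" using ij(1) by auto
      moreover have "A *\<^sub>v v = 0\<^sub>v n"
      proof (intro eq_vecI)
        fix p assume "p < dim_vec (0\<^sub>v n :: complex Matrix.vec)"
        then have p: "p < n" by simp
        have "vec_index (A *\<^sub>v v) p = (\<Sum>k<d. A $$ (p, k) * (of_bool (k = i) - of_bool (k = j)))"
          unfolding mult_vec_index[OF A v p] by (simp add: v_def)
        also have "\<dots> = A $$ (p, i) - A $$ (p, j)"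
          using ij by (simp add: right_diff_distrib sum_subtractf of_bool_def if_distrib[of "\<lambda>x. _ * x"] cong: if_cong)
        finally show "vec_index (A *\<^sub>v v) p = vec_index (0\<^sub>v n) p" using c[OF p] p by simp
      qed (use A in auto)
      ultimately show ?thesis unfolding det using v by blast
    qed
    ultimately show ?thesis by blast
  qed
qed

text \<open>Cramer's rule exhibits the entries of the inverse as rational functions of the entries
  of \<open>G\<close>; their measurability is not visible from the elimination procedure.\<close>

lemma the_mat_inverse:
  fixes G :: "complex mat"
  assumes G: "G \<in> carrier_mat d d" and "det G \<noteq> 0"
  shows "the (mat_inverse G) = (1 / det G) \<cdot>\<^sub>m adj_mat G"
    "the (mat_inverse G) \<in> carrier_mat d d"
    "G * the (mat_inverse G) = 1\<^sub>m d" "the (mat_inverse G) * G = 1\<^sub>m d"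
proof -
  let ?B = "(1 / det G) \<cdot>\<^sub>m adj_mat G"
  note adj = adj_mat[OF G]
  have B: "?B \<in> carrier_mat d d" using adj(1) by simp
  have GB: "G * ?B = 1\<^sub>m d"
  proof -
    have "G * ?B = (1 / det G) \<cdot>\<^sub>m (G * adj_mat G)" by (rule mult_smult_distrib[OF G adj(1)])
    then show ?thesis unfolding adj(2) using assms(2) by (auto intro!: eq_matI)
  qed
  have BG: "?B * G = 1\<^sub>m d"
  proof -
    have "?B * G = (1 / det G) \<cdot>\<^sub>m (adj_mat G * G)" by (rule mult_smult_assoc_mat[OF adj(1) G])
    then show ?thesis unfolding adj(3) using assms(2) by (auto intro!: eq_matI)
  qed
  have unit: "G \<in> Units (ring_mat TYPE(complex) d ())"
    unfolding Units_def ring_mat_def using G B GB BG by auto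
  obtain C where C: "mat_inverse G = Some C"
    using mat_inverse(1)[OF G, where b = "()"] unit by (cases "mat_inverse G") auto
  note CD = mat_inverse(2)[OF G C]
  have "C = C * (G * ?B)" unfolding GB using CD right_mult_one_mat[of C d d] by simp
  also have "\<dots> = (C * G) * ?B" by (rule assoc_mult_mat[symmetric]) (use CD G B in auto)
  also have "\<dots> = ?B" using CD left_mult_one_mat[OF B] by simp
  finally have "C = ?B" .
  then show "the (mat_inverse G) = ?B" using C by simp
  show "the (mat_inverse G) \<in> carrier_mat d d" "G * the (mat_inverse G) = 1\<^sub>m d" "the (mat_inverse G) * G = 1\<^sub>m d"
    using C CD by auto
qed

text \<open>By the normal equations \<open>A c\<close> is the orthogonal projection of
  \<open>g\<close> onto the range of \<open>A\<close>, and a projection does not increase the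
  norm.\<close>

lemma least_squares_residual:
  assumes A: "A \<in> carrier_mat n d" and det: "det (gram_mat A) \<noteq> 0" and g: "g \<in> carrier_vec n"
  defines "c \<equiv> (the (mat_inverse (gram_mat A)) * mat_adjoint A) *\<^sub>v g"
  shows "c \<in> carrier_vec d" "(\<Sum>j<n. (cmod (vec_index (A *\<^sub>v c) j))\<^sup>2) \<le> (\<Sum>j<n. (cmod (vec_index g j))\<^sup>2)"
proof -
  note AC = mat_adjoint_carrier[OF A] and GC = gram_carrier[OF A]
  note inv = the_mat_inverse[OF GC det]
  let ?B = "the (mat_inverse (gram_mat A))"
  have BA: "?B * mat_adjoint A \<in> carrier_mat d n" using inv(2) AC by simp
  show c: "c \<in> carrier_vec d" unfolding c_def using BA g by simp
  then have Ac: "A *\<^sub>v c \<in> carrier_vec n" using A by simp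
  have "mat_adjoint A *\<^sub>v (A *\<^sub>v c) = gram_mat A *\<^sub>v c" by (rule assoc_mult_mat_vec[OF AC A c, symmetric])
  also have "\<dots> = (gram_mat A * (?B * mat_adjoint A)) *\<^sub>v g"
    unfolding c_def by (rule assoc_mult_mat_vec[OF GC BA g, symmetric])
  also have "gram_mat A * (?B * mat_adjoint A) = (gram_mat A * ?B) * mat_adjoint A"
    by (rule assoc_mult_mat[OF GC inv(2) AC, symmetric])
  also have "\<dots> = mat_adjoint A" unfolding inv(3) using AC by simp
  finally have normal: "mat_adjoint A *\<^sub>v (A *\<^sub>v c) = mat_adjoint A *\<^sub>v g" .
  have "(\<Sum>j<n. cnj (vec_index (A *\<^sub>v c) j) * vec_index (A *\<^sub>v c) j) = (\<Sum>j<n. cnj (vec_index (A *\<^sub>v c) j) * vec_index g j)"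
    unfolding adjoint_pairing[OF A c Ac, symmetric] adjoint_pairing[OF A c g, symmetric] normal ..
  then have "complex_of_real (\<Sum>j<n. (cmod (vec_index (A *\<^sub>v c) j))\<^sup>2) = (\<Sum>j<n. cnj (vec_index (A *\<^sub>v c) j) * vec_index g j)"
    by (simp add: complex_norm_square mult.commute del: of_real_power)
  then have "(\<Sum>j<n. (cmod (vec_index (A *\<^sub>v c) j))\<^sup>2) = Re (\<Sum>j<n. cnj (vec_index (A *\<^sub>v c) j) * vec_index g j)"
    by (metis Re_complex_of_real)
  also have "\<dots> \<le> (\<Sum>j<n. ((cmod (vec_index (A *\<^sub>v c) j))\<^sup>2 + (cmod (vec_index g j))\<^sup>2) / 2)"
    unfolding Re_sum
  proof (rule sum_mono)
    fix j
    let ?x = "vec_index (A *\<^sub>v c) j" and ?y = "vec_index g j"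
    have "Re (cnj ?x * ?y) \<le> cmod ?x * cmod ?y" using complex_Re_le_cmod[of "cnj ?x * ?y"] by (simp add: norm_mult)
    also have "\<dots> \<le> ((cmod ?x)\<^sup>2 + (cmod ?y)\<^sup>2) / 2" using sum_squares_bound[of "cmod ?x" "cmod ?y"] by simp
    finally show "Re (cnj ?x * ?y) \<le> ((cmod ?x)\<^sup>2 + (cmod ?y)\<^sup>2) / 2" .
  qed
  finally show "(\<Sum>j<n. (cmod (vec_index (A *\<^sub>v c) j))\<^sup>2) \<le> (\<Sum>j<n. (cmod (vec_index g j))\<^sup>2)"
    by (simp add: sum.distrib sum_divide_distrib[symmetric])
qed

lemma least_squares_exact:
  assumes A: "A \<in> carrier_mat n d" and det: "det (gram_mat A) \<noteq> 0" and v: "v \<in> carrier_vec d"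
  shows "(the (mat_inverse (gram_mat A)) * mat_adjoint A) *\<^sub>v (A *\<^sub>v v) = v"
proof -
  note AC = mat_adjoint_carrier[OF A] and GC = gram_carrier[OF A]
  note inv = the_mat_inverse[OF GC det]
  let ?B = "the (mat_inverse (gram_mat A))"
  have BA: "?B * mat_adjoint A \<in> carrier_mat d n" using inv(2) AC by simp
  have "(?B * mat_adjoint A) *\<^sub>v (A *\<^sub>v v) = ((?B * mat_adjoint A) * A) *\<^sub>v v"
    by (rule assoc_mult_mat_vec[OF BA A v, symmetric])
  also have "(?B * mat_adjoint A) * A = ?B * gram_mat A" by (rule assoc_mult_mat[OF inv(2) AC A])
  also have "\<dots> = 1\<^sub>m d" by (rule inv(4))
  finally show ?thesis using v by simp
qed

section \<open>Measurable dependence of determinants and adjugates on the entries\<close>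

lemma measurable_det:
  fixes A :: "'b \<Rightarrow> complex mat"
  assumes "\<And>x. A x \<in> carrier_mat d d"
    and "\<And>i j. i < d \<Longrightarrow> j < d \<Longrightarrow> (\<lambda>x. A x $$ (i, j)) \<in> borel_measurable N"
  shows "(\<lambda>x. det (A x)) \<in> borel_measurable N"
  unfolding det_def'[OF assms(1)]
proof (intro borel_measurable_sum borel_measurable_times borel_measurable_const borel_measurable_prod)
  fix p i assume "p \<in> {p. p permutes {0..<d}}" "i \<in> {0..<d}"
  then have "i < d" "p i < d" using permutes_in_image[of p "{0..<d}" i] by auto
  then show "(\<lambda>x. A x $$ (i, p i)) \<in> borel_measurable N" by (rule assms(2))
qed

lemma measurable_adj_mat:
  fixes A :: "'b \<Rightarrow> complex mat"
  assumes A: "\<And>x. A x \<in> carrier_mat d d"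
    and e: "\<And>i j. i < d \<Longrightarrow> j < d \<Longrightarrow> (\<lambda>x. A x $$ (i, j)) \<in> borel_measurable N"
    and ij: "i < d" "j < d"
  shows "(\<lambda>x. adj_mat (A x) $$ (i, j)) \<in> borel_measurable N"
proof -
  have eq: "adj_mat (A x) $$ (i, j) = (-1) ^ (j + i) * det (mat_delete (A x) j i)" for x
    using A[of x] ij by (simp add: adj_mat_def cofactor_def)
  have dims: "dim_row (A x) = d" "dim_col (A x) = d" for x using A[of x] by auto
  have "(\<lambda>x. det (mat_delete (A x) j i)) \<in> borel_measurable N"
  proof (rule measurable_det[where d = "d - 1"])
    show "mat_delete (A x) j i \<in> carrier_mat (d - 1) (d - 1)" for x
      using A[of x] by (rule mat_delete_carrier)
    fix k l assume "k < d - 1" "l < d - 1"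
    then have "(\<lambda>x. mat_delete (A x) j i $$ (k, l)) = (\<lambda>x. A x $$ (if k < j then k else Suc k, if l < i then l else Suc l))"
      by (simp add: mat_delete_def dims)
    then show "(\<lambda>x. mat_delete (A x) j i $$ (k, l)) \<in> borel_measurable N"
      using \<open>k < d - 1\<close> \<open>l < d - 1\<close> by (auto intro!: e)
  qed
  then show ?thesis unfolding eq by simp
qed

section \<open>Error of the least squares operator\<close>

lemma sum_lessThan_shift:
  fixes N d :: nat
  shows "(\<Sum>k<N + d. f k) = (\<Sum>k<d. f k) + (\<Sum>k<N. f (k + d) :: 'a :: comm_monoid_add)"
  by (induction N) (simp_all add: add.assoc)

context rkhs_embedding
begin

lemma quasi_orthonormal_Suc: "quasi_orthonormal I (\<lambda>k. e (Suc k))"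
  using quasi_orthonormal_e unfolding quasi_orthonormal_def by auto

text \<open>The remainder \<open>w - S N\<close> tends in \<open>H\<close> to the kernel part
  \<open>w0\<close>, which need not be 0. But \<open>w0\<close> vanishes almost everywhere by
  \<open>complete_e\<close>, so it may be subtracted before \<open>L2_bound\<close> transfers
  convergence from \<open>H\<close> to L2.\<close>

lemma L2_Parseval:
  assumes w: "w \<in> H"
  shows "(\<lambda>k. lam (Suc k) * (cmod (ip w (e (Suc k))))\<^sup>2) sums (\<integral>x. (cmod (w x))\<^sup>2 \<partial>M)"
proof -
  define c where "c k = ip w (e (Suc k))" for k
  define S where "S N = (\<Sum>k<N. cscale (c k) (e (Suc k)))" for N
  note res = residual[OF quasi_orthonormal_Suc finite_lessThan w, folded c_def, folded S_def]
  have S: "S N \<in> H" for N using res(1) .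
  define w0 where "w0 = kernel_part w"
  note kp = kernel_part[OF w, folded w0_def]
  have ipS: "c k * cnj (ip (S N) (e (Suc k))) = c k * cnj (c k)" if "k < N" for k N
    using ip_comb[OF quasi_orthonormal_Suc finite_lessThan order_refl, of k N c] that
    by (auto simp: S_def c_def zero_right w)
  have e1: "L2_inner M w (S N) = (\<Sum>k<N. complex_of_real (lam (Suc k) * (cmod (c k))\<^sup>2))" for N
  proof -
    have "L2_inner M w (S N) = (\<Sum>k<N. L2_inner M w (cscale (c k) (e (Suc k))))"
      unfolding S_def using w by (intro L2.sum_right in_scale e_in) auto
    also have "\<dots> = (\<Sum>k<N. complex_of_real (lam (Suc k) * (cmod (c k))\<^sup>2))"
      using w e_in by (intro sum.cong refl)
        (simp add: L2.scale_right L2_e c_def complex_norm_square mult_ac del: of_real_power)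
    finally show ?thesis .
  qed
  have e2: "L2_inner M (S N) (S N) = (\<Sum>k<N. complex_of_real (lam (Suc k) * (cmod (c k))\<^sup>2))" for N
  proof -
    have "L2_inner M (S N) (S N) = (\<Sum>k<N. L2_inner M (S N) (cscale (c k) (e (Suc k))))"
      by (subst (2) S_def) (use S in \<open>intro L2.sum_right in_scale e_in; simp\<close>)
    also have "\<dots> = (\<Sum>k<N. complex_of_real (lam (Suc k)) * cnj (c k * cnj (ip (S N) (e (Suc k)))))"
      using S e_in by (intro sum.cong refl) (simp add: L2.scale_right L2_e mult_ac)
    also have "\<dots> = (\<Sum>k<N. complex_of_real (lam (Suc k)) * (c k * cnj (c k)))"
      by (intro sum.cong refl) (simp add: ipS mult.commute[of "cnj _"])
    finally show ?thesis by (simp add: complex_norm_square del: of_real_power)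
  qed
  have d: "(\<integral>x. (cmod ((w - S N) x))\<^sup>2 \<partial>M) = (\<integral>x. (cmod (w x))\<^sup>2 \<partial>M) - (\<Sum>k<N. lam (Suc k) * (cmod (c k))\<^sup>2)" for N
    using L2.expand_diff[OF w S, of N] unfolding e1 e2 L2_self by (simp add: Re_sum)
  have le: "(\<integral>x. (cmod ((w - S N) x))\<^sup>2 \<partial>M) \<le> (nsq (w - S N) - nsq w0) * kernel_trace M K" for N
  proof -
    have "(\<integral>x. (cmod ((w - S N) x))\<^sup>2 \<partial>M) = (\<integral>x. (cmod ((w - S N - w0) x))\<^sup>2 \<partial>M)"
    proof (rule integral_cong_AE)
      show "AE x in M. (cmod ((w - S N) x))\<^sup>2 = (cmod ((w - S N - w0) x))\<^sup>2"
        using complete_e[OF kp(1,2)] by (rule AE_mp) (auto intro!: AE_I2)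
    qed (rule borel_measurable_integrable, rule L2_bound, intro in_diff w S kp(1))+
    also have "\<dots> \<le> nsq (w - S N - w0) * kernel_trace M K"
      using w S kp(1) by (intro L2_bound in_diff)
    also have "nsq (w - S N - w0) = nsq (w - S N) - nsq w0"
    proof -
      have Sw0: "ip (S N) w0 = 0"
      proof -
        have "ip (S N) w0 = (\<Sum>k<N. c k * ip (e (Suc k)) w0)"
          unfolding S_def using kp(1) e_in by (subst sum_left) (auto intro!: in_scale simp: scale_left)
        also have "\<dots> = 0" using kp(2) ip_cnj[OF kp(1) e_in] by (intro sum.neutral) auto
        finally show ?thesis .
      qed
      have "ip w w0 = ip w0 w0"
        using kp(3)[OF kp(1,2)] ip_cnj[OF kp(1) w] ip_cnj[OF kp(1) kp(1)] by simp
      then have "ip (w - S N) w0 = ip w0 w0" using diff_left[OF w S kp(1)] Sw0 by simp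
      then show ?thesis using expand_diff[OF in_diff[OF w S] kp(1), of N] by simp
    qed
    finally show ?thesis .
  qed
  have lim: "(\<lambda>N. (nsq (w - S N) - nsq w0) * kernel_trace M K) \<longlonglongrightarrow> 0"
  proof -
    have "(\<lambda>N. \<Sum>k<N. (cmod (c k))\<^sup>2) \<longlonglongrightarrow> nsq w - nsq w0" using kp(5) by (simp add: sums_def c_def)
    then have "(\<lambda>N. (nsq w - (\<Sum>k<N. (cmod (c k))\<^sup>2) - nsq w0) * kernel_trace M K)
        \<longlonglongrightarrow> (nsq w - (nsq w - nsq w0) - nsq w0) * kernel_trace M K" by (intro tendsto_intros)
    then show ?thesis by (simp add: res(4))
  qed
  have "(\<lambda>N. \<integral>x. (cmod ((w - S N) x))\<^sup>2 \<partial>M) \<longlonglongrightarrow> 0"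
    by (rule tendsto_sandwich[OF _ _ tendsto_const lim];
        intro always_eventually allI le Bochner_Integration.integral_nonneg zero_le_power2)
  then have "(\<lambda>N. (\<integral>x. (cmod (w x))\<^sup>2 \<partial>M) - ((\<integral>x. (cmod (w x))\<^sup>2 \<partial>M) - (\<Sum>k<N. lam (Suc k) * (cmod (c k))\<^sup>2)))
      \<longlonglongrightarrow> (\<integral>x. (cmod (w x))\<^sup>2 \<partial>M) - 0" unfolding d by (intro tendsto_diff tendsto_const)
  then show ?thesis by (simp add: sums_def c_def)
qed

lemma L2_norm_sq_eq: "w \<in> H \<Longrightarrow> L2_norm_sq M w = ennreal (\<integral>x. (cmod (w x))\<^sup>2 \<partial>M)"
  unfolding L2_norm_sq_def by (intro nn_integral_eq_integral L2_bound) auto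

end

context rkhs_sampling
begin

definition sg :: "nat \<Rightarrow> real" where "sg k = singular_number lam (Suc k)"

lemma sg_sq: "(sg k)\<^sup>2 = lam (Suc k)" "0 \<le> sg k"
  using lam_nonneg[of "Suc k"] by (auto simp: sg_def singular_number_def)

lemma sg_pos: "k < m - 1 \<Longrightarrow> sg k > 0"
  using lam_pos[of "Suc k"] by (simp add: sg_def singular_number_def)

lemma e_eta: "k < m - 1 \<Longrightarrow> e (Suc k) = cscale (complex_of_real (sg k)) (eta lam e (Suc k))"
  using sg_pos[of k] by (simp add: eta_def cscale_def sg_def[symmetric] fun_eq_iff)

text \<open>Parseval in the system \<open>eta\<close>. Writing the coefficient of \<open>f\<close>
  as \<open>sg l * ip f (e (Suc l))\<close> keeps it meaningful for \<open>lam (Suc l) = 0\<close>,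
  where the term is 0.\<close>

lemma error_sums:
  fixes c :: "nat \<Rightarrow> complex"
  assumes f: "f \<in> H"
  defines "w \<equiv> f - (\<Sum>k<m-1. cscale (c k) (eta lam e (Suc k)))"
  shows "w \<in> H"
    "(\<lambda>l. (cmod (complex_of_real (sg l) * ip f (e (Suc l)) - (if l < m - 1 then c l else 0)))\<^sup>2) sums (\<integral>x. (cmod (w x))\<^sup>2 \<partial>M)"
proof -
  let ?s = "\<Sum>k<m-1. cscale (c k) (eta lam e (Suc k))"
  have s: "?s \<in> H" by (intro in_sum in_scale eta_in) simp
  then show w: "w \<in> H" unfolding w_def by (intro in_diff f)
  have "lam (Suc l) * (cmod (ip w (e (Suc l))))\<^sup>2
      = (cmod (complex_of_real (sg l) * ip f (e (Suc l)) - (if l < m - 1 then c l else 0)))\<^sup>2" for l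
  proof -
    have "?s = (\<Sum>k<m-1. cscale (c k * complex_of_real (1 / sg k)) (e (Suc k)))"
      by (intro sum.cong refl) (simp add: eta_def cscale_def sg_def mult.assoc)
    then have "ip ?s (e (Suc l)) = ip (\<Sum>k<m-1. cscale (c k * complex_of_real (1 / sg k)) (e (Suc k))) (e (Suc l))"
      by (rule arg_cong)
    also have "\<dots> = (if l \<in> {..<m-1} \<and> e (Suc l) \<noteq> 0 then c l * complex_of_real (1 / sg l) else 0)"
      by (rule ip_comb[OF quasi_orthonormal_Suc[of "insert l {..<m-1}"]]) auto
    finally have "ip ?s (e (Suc l)) = (if l < m - 1 \<and> e (Suc l) \<noteq> 0 then c l * complex_of_real (1 / sg l) else 0)"
      by simp
    moreover have "e (Suc l) \<noteq> 0" if "l < m - 1"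
      using e_orth[of "Suc l" "Suc l"] lam_pos[of "Suc l"] that zero_left[OF in_zero] by auto
    ultimately have ipw: "ip w (e (Suc l)) = ip f (e (Suc l)) - (if l < m - 1 then c l / complex_of_real (sg l) else 0)"
      unfolding w_def using f s e_in by (simp add: diff_left)
    have "lam (Suc l) * (cmod (ip w (e (Suc l))))\<^sup>2 = (cmod (complex_of_real (sg l) * ip w (e (Suc l))))\<^sup>2"
      by (simp add: norm_mult power_mult_distrib sg_sq)
    also have "complex_of_real (sg l) * ip w (e (Suc l)) = complex_of_real (sg l) * ip f (e (Suc l)) - (if l < m - 1 then c l else 0)"
      unfolding ipw using sg_pos[of l] by (auto simp: right_diff_distrib)
    finally show ?thesis .
  qed
  with L2_Parseval[OF w] show "(\<lambda>l. (cmod (complex_of_real (sg l) * ip f (e (Suc l)) - (if l < m - 1 then c l else 0)))\<^sup>2)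
      sums (\<integral>x. (cmod (w x))\<^sup>2 \<partial>M)" by simp
qed

abbreviation L :: "nat \<Rightarrow> (nat \<Rightarrow> 'a) \<Rightarrow> complex mat" where
  "L n X \<equiv> lsq_matrix \<rho> (eta lam e) m n X"

lemma L_carrier: "L n X \<in> carrier_mat n (m - 1)"
  by (simp add: lsq_matrix_def)

lemma L_index: "j < n \<Longrightarrow> k < m - 1 \<Longrightarrow> L n X $$ (j, k) = yL (X j) k"
  by (simp add: lsq_matrix_def yL_def wt_def)

lemma data_wt: "lsq_data \<rho> n X f = Matrix.vec n (\<lambda>j. wt f (X j))"
  by (simp add: lsq_data_def wt_def)

text \<open>\<open>cdot\<close> conjugates the sample vector while matrix multiplication does not;
  the two conjugations reconcile them and leave moduli unchanged.\<close>

lemma L_mult: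
  assumes "v \<in> carrier_vec (m - 1)" "j < n"
  shows "vec_index (L n X *\<^sub>v v) j = cnj (cdot (m - 1) (\<lambda>k. cnj (vec_index v k)) (yL (X j)))"
  using mult_vec_index[OF L_carrier assms] by (simp add: cdot_def L_index assms(2) mult.commute)

lemma good_lower:
  assumes "good n r X" "v \<in> carrier_vec (m - 1)"
  shows "real n / 6 * (\<Sum>k<m-1. (cmod (vec_index v k))\<^sup>2) \<le> (\<Sum>j<n. (cmod (vec_index (L n X *\<^sub>v v) j))\<^sup>2)"
proof -
  have "real n / 6 * (\<Sum>k<m-1. (cmod (cnj (vec_index v k)))\<^sup>2)
     \<le> (\<Sum>j<n. (cmod (cdot (m - 1) (\<lambda>k. cnj (vec_index v k)) (yL (X j))))\<^sup>2)"
    by (rule goodD(1)[OF assms(1)])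
  then show ?thesis using L_mult[OF assms(2)] by simp
qed

lemma good_det:
  assumes "good n r X" "n > 0" shows "det (gram_mat (L n X)) \<noteq> 0"
proof
  assume "det (gram_mat (L n X)) = 0"
  then obtain v where v: "v \<in> carrier_vec (m - 1)" "v \<noteq> 0\<^sub>v (m - 1)" "L n X *\<^sub>v v = 0\<^sub>v n"
    using det_0_iff_vec_prod_zero_field[OF gram_carrier[OF L_carrier]] gram_kernel[OF L_carrier] by blast
  have "real n / 6 * (\<Sum>k<m-1. (cmod (vec_index v k))\<^sup>2) \<le> 0"
    using good_lower[OF assms(1) v(1)] unfolding v(3) by simp
  then have "(\<Sum>k<m-1. (cmod (vec_index v k))\<^sup>2) \<le> 0" using assms(2) by (simp add: mult_le_0_iff)
  then have "(\<Sum>k<m-1. (cmod (vec_index v k))\<^sup>2) = 0" by (intro antisym sum_nonneg) auto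
  then have "\<forall>k<m-1. vec_index v k = 0" by (subst (asm) sum_nonneg_eq_0_iff) auto
  then show False using v(1,2) by (metis carrier_vecD eq_vecI index_zero_vec)
qed

lemma wt_linear:
  "wt (f + g) x = wt f x + wt g x" "wt (f - g) x = wt f x - wt g x" "wt (cscale c f) x = c * wt f x"
  "wt (sum F I) x = (\<Sum>i\<in>I. wt (F i) x)"
proof -
  show 1: "wt (f + g) x = wt f x + wt g x" for f g by (simp add: wt_def add_divide_distrib)
  show "wt (f - g) x = wt f x - wt g x" by (simp add: wt_def diff_divide_distrib)
  show "wt (cscale c f) x = c * wt f x" by (simp add: wt_def cscale_def)
  show "wt (sum F I) x = (\<Sum>i\<in>I. wt (F i) x)"
  proof (induction I rule: infinite_finite_induct)
    case (insert i I)
    show ?case unfolding sum.insert[OF insert.hyps] 1 insert.IH ..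
  qed (simp_all add: wt_def)
qed

text \<open>Point values of \<open>g\<close> are its inner products with the kernel parts
  \<open>\<kappa> j\<close> of the sections at the nodes. On the good event these are mutually
  orthogonal, with squared norms \<open>K0(x\<^sub>j, x\<^sub>j)\<close> bounded by
  \<open>3 * tr0 * \<rho>\<close>, so Bessel's inequality for the normalised
  \<open>\<kappa> j\<close> gives a bound free of \<open>n\<close>.\<close>

lemma kernel_part_samples:
  assumes good: "good n r X" and X: "X \<in> space (Q n)" and g: "g \<in> H" and ge: "\<And>k. 1 \<le> k \<Longrightarrow> ip g (e k) = 0"
  shows "(\<Sum>j<n. (cmod (wt g (X j)))\<^sup>2) \<le> 3 * tr0 M K e * nsq g"
proof -
  define \<kappa> where "\<kappa> j = kernel_part (kf (X j))" for j
  have XD: "X j \<in> D" if "j < n" for j using Q_in_D[OF X that] .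
  have \<kappa>: "\<kappa> j \<in> H" if "j < n" for j unfolding \<kappa>_def by (intro kernel_part kf_in XD that)
  define q where "q j = nsq (\<kappa> j)" for j
  \<comment> \<open>If \<open>\<kappa> j = 0\<close>, then \<open>u j = 0\<close>, which
    \<open>quasi_orthonormal\<close> admits.\<close>
  define u where "u j = cscale (complex_of_real (1 / sqrt (q j))) (\<kappa> j)" for j
  have q0: "0 \<le> q j" if "j < n" for j unfolding q_def by (intro nonneg \<kappa> that)
  have "quasi_orthonormal {..<n} u"
    unfolding quasi_orthonormal_def
  proof (intro conjI ballI impI)
    fix j assume j: "j \<in> {..<n}"
    then show uj: "u j \<in> H" unfolding u_def by (intro in_scale \<kappa>) simp
    show "u j = 0 \<or> ip (u j) (u j) = 1"
    proof (cases "q j = 0")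
      case True
      then show ?thesis by (simp add: u_def cscale_def zero_fun_def)
    next
      case False
      then have "q j > 0" using q0[of j] j by simp
      then have "nsq (u j) = 1"
        using \<kappa>[of j] j by (simp add: u_def expand_scale norm_divide power_divide q_def[symmetric])
      then show ?thesis using self_real[OF uj] by simp
    qed
    fix i assume i: "i \<in> {..<n}" "j \<noteq> i"
    have "ip (\<kappa> j) (\<kappa> i) = K0 K e (X i) (X j)"
      unfolding \<kappa>_def using XD i j by (intro K0_ip[symmetric]) auto
    also have "\<dots> = 0" using i j by (intro goodD(3)[OF good]) auto
    finally show "ip (u j) (u i) = 0" unfolding u_def using \<kappa> i j by (simp add: scale_left scale_right in_scale)
  qed
  from Bessel[OF this _ g] have B: "(\<Sum>j<n. (cmod (ip g (u j)))\<^sup>2) \<le> nsq g" by simp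
  have "(cmod (wt g (X j)))\<^sup>2 \<le> 3 * tr0 M K e * (cmod (ip g (u j)))\<^sup>2" if j: "j < n" for j
  proof (cases "\<rho> (X j) = 0")
    case True
    then show ?thesis using tr0_nonneg by (simp add: wt_def)
  next
    case False
    then have \<rho>: "\<rho> (X j) > 0" using \<rho>_nonneg[OF XD[OF j]] by simp
    have "ip g (\<kappa> j) = g (X j)"
      unfolding \<kappa>_def using kernel_part(3)[OF kf_in[OF XD[OF j]] g ge] eval_ip[OF g XD[OF j]] by simp
    then have gq: "(cmod (g (X j)))\<^sup>2 = q j * (cmod (ip g (u j)))\<^sup>2"
    proof (cases "q j = 0")
      case True
      then have "\<kappa> j = 0" using nsq_eq_0[OF \<kappa>[OF j]] by (simp add: q_def)
      then show ?thesis using True \<open>ip g (\<kappa> j) = g (X j)\<close> zero_right[OF g] by simp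
    next
      case False
      then have "q j > 0" using q0[OF j] by simp
      then show ?thesis using \<open>ip g (\<kappa> j) = g (X j)\<close> g \<kappa>[OF j]
        by (simp add: u_def scale_right norm_divide power_divide norm_mult power_mult_distrib)
    qed
    have "q j \<le> 3 * tr0 M K e * \<rho> (X j)"
      using goodD(4)[OF good j] unfolding q_def \<kappa>_def K0_diag[OF XD[OF j]] .
    then have "q j * (cmod (ip g (u j)))\<^sup>2 \<le> 3 * tr0 M K e * \<rho> (X j) * (cmod (ip g (u j)))\<^sup>2"
      by (intro mult_right_mono) auto
    then show ?thesis using \<rho> gq cmod_wt[OF XD[OF j], of g] by (simp add: pos_divide_le_eq mult_ac)
  qed
  then have "(\<Sum>j<n. (cmod (wt g (X j)))\<^sup>2) \<le> 3 * tr0 M K e * (\<Sum>j<n. (cmod (ip g (u j)))\<^sup>2)"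
    unfolding sum_distrib_left by (intro sum_mono) auto
  also have "\<dots> \<le> 3 * tr0 M K e * nsq g" using B tr0_nonneg by (intro mult_left_mono) auto
  finally show ?thesis .
qed

lemma upper_level_nonneg: "0 \<le> upper_level n r"
  unfolding upper_level_def using lam_nonneg[OF m] by (simp add: le_max_iff_disj)

text \<open>The part \<open>h\<close> of \<open>g\<close> in the closed span of the tail is known at
  the nodes only as a pointwise limit, so the good-event bound is applied to truncations and passed
  to the limit over the finitely many nodes. The kernel part is treated separately, and the two are
  joined by \<open>(a + b)^2 \<le> 2a^2 + 2b^2\<close>.\<close>

lemma residual_samples:
  assumes good: "good n r X" and X: "X \<in> space (Q n)" and f: "f \<in> H"
  defines "g \<equiv> f - (\<Sum>k<m-1. cscale (ip f (e (Suc k))) (e (Suc k)))"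
  shows "(\<Sum>j<n. (cmod (wt g (X j)))\<^sup>2) \<le> 2 * upper_level n r * nsq f + 6 * tr0 M K e * nsq f"
proof -
  define \<alpha> where "\<alpha> k = ip f (e (Suc k))" for k
  define f0 where "f0 = kernel_part f"
  note kp = kernel_part[OF f, folded f0_def]
  have md: "Suc (k + (m - 1)) = k + m" for k using m by simp
  define h where "h = g - f0"
  have lim: "(\<lambda>N. \<Sum>k<N. \<alpha> (k + (m - 1)) * e (k + m) x) \<longlonglongrightarrow> h x" for x
  proof -
    have "(\<lambda>N. \<Sum>k<N + (m - 1). \<alpha> k * e (Suc k) x) \<longlonglongrightarrow> f x - f0 x"
      using LIMSEQ_ignore_initial_segment[OF kp(4), of x "m - 1"] by (simp add: \<alpha>_def)
    then have "(\<lambda>N. (\<Sum>k<m-1. \<alpha> k * e (Suc k) x) + (\<Sum>k<N. \<alpha> (k + (m - 1)) * e (k + m) x)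
        - (\<Sum>k<m-1. \<alpha> k * e (Suc k) x)) \<longlonglongrightarrow> f x - f0 x - (\<Sum>k<m-1. \<alpha> k * e (Suc k) x)"
      unfolding sum_lessThan_shift md by (intro tendsto_diff tendsto_const)
    moreover have "(\<Sum>k<d. cscale (\<alpha> k) (e (Suc k))) x = (\<Sum>k<d. \<alpha> k * e (Suc k) x)" for d
      by (induction d) (simp_all add: cscale_def)
    ultimately show ?thesis by (simp add: h_def g_def \<alpha>_def[symmetric] algebra_simps)
  qed
  have hs: "(\<Sum>j<n. (cmod (wt h (X j)))\<^sup>2) \<le> upper_level n r * nsq f"
  proof (rule LIMSEQ_le_const2)
    show "(\<lambda>N. \<Sum>j<n. (cmod (\<Sum>k<N. \<alpha> (k + (m - 1)) * yT (X j) k))\<^sup>2) \<longlonglongrightarrow> (\<Sum>j<n. (cmod (wt h (X j)))\<^sup>2)"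
    proof (intro tendsto_sum tendsto_power tendsto_norm)
      fix j
      show "(\<lambda>N. \<Sum>k<N. \<alpha> (k + (m - 1)) * yT (X j) k) \<longlonglongrightarrow> wt h (X j)"
      proof (cases "\<rho> (X j) = 0")
        case False
        have "(\<lambda>N. (\<Sum>k<N. \<alpha> (k + (m - 1)) * e (k + m) (X j)) / complex_of_real (sqrt (\<rho> (X j))))
            \<longlonglongrightarrow> h (X j) / complex_of_real (sqrt (\<rho> (X j)))"
          by (intro tendsto_divide lim tendsto_const) (use False in simp)
        then show ?thesis using False by (simp add: wt_def yT_def sum_divide_distrib)
      qed (simp add: wt_def yT_def)
    qed
    have "(\<Sum>j<n. (cmod (\<Sum>k<N. \<alpha> (k + (m - 1)) * yT (X j) k))\<^sup>2) \<le> upper_level n r * nsq f" for N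
    proof -
      have c: "(\<Sum>k<N. \<alpha> (k + (m - 1)) * yT (X j) k) = cnj (cdot N (\<lambda>k. cnj (\<alpha> (k + (m - 1)))) (yT (X j)))" for j
        by (simp add: cdot_def)
      have "(\<Sum>j<n. (cmod (cdot N (\<lambda>k. cnj (\<alpha> (k + (m - 1)))) (yT (X j))))\<^sup>2)
          \<le> upper_level n r * (\<Sum>k<N. (cmod (cnj (\<alpha> (k + (m - 1)))))\<^sup>2)"
        by (rule goodD(2)[OF good])
      also have "\<dots> \<le> upper_level n r * nsq f"
      proof (intro mult_left_mono upper_level_nonneg)
        have "(\<Sum>k<N. (cmod (\<alpha> (k + (m - 1))))\<^sup>2) \<le> (\<Sum>k<N + (m - 1). (cmod (\<alpha> k))\<^sup>2)"
          unfolding sum_lessThan_shift by (simp add: sum_nonneg)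
        also have "\<dots> \<le> nsq f" unfolding \<alpha>_def by (rule Bessel[OF quasi_orthonormal_Suc _ f]) simp
        finally show "(\<Sum>k<N. (cmod (cnj (\<alpha> (k + (m - 1)))))\<^sup>2) \<le> nsq f" by simp
      qed
      finally show ?thesis unfolding c by simp
    qed
    then show "\<exists>N0. \<forall>N\<ge>N0. (\<Sum>j<n. (cmod (\<Sum>k<N. \<alpha> (k + (m - 1)) * yT (X j) k))\<^sup>2) \<le> upper_level n r * nsq f" by blast
  qed
  have fs: "(\<Sum>j<n. (cmod (wt f0 (X j)))\<^sup>2) \<le> 3 * tr0 M K e * nsq f"
  proof -
    have "(\<Sum>j<n. (cmod (wt f0 (X j)))\<^sup>2) \<le> 3 * tr0 M K e * nsq f0"
      by (rule kernel_part_samples[OF good X kp(1,2)])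
    also have "nsq f0 \<le> nsq f" using sums_le[OF _ sums_zero kp(5)] by simp
    then have "3 * tr0 M K e * nsq f0 \<le> 3 * tr0 M K e * nsq f" using tr0_nonneg by (intro mult_left_mono) auto
    finally show ?thesis .
  qed
  have "(cmod (wt g x))\<^sup>2 \<le> 2 * (cmod (wt h x))\<^sup>2 + 2 * (cmod (wt f0 x))\<^sup>2" for x
  proof -
    have "wt g x = wt h x + wt f0 x" using wt_linear(1)[of h f0 x] by (simp add: h_def)
    then have "(cmod (wt g x))\<^sup>2 \<le> (cmod (wt h x) + cmod (wt f0 x))\<^sup>2"
      by (auto intro: power_mono norm_triangle_ineq)
    also have "\<dots> \<le> 2 * (cmod (wt h x))\<^sup>2 + 2 * (cmod (wt f0 x))\<^sup>2"
      using sum_squares_bound[of "cmod (wt h x)" "cmod (wt f0 x)"] by (simp add: power2_sum)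
    finally show ?thesis .
  qed
  then have "(\<Sum>j<n. (cmod (wt g (X j)))\<^sup>2) \<le> (\<Sum>j<n. 2 * (cmod (wt h (X j)))\<^sup>2 + 2 * (cmod (wt f0 (X j)))\<^sup>2)"
    by (intro sum_mono) auto
  also have "\<dots> = 2 * (\<Sum>j<n. (cmod (wt h (X j)))\<^sup>2) + 2 * (\<Sum>j<n. (cmod (wt f0 (X j)))\<^sup>2)"
    by (simp add: sum.distrib sum_distrib_left)
  finally show ?thesis using hs fs by linarith
qed

lemma lsq_operator_eq:
  "lsq_operator \<rho> (eta lam e) m n X f
    = (\<Sum>k<m-1. cscale (vec_index (lsq_coeffs \<rho> (eta lam e) m n X f) k) (eta lam e (Suc k)))"
  unfolding lsq_operator_def by (rule sum.reindex_bij_witness[of _ Suc "\<lambda>i. i - 1"]) auto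

definition bound :: "nat \<Rightarrow> real \<Rightarrow> real" where
  "bound n r = Max {lam m, r * ln (real n) / real n * T, tr0 M K e / real n}"

text \<open>In the system \<open>eta\<close> the error has coefficients \<open>- c' l\<close> for
  \<open>l < m - 1\<close> and those of the tail of \<open>f\<close> beyond. The index ranges are
  disjoint, so no mixed terms arise, and the tail costs at most \<open>lam m\<close>.\<close>

lemma good_error:
  assumes good: "good n r X" and X: "X \<in> space (Q n)" and n: "n > 0" and f: "f \<in> H" "nsq f \<le> 1"
  shows "L2_norm_sq M (f - lsq_operator \<rho> (eta lam e) m n X f) \<le> ennreal (441 * bound n r)"
proof -
  define \<alpha> where "\<alpha> k = ip f (e (Suc k))" for k
  define Pf where "Pf = (\<Sum>k<m-1. cscale (\<alpha> k) (e (Suc k)))"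
  define g where "g = f - Pf"
  note det = good_det[OF good n]
  define W where "W = the (mat_inverse (gram_mat (L n X))) * mat_adjoint (L n X)"
  have W: "W \<in> carrier_mat (m - 1) n"
    unfolding W_def using the_mat_inverse(2)[OF gram_carrier[OF L_carrier] det] mat_adjoint_carrier[OF L_carrier] by simp
  define dat where "dat h = Matrix.vec n (\<lambda>j. wt h (X j))" for h
  have dat: "dat h \<in> carrier_vec n" for h by (simp add: dat_def)
  define c where "c = lsq_coeffs \<rho> (eta lam e) m n X f"
  have c: "c = W *\<^sub>v dat f" by (simp add: c_def lsq_coeffs_def Let_def W_def data_wt dat_def)
  define c' where "c' = W *\<^sub>v dat g"
  note lsr = least_squares_residual[OF L_carrier det dat[of g], folded W_def, folded c'_def]
  define v where "v = Matrix.vec (m - 1) (\<lambda>k. complex_of_real (sg k) * \<alpha> k)"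
  have v: "v \<in> carrier_vec (m - 1)" by (simp add: v_def)
  have "dat Pf = L n X *\<^sub>v v"
  proof (intro eq_vecI)
    fix j assume "j < dim_vec (L n X *\<^sub>v v)"
    then have j: "j < n" using L_carrier[of n X] by simp
    have "wt Pf (X j) = (\<Sum>k<m-1. \<alpha> k * wt (e (Suc k)) (X j))" unfolding Pf_def by (simp only: wt_linear)
    also have "\<dots> = (\<Sum>k<m-1. L n X $$ (j, k) * vec_index v k)"
      using j by (intro sum.cong refl) (simp add: L_index v_def yL_def e_eta wt_linear)
    finally show "vec_index (dat Pf) j = vec_index (L n X *\<^sub>v v) j"
      using j mult_vec_index[OF L_carrier v j] by (simp add: dat_def)
  qed (use L_carrier[of n X] in \<open>simp add: dat_def\<close>)
  then have "W *\<^sub>v dat Pf = v" unfolding W_def using least_squares_exact[OF L_carrier det v] by simp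
  moreover have "dat f = dat Pf + dat g"
    by (intro eq_vecI) (simp_all add: dat_def g_def wt_linear)
  ultimately have "c = v + c'" unfolding c c'_def using mult_add_distrib_mat_vec[OF W dat dat] by simp
  then have ck: "vec_index c k = complex_of_real (sg k) * \<alpha> k + vec_index c' k" if "k < m - 1" for k
    using that lsr(1) by (simp add: v_def)
  have "real n / 6 * (\<Sum>k<m-1. (cmod (vec_index c' k))\<^sup>2) \<le> (\<Sum>j<n. (cmod (vec_index (L n X *\<^sub>v c') j))\<^sup>2)"
    by (rule good_lower[OF good lsr(1)])
  also have "\<dots> \<le> (\<Sum>j<n. (cmod (vec_index (dat g) j))\<^sup>2)" by (rule lsr(2))
  also have "\<dots> = (\<Sum>j<n. (cmod (wt g (X j)))\<^sup>2)" by (simp add: dat_def)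
  also have "\<dots> \<le> 2 * upper_level n r * nsq f + 6 * tr0 M K e * nsq f"
    using residual_samples[OF good X f(1)] by (simp add: g_def Pf_def \<alpha>_def)
  also have "\<dots> \<le> 2 * upper_level n r * 1 + 6 * tr0 M K e * 1"
    using f(2) tr0_nonneg upper_level_nonneg by (intro add_mono mult_left_mono) auto
  finally have c'1: "real n / 6 * (\<Sum>k<m-1. (cmod (vec_index c' k))\<^sup>2) \<le> 2 * upper_level n r + 6 * tr0 M K e" by simp
  have bnd: "lam m \<le> bound n r" "r * ln (real n) / real n * T \<le> bound n r" "tr0 M K e / real n \<le> bound n r"
    unfolding bound_def by auto
  have up: "upper_level n r \<le> 11 * (real n * bound n r)"
  proof -
    have "real n * lam m \<le> real n * bound n r" using bnd(1) by (intro mult_left_mono) auto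
    moreover have "r * ln (real n) * T \<le> real n * bound n r"
      using bnd(2) n by (simp add: field_simps)
    ultimately show ?thesis unfolding upper_level_def by simp
  qed
  have tr: "tr0 M K e \<le> real n * bound n r" using bnd(3) n by (simp add: field_simps)
  \<comment> \<open>\<open>6 * (2 * 11 + 6) = 168\<close>; the tail of \<open>f\<close> adds one
    more \<open>bound n r\<close> below.\<close>
  have "real n * (\<Sum>k<m-1. (cmod (vec_index c' k))\<^sup>2) \<le> real n * (168 * bound n r)"
    using c'1 up tr by simp
  then have c'2: "(\<Sum>k<m-1. (cmod (vec_index c' k))\<^sup>2) \<le> 168 * bound n r" using n by simp
  let ?w = "f - lsq_operator \<rho> (eta lam e) m n X f"
  have w: "?w = f - (\<Sum>k<m-1. cscale (vec_index c k) (eta lam e (Suc k)))"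
    by (simp only: lsq_operator_eq c_def)
  note es = error_sums[OF f(1), of "vec_index c", folded w]
  have "(\<integral>x. (cmod (?w x))\<^sup>2 \<partial>M) \<le> 169 * bound n r"
  proof (rule LIMSEQ_le_const2[OF es(2)[unfolded sums_def]])
    have "(\<Sum>l<N. (cmod (complex_of_real (sg l) * \<alpha> l - (if l < m - 1 then vec_index c l else 0)))\<^sup>2) \<le> 169 * bound n r" for N
    proof -
      have "(\<Sum>l<N. (cmod (complex_of_real (sg l) * \<alpha> l - (if l < m - 1 then vec_index c l else 0)))\<^sup>2)
          \<le> (\<Sum>l<N. (if l < m - 1 then (cmod (vec_index c' l))\<^sup>2 else 0) + lam m * (cmod (\<alpha> l))\<^sup>2)"
      proof (rule sum_mono)
        fix l
        show "(cmod (complex_of_real (sg l) * \<alpha> l - (if l < m - 1 then vec_index c l else 0)))\<^sup>2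
            \<le> (if l < m - 1 then (cmod (vec_index c' l))\<^sup>2 else 0) + lam m * (cmod (\<alpha> l))\<^sup>2"
        proof (cases "l < m - 1")
          case True
          then show ?thesis using lam_nonneg[OF m] by (simp add: ck)
        next
          case False
          then have "lam (Suc l) \<le> lam m" using m by (intro lam_mono) auto
          then have "lam (Suc l) * (cmod (\<alpha> l))\<^sup>2 \<le> lam m * (cmod (\<alpha> l))\<^sup>2" by (intro mult_right_mono) auto
          then show ?thesis using False by (simp add: norm_mult power_mult_distrib sg_sq)
        qed
      qed
      also have "\<dots> = (\<Sum>l<N. if l < m - 1 then (cmod (vec_index c' l))\<^sup>2 else 0) + lam m * (\<Sum>l<N. (cmod (\<alpha> l))\<^sup>2)"
        by (simp add: sum.distrib sum_distrib_left)
      also have "\<dots> \<le> 168 * bound n r + lam m * 1"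
      proof (intro add_mono mult_left_mono lam_nonneg m)
        have "(\<Sum>l<N. if l < m - 1 then (cmod (vec_index c' l))\<^sup>2 else 0) = (\<Sum>l\<in>{..<N} \<inter> {..<m-1}. (cmod (vec_index c' l))\<^sup>2)"
          by (subst sum.inter_restrict) auto
        also have "\<dots> \<le> (\<Sum>l<m-1. (cmod (vec_index c' l))\<^sup>2)" by (intro sum_mono2) auto
        finally show "(\<Sum>l<N. if l < m - 1 then (cmod (vec_index c' l))\<^sup>2 else 0) \<le> 168 * bound n r" using c'2 by simp
        show "(\<Sum>l<N. (cmod (\<alpha> l))\<^sup>2) \<le> 1"
          unfolding \<alpha>_def using Bessel[OF quasi_orthonormal_Suc, of "{..<N}" f] f by simp
      qed
      finally show ?thesis using bnd(1) by simp
    qed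
    then show "\<exists>N0. \<forall>N\<ge>N0. (\<Sum>l<N. (cmod (complex_of_real (sg l) * ip f (e (Suc l)) - (if l < m - 1 then vec_index c l else 0)))\<^sup>2) \<le> 169 * bound n r"
      unfolding \<alpha>_def by blast
  qed
  also have "169 * bound n r \<le> 441 * bound n r" using bnd(1) lam_nonneg[OF m] by simp
  finally show ?thesis unfolding L2_norm_sq_eq[OF es(1)] by (rule ennreal_leI)
qed

end

section \<open>Measurability and the final estimate\<close>

context rkhs_sampling
begin

definition wgt :: "'a \<Rightarrow> complex" where
  "wgt x = (if \<rho> x \<noteq> 0 then 1 / complex_of_real (sqrt (\<rho> x)) else 0)"

lemma wt_wgt: "wt f x = wgt x * f x"
  by (simp add: wt_def wgt_def)

text \<open>Entries of the pseudo-inverse of the least squares matrix, by Cramer's rule. The formula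
  is total, with value 0 for a singular Gram matrix, so it is measurable on the whole sample
  space.\<close>

definition pinv :: "nat \<Rightarrow> (nat \<Rightarrow> 'a) \<Rightarrow> nat \<Rightarrow> nat \<Rightarrow> complex" where
  "pinv n X k j = (1 / det (gram_mat (L n X))) * (\<Sum>p<m-1. adj_mat (gram_mat (L n X)) $$ (k, p) * cnj (yL (X j) p))"

lemma pinv_coeffs:
  assumes det: "det (gram_mat (L n X)) \<noteq> 0" and k: "k < m - 1"
  shows "vec_index (lsq_coeffs \<rho> (eta lam e) m n X f) k = (\<Sum>j<n. pinv n X k j * wt f (X j))"
proof -
  note G = gram_carrier[OF L_carrier, of n X]
  note inv = the_mat_inverse[OF G det]
  note AC = mat_adjoint_carrier[OF L_carrier, of n X]
  define W where "W = the (mat_inverse (gram_mat (L n X))) * mat_adjoint (L n X)"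
  have W: "W \<in> carrier_mat (m - 1) n" unfolding W_def using inv(2) AC by simp
  have Wkj: "W $$ (k, j) = pinv n X k j" if j: "j < n" for j
  proof -
    have "W $$ (k, j) = (\<Sum>p<m-1. the (mat_inverse (gram_mat (L n X))) $$ (k, p) * mat_adjoint (L n X) $$ (p, j))"
      unfolding W_def using inv(2) AC k j by (simp add: scalar_prod_def atLeast0LessThan)
    also have "\<dots> = (\<Sum>p<m-1. (1 / det (gram_mat (L n X))) * (adj_mat (gram_mat (L n X)) $$ (k, p) * cnj (yL (X j) p)))"
      unfolding inv(1) using adj_mat(1)[OF G] k j
      by (intro sum.cong refl) (simp add: mat_adjoint_index[OF L_carrier] L_index)
    finally show ?thesis by (simp add: pinv_def sum_distrib_left)
  qed
  have "lsq_coeffs \<rho> (eta lam e) m n X f = W *\<^sub>v Matrix.vec n (\<lambda>j. wt f (X j))"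
    by (simp add: lsq_coeffs_def Let_def W_def data_wt)
  then show ?thesis using mult_vec_index[OF W _ k, of "Matrix.vec n (\<lambda>j. wt f (X j))"] by (simp add: Wkj)
qed

definition coef :: "nat \<Rightarrow> (nat \<Rightarrow> 'a) \<Rightarrow> nat \<Rightarrow> nat \<Rightarrow> complex" where
  "coef n X l j = (if l < m - 1 then cnj (pinv n X l j * wgt (X j)) else 0)"

text \<open>\<open>dual n X l\<close> represents the functional that sends \<open>f\<close> to the \<open>l\<close>-th coefficient of the
  approximation error \<open>f - lsq_operator f\<close> with respect to the functions \<open>eta\<close>.\<close>

definition dual :: "nat \<Rightarrow> (nat \<Rightarrow> 'a) \<Rightarrow> nat \<Rightarrow> 'a \<Rightarrow> complex" where
  "dual n X l = cscale (complex_of_real (sg l)) (e (Suc l)) - (\<Sum>j<n. cscale (coef n X l j) (kf (X j)))"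

lemma dual_in: "X \<in> space (Q n) \<Longrightarrow> dual n X l \<in> H"
  unfolding dual_def using Q_in_D by (intro in_diff in_scale in_sum e_in kf_in) auto

lemma error_dual:
  assumes det: "det (gram_mat (L n X)) \<noteq> 0" and X: "X \<in> space (Q n)" and f: "f \<in> H"
  shows "L2_norm_sq M (f - lsq_operator \<rho> (eta lam e) m n X f)
      = ennreal (\<integral>x. (cmod ((f - lsq_operator \<rho> (eta lam e) m n X f) x))\<^sup>2 \<partial>M)"
    "(\<lambda>l. (cmod (ip f (dual n X l)))\<^sup>2) sums (\<integral>x. (cmod ((f - lsq_operator \<rho> (eta lam e) m n X f) x))\<^sup>2 \<partial>M)"
proof -
  let ?c = "vec_index (lsq_coeffs \<rho> (eta lam e) m n X f)"
  note es = error_sums[OF f, of ?c, folded lsq_operator_eq]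
  show "L2_norm_sq M (f - lsq_operator \<rho> (eta lam e) m n X f)
      = ennreal (\<integral>x. (cmod ((f - lsq_operator \<rho> (eta lam e) m n X f) x))\<^sup>2 \<partial>M)"
    by (rule L2_norm_sq_eq[OF es(1)])
  have "ip f (dual n X l) = complex_of_real (sg l) * ip f (e (Suc l)) - (if l < m - 1 then ?c l else 0)" for l
  proof -
    have kfX: "kf (X j) \<in> H" if "j < n" for j using kf_in Q_in_D[OF X that] by blast
    have "ip f (dual n X l) = complex_of_real (sg l) * ip f (e (Suc l)) - (\<Sum>j<n. ip f (cscale (coef n X l j) (kf (X j))))"
    proof -
      have t: "(\<Sum>j<n. cscale (coef n X l j) (kf (X j))) \<in> H" by (intro in_sum in_scale kfX) simp
      have "ip f (\<Sum>j<n. cscale (coef n X l j) (kf (X j))) = (\<Sum>j<n. ip f (cscale (coef n X l j) (kf (X j))))"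
        by (intro sum_right in_scale kfX f) simp
      then show ?thesis
        unfolding dual_def using f e_in[of "Suc l"] diff_right[OF in_scale t f] by (simp add: scale_right)
    qed
    also have "(\<Sum>j<n. ip f (cscale (coef n X l j) (kf (X j)))) = (\<Sum>j<n. cnj (coef n X l j) * f (X j))"
      using f kfX eval_ip[OF f] Q_in_D[OF X] by (intro sum.cong refl) (simp add: scale_right)
    also have "\<dots> = (if l < m - 1 then ?c l else 0)"
      by (simp add: coef_def pinv_coeffs[OF det] wt_wgt mult.assoc)
    finally show ?thesis .
  qed
  with es(2) show "(\<lambda>l. (cmod (ip f (dual n X l)))\<^sup>2) sums (\<integral>x. (cmod ((f - lsq_operator \<rho> (eta lam e) m n X f) x))\<^sup>2 \<partial>M)"
    by simp
qed

text \<open>The map from \<open>f\<close> to its sequence of error coefficients and the map from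
  finitely supported \<open>a\<close> to the combination of the \<open>dual n X l\<close> are
  adjoint to each other and have the same norm. This trades the supremum over the unit ball for
  quadratic forms.\<close>

lemma error_bound_iff:
  assumes det: "det (gram_mat (L n X)) \<noteq> 0" and X: "X \<in> space (Q n)" and C: "0 \<le> C"
  shows "(SUP f \<in> {f \<in> H. hnorm ip f \<le> 1}. L2_norm_sq M (f - lsq_operator \<rho> (eta lam e) m n X f)) \<le> ennreal C
     \<longleftrightarrow> (\<forall>N a. nsq (\<Sum>l<N. cscale (a l) (dual n X l)) \<le> C * (\<Sum>l<N. (cmod (a l))\<^sup>2))" (is "?l \<longleftrightarrow> ?r")
proof -
  have ball: "{f \<in> H. hnorm ip f \<le> 1} = {f \<in> H. nsq f \<le> 1}" by (auto simp: hnorm_def)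
  note dH = dual_in[OF X]
  define err where "err f = (\<integral>x. (cmod ((f - lsq_operator \<rho> (eta lam e) m n X f) x))\<^sup>2 \<partial>M)" for f
  have l_iff: "?l \<longleftrightarrow> (\<forall>f\<in>H. nsq f \<le> 1 \<longrightarrow> err f \<le> C)"
    unfolding ball SUP_le_iff using C by (auto simp: error_dual(1)[OF det X] err_def)
  have es: "(\<lambda>l. (cmod (ip f (dual n X l)))\<^sup>2) sums err f" if "f \<in> H" for f
    using error_dual(2)[OF det X that] by (simp add: err_def)
  have part: "(\<Sum>l<N. (cmod (ip f (dual n X l)))\<^sup>2) \<le> err f" if "f \<in> H" for f N
    using sum_le_suminf[OF sums_summable[OF es[OF that]], of "{..<N}"] sums_unique[OF es[OF that]] by simp
  have pair: "ip f (\<Sum>l<N. cscale (a l) (dual n X l)) = (\<Sum>l<N. cnj (a l) * ip f (dual n X l))" if "f \<in> H" for f N a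
    using that dH by (subst sum_right) (auto intro!: in_scale simp: scale_right)
  show ?thesis unfolding l_iff
  proof (intro iffI allI ballI impI)
    fix N and a :: "nat \<Rightarrow> complex"
    assume *: "\<forall>f\<in>H. nsq f \<le> 1 \<longrightarrow> err f \<le> C"
    let ?u = "\<Sum>l<N. cscale (a l) (dual n X l)"
    have u: "?u \<in> H" using dH by (intro in_sum in_scale)
    show "nsq ?u \<le> C * (\<Sum>l<N. (cmod (a l))\<^sup>2)"
    proof (cases "nsq ?u = 0")
      case True
      show ?thesis unfolding True using C by (intro mult_nonneg_nonneg sum_nonneg) auto
    next
      case False
      then have pos: "nsq ?u > 0" using nonneg[OF u] by simp
      \<comment> \<open>The error bound is tested on the normalised combination itself;
        Cauchy-Schwarz for sums then separates the coefficients \<open>a l\<close>.\<close>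
      define t where "t = 1 / sqrt (nsq ?u)"
      let ?f = "cscale (complex_of_real t) ?u"
      have "t\<^sup>2 * nsq ?u = 1" using pos by (simp add: t_def power_divide)
      then have f: "?f \<in> H" "nsq ?f \<le> 1"
        using in_scale[OF u] unfolding expand_scale[OF u] norm_of_real power2_abs by simp_all
      have "nsq ?u * t = cmod (ip ?f ?u)"
      proof -
        have "ip ?f ?u = complex_of_real (t * nsq ?u)" using u self_real[OF u] by (simp add: scale_left)
        then have "cmod (ip ?f ?u) = \<bar>t * nsq ?u\<bar>" by (simp only: norm_of_real)
        moreover have "0 < t" using pos by (simp add: t_def)
        ultimately show ?thesis using mult_pos_pos[OF _ pos, of t] by (simp only: abs_of_pos mult.commute)
      qed
      then have "(nsq ?u * t)\<^sup>2 = (cmod (\<Sum>l<N. cnj (a l) * ip ?f (dual n X l)))\<^sup>2"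
        unfolding pair[OF f(1), symmetric] by simp
      also have "\<dots> \<le> (\<Sum>l<N. cmod (a l) * cmod (ip ?f (dual n X l)))\<^sup>2"
        by (intro power_mono order_trans[OF norm_sum]) (simp_all add: norm_mult)
      also have "\<dots> \<le> (\<Sum>l<N. (cmod (a l))\<^sup>2) * (\<Sum>l<N. (cmod (ip ?f (dual n X l)))\<^sup>2)"
        by (rule Cauchy_Schwarz_ineq_sum)
      also have "\<dots> \<le> (\<Sum>l<N. (cmod (a l))\<^sup>2) * C"
        using * f part[OF f(1), of N] by (intro mult_left_mono sum_nonneg) force+
      finally show ?thesis using pos by (simp add: t_def power_divide power_mult_distrib power2_eq_square mult.commute)
    qed
  next
    fix f
    assume *: "\<forall>N a. nsq (\<Sum>l<N. cscale (a l) (dual n X l)) \<le> C * (\<Sum>l<N. (cmod (a l))\<^sup>2)"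
      and f: "f \<in> H" "nsq f \<le> 1"
    have "(\<Sum>l<N. (cmod (ip f (dual n X l)))\<^sup>2) \<le> C" for N
    proof -
      \<comment> \<open>Choosing the coefficients of \<open>f\<close> as the sequence
        \<open>a\<close> makes \<open>ip f ?u\<close> equal to \<open>s\<close>, and Cauchy-Schwarz
        gives \<open>s * s \<le> C * s\<close>.\<close>
      define s where "s = (\<Sum>l<N. (cmod (ip f (dual n X l)))\<^sup>2)"
      let ?u = "\<Sum>l<N. cscale (ip f (dual n X l)) (dual n X l)"
      have u: "?u \<in> H" using dH by (intro in_sum in_scale)
      have "ip f ?u = complex_of_real s"
        unfolding pair[OF f(1)] s_def by (simp add: complex_norm_square mult.commute del: of_real_power)
      then have "s\<^sup>2 \<le> nsq f * nsq ?u" using Cauchy_Schwarz[OF f(1) u] by simp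
      also have "\<dots> \<le> 1 * nsq ?u" using f(2) nonneg[OF u] by (intro mult_right_mono) auto
      also have "\<dots> \<le> C * s" using * by (simp add: s_def)
      finally have "s * s \<le> C * s" by (simp add: power2_eq_square)
      moreover have "s \<ge> 0" unfolding s_def by (intro sum_nonneg) auto
      ultimately show ?thesis unfolding s_def[symmetric] using C by (cases "s = 0") (auto simp: mult_le_cancel_right)
    qed
    then show "err f \<le> C" using es[OF f(1)] unfolding sums_def by (intro LIMSEQ_le_const2) auto
  qed
qed

lemma measurable_coordinate: "j < n \<Longrightarrow> (\<lambda>X. X j) \<in> measurable (Q n) M"
proof -
  assume "j < n"
  then have "(\<lambda>X. X j) \<in> measurable (Q n) P" by (intro measurable_component_singleton) simp
  then show ?thesis by simp
qed

lemma measurable_yL_sample: "j < n \<Longrightarrow> (\<lambda>X. yL (X j) k) \<in> borel_measurable (Q n)"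
proof (rule measurable_compose[OF measurable_coordinate])
  show "(\<lambda>x. yL x k) \<in> borel_measurable M"
    using measurable_wt[OF measurable_H[OF eta_in, of "Suc k"]] by (simp add: yL_def)
qed

lemma measurable_gram:
  assumes "k < m - 1" "l < m - 1" shows "(\<lambda>X. gram_mat (L n X) $$ (k, l)) \<in> borel_measurable (Q n)"
proof -
  have "(\<lambda>X. gram_mat (L n X) $$ (k, l)) = (\<lambda>X. \<Sum>j<n. cnj (yL (X j) k) * yL (X j) l)"
    using assms by (simp add: gram_index[OF L_carrier] L_index fun_eq_iff del: index_mult_mat)
  then show ?thesis
    by (auto intro!: borel_measurable_sum borel_measurable_times borel_measurable_cnj measurable_yL_sample)
qed

lemma measurable_gram_det: "(\<lambda>X. det (gram_mat (L n X))) \<in> borel_measurable (Q n)"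
  by (rule measurable_det[OF gram_carrier[OF L_carrier] measurable_gram])

lemma measurable_coef:
  assumes j: "j < n" shows "(\<lambda>X. coef n X l j) \<in> borel_measurable (Q n)"
proof (cases "l < m - 1")
  case True
  have "wgt \<in> borel_measurable M"
  proof -
    note [measurable] = measurable_\<rho>
    have "(\<lambda>x. complex_of_real (sqrt (\<rho> x))) \<in> borel_measurable M" by measurable
    then show ?thesis unfolding wgt_def by measurable
  qed
  then have "(\<lambda>X. wgt (X j)) \<in> borel_measurable (Q n)"
    by (rule measurable_compose[OF measurable_coordinate[OF j]])
  moreover have "(\<lambda>X. pinv n X l j) \<in> borel_measurable (Q n)"
    unfolding pinv_def using True j measurable_gram_det
    by (intro borel_measurable_times borel_measurable_divide borel_measurable_const borel_measurable_sum borel_measurable_cnj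
        measurable_adj_mat[OF gram_carrier[OF L_carrier] measurable_gram] measurable_yL_sample) auto
  ultimately show ?thesis using True unfolding coef_def by (simp add: borel_measurable_cnj)
qed (simp add: coef_def)

text \<open>By the reproducing property the Gram entries are polynomials in the coefficients
  \<open>coef\<close>, their conjugates, and values of \<open>e\<close> and \<open>K\<close> at the
  nodes. Here the joint measurability of \<open>K\<close> enters.\<close>

lemma measurable_dual_gram: "(\<lambda>X. ip (dual n X l) (dual n X k)) \<in> borel_measurable (Q n)"
proof -
  have meas_e: "(\<lambda>X. e (Suc l) (X j)) \<in> borel_measurable (Q n)" if "j < n" for j l
    by (rule measurable_compose[OF measurable_coordinate[OF that] measurable_e]) simp
  have meas_K: "(\<lambda>X. K (X j) (X i)) \<in> borel_measurable (Q n)" if "i < n" "j < n" for i j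
    using measurable_compose[OF measurable_Pair[OF measurable_coordinate[OF that(2)] measurable_coordinate[OF that(1)]] measurable_K]
    by simp
  have "(\<lambda>X. complex_of_real (sg l) * complex_of_real (sg k) * ip (e (Suc l)) (e (Suc k))
      - (\<Sum>j<n. complex_of_real (sg l) * cnj (coef n X k j) * e (Suc l) (X j))
      - ((\<Sum>i<n. coef n X l i * complex_of_real (sg k) * cnj (e (Suc k) (X i)))
        - (\<Sum>i<n. \<Sum>j<n. coef n X l i * cnj (coef n X k j) * K (X j) (X i)))) \<in> borel_measurable (Q n)"
    by (intro borel_measurable_diff borel_measurable_sum borel_measurable_times borel_measurable_const borel_measurable_cnj
        measurable_coef meas_e meas_K) auto
  moreover have "ip (dual n X l) (dual n X k)
     = complex_of_real (sg l) * complex_of_real (sg k) * ip (e (Suc l)) (e (Suc k))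
      - (\<Sum>j<n. complex_of_real (sg l) * cnj (coef n X k j) * e (Suc l) (X j))
      - ((\<Sum>i<n. coef n X l i * complex_of_real (sg k) * cnj (e (Suc k) (X i)))
        - (\<Sum>i<n. \<Sum>j<n. coef n X l i * cnj (coef n X k j) * K (X j) (X i)))"
    if X: "X \<in> space (Q n)" for X
  proof -
    have D: "X j \<in> D" if "j < n" for j using Q_in_D[OF X that] .
    note kfX = kf_in[OF D]
    define s where "s l = cscale (complex_of_real (sg l)) (e (Suc l))" for l
    define t where "t l = (\<Sum>j<n. cscale (coef n X l j) (kf (X j)))" for l
    have s: "s l \<in> H" for l unfolding s_def by (intro in_scale e_in) simp
    have t: "t l \<in> H" for l unfolding t_def by (intro in_sum in_scale kfX) simp
    have t_right: "ip h (t l) = (\<Sum>j<n. cnj (coef n X l j) * h (X j))" if h: "h \<in> H" for h l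
    proof -
      have "ip h (t l) = (\<Sum>j<n. ip h (cscale (coef n X l j) (kf (X j))))"
        unfolding t_def using h kfX by (intro sum_right in_scale) auto
      also have "\<dots> = (\<Sum>j<n. cnj (coef n X l j) * h (X j))"
        using h kfX D by (intro sum.cong refl) (simp add: scale_right eval_ip)
      finally show ?thesis .
    qed
    have t_left: "ip (t l) h = (\<Sum>j<n. coef n X l j * cnj (h (X j)))" if h: "h \<in> H" for h l
      using ip_cnj[OF h t, of l] t_right[OF h, of l] by simp
    have "t l (X j) = (\<Sum>i<n. coef n X l i * K (X j) (X i))" if "j < n" for j l
    proof -
      have "t l (X j) = ip (t l) (kf (X j))" using eval_ip[OF t D[OF that]] .
      also have "\<dots> = (\<Sum>i<n. coef n X l i * cnj (kf (X j) (X i)))" by (rule t_left[OF kfX[OF that]])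
      also have "\<dots> = (\<Sum>i<n. coef n X l i * K (X j) (X i))"
      proof (intro sum.cong refl)
        fix i assume "i \<in> {..<n}"
        then have i: "i < n" by simp
        have "cnj (kf (X j) (X i)) = K (X j) (X i)"
          using eval_ip[OF kfX[OF that] D[OF i]] K_ip[OF D[OF that] D[OF i]] ip_cnj[OF kfX[OF that] kfX[OF i]] by simp
        then show "coef n X l i * cnj (kf (X j) (X i)) = coef n X l i * K (X j) (X i)" by simp
      qed
      finally show ?thesis .
    qed
    then have "ip (t l) (t k) = (\<Sum>j<n. cnj (coef n X k j) * (\<Sum>i<n. coef n X l i * K (X j) (X i)))"
      unfolding t_right[OF t] by (intro sum.cong) auto
    also have "\<dots> = (\<Sum>j<n. \<Sum>i<n. coef n X l i * cnj (coef n X k j) * K (X j) (X i))"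
      by (simp add: sum_distrib_left mult_ac)
    also have "\<dots> = (\<Sum>i<n. \<Sum>j<n. coef n X l i * cnj (coef n X k j) * K (X j) (X i))" by (rule sum.swap)
    finally have tt: "ip (t l) (t k) = \<dots>" .
    have "ip (dual n X l) (dual n X k) = ip (s l) (s k) - ip (s l) (t k) - (ip (t l) (s k) - ip (t l) (t k))"
      unfolding dual_def s_def[symmetric] t_def[symmetric] using s t by (simp add: diff_left diff_right in_diff)
    also have "ip (s l) (s k) = complex_of_real (sg l) * complex_of_real (sg k) * ip (e (Suc l)) (e (Suc k))"
      unfolding s_def using e_in by (simp add: scale_left scale_right in_scale)
    also have "ip (s l) (t k) = (\<Sum>j<n. complex_of_real (sg l) * cnj (coef n X k j) * e (Suc l) (X j))"
      unfolding t_right[OF s] by (simp add: s_def cscale_def mult_ac)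
    also have "ip (t l) (s k) = (\<Sum>i<n. coef n X l i * complex_of_real (sg k) * cnj (e (Suc k) (X i)))"
      unfolding t_left[OF s] by (simp add: s_def cscale_def mult_ac)
    finally show ?thesis unfolding tt .
  qed
  ultimately show ?thesis by (subst measurable_cong) auto
qed

lemma nsq_dual:
  fixes N :: nat and a :: "nat \<Rightarrow> complex"
  assumes X: "X \<in> space (Q n)"
  shows "nsq (\<Sum>l<N. cscale (a l) (dual n X l)) = (\<Sum>l<N. \<Sum>k<N. Re (a l * cnj (a k) * ip (dual n X l) (dual n X k)))"
proof -
  note dH = dual_in[OF X]
  have "ip (\<Sum>l<N. cscale (a l) (dual n X l)) (\<Sum>k<N. cscale (a k) (dual n X k))
      = (\<Sum>l<N. ip (cscale (a l) (dual n X l)) (\<Sum>k<N. cscale (a k) (dual n X k)))"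
    using dH by (intro sum_left in_scale in_sum) auto
  also have "\<dots> = (\<Sum>l<N. \<Sum>k<N. ip (cscale (a l) (dual n X l)) (cscale (a k) (dual n X k)))"
    using dH by (intro sum.cong refl sum_right in_scale) auto
  also have "\<dots> = (\<Sum>l<N. \<Sum>k<N. a l * cnj (a k) * ip (dual n X l) (dual n X k))"
    using dH by (simp add: scale_left scale_right in_scale mult_ac)
  finally show ?thesis by (simp add: Re_sum)
qed

text \<open>The supremum runs over the unit ball of a possibly non-separable space. By duality it is
  controlled by quadratic forms on finitely supported sequences, and by continuity a countable dense
  set of sequences suffices.\<close>

lemma error_event_measurable:
  assumes C: "0 \<le> C"
  shows "{X \<in> space (Q n). lsq_full_rank \<rho> (eta lam e) m n X \<and>
     (SUP f \<in> {f \<in> H. hnorm ip f \<le> 1}. L2_norm_sq M (f - lsq_operator \<rho> (eta lam e) m n X f)) \<le> ennreal C} \<in> sets (Q n)"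
proof -
  \<comment> \<open>Density is meant in the product topology on sequences; each form involves only
    the first \<open>N\<close> coordinates and is continuous there.\<close>
  obtain Dn :: "(nat \<Rightarrow> complex) set" where Dn: "countable Dn" "\<And>S. open S \<Longrightarrow> S \<noteq> {} \<Longrightarrow> \<exists>d\<in>Dn. d \<in> S"
    using countable_dense_exists[where 'a = "nat \<Rightarrow> complex"] by blast
  define \<Phi> where "\<Phi> N a X = (\<Sum>l<N. \<Sum>k<N. Re (a l * cnj (a k) * ip (dual n X l) (dual n X k))) - C * (\<Sum>l<N. (cmod (a l))\<^sup>2)"
    for N :: nat and a X
  have cont: "continuous_on UNIV (\<lambda>a. \<Phi> N a X)" for N X
    unfolding \<Phi>_def by (intro continuous_intros continuous_on_product_coordinates)
  have dense: "(\<forall>a. \<Phi> N a X \<le> 0) \<longleftrightarrow> (\<forall>a\<in>Dn. \<Phi> N a X \<le> 0)" for N X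
  proof
    assume *: "\<forall>a\<in>Dn. \<Phi> N a X \<le> 0"
    show "\<forall>a. \<Phi> N a X \<le> 0"
    proof (rule ccontr)
      assume "\<not> ?thesis"
      then have ne: "{a. 0 < \<Phi> N a X} \<noteq> {}" by (auto simp: not_le)
      have "open {a. 0 < \<Phi> N a X}" by (intro open_Collect_less continuous_on_const cont)
      from Dn(2)[OF this ne] * show False by force
    qed
  qed blast
  have meas: "(\<lambda>X. \<Phi> N a X) \<in> borel_measurable (Q n)" for N a
    unfolding \<Phi>_def
    by (intro borel_measurable_diff borel_measurable_const borel_measurable_sum
        measurable_compose[OF _ borel_measurable_Re] borel_measurable_times measurable_dual_gram)
  have "{X \<in> space (Q n). lsq_full_rank \<rho> (eta lam e) m n X \<and>
     (SUP f \<in> {f \<in> H. hnorm ip f \<le> 1}. L2_norm_sq M (f - lsq_operator \<rho> (eta lam e) m n X f)) \<le> ennreal C}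
    = {X \<in> space (Q n). det (gram_mat (L n X)) \<noteq> 0 \<and> (\<forall>N. \<forall>a\<in>Dn. \<Phi> N a X \<le> 0)}"
  proof (intro Collect_cong conj_cong refl)
    fix X assume X: "X \<in> space (Q n)"
    show "lsq_full_rank \<rho> (eta lam e) m n X \<longleftrightarrow> det (gram_mat (L n X)) \<noteq> 0"
      unfolding lsq_full_rank_def by (rule full_column_rank_iff[OF L_carrier])
    assume det: "det (gram_mat (L n X)) \<noteq> 0"
    show "(SUP f \<in> {f \<in> H. hnorm ip f \<le> 1}. L2_norm_sq M (f - lsq_operator \<rho> (eta lam e) m n X f)) \<le> ennreal C
      \<longleftrightarrow> (\<forall>N. \<forall>a\<in>Dn. \<Phi> N a X \<le> 0)"
      unfolding error_bound_iff[OF det X C] dense[symmetric] by (simp add: nsq_dual[OF X] \<Phi>_def)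
  qed
  also have "\<dots> \<in> sets (Q n)"
  proof -
    have "(\<Inter>N. \<Inter>a\<in>Dn. {X \<in> space (Q n). \<Phi> N a X \<le> 0}) \<inter> space (Q n) \<in> sets (Q n)"
    proof (cases "Dn = {}")
      case False
      have "{X \<in> space (Q n). \<Phi> N a X \<le> 0} \<in> sets (Q n)" for N a using meas by measurable
      then have "(\<Inter>a\<in>Dn. {X \<in> space (Q n). \<Phi> N a X \<le> 0}) \<in> sets (Q n)" for N
        using False Dn(1) by (intro sets.countable_INT') auto
      then show ?thesis by (intro sets.Int sets.top sets.countable_INT) auto
    qed simp
    moreover have "{X \<in> space (Q n). det (gram_mat (L n X)) \<noteq> 0} \<in> sets (Q n)"
      using measurable_gram_det by measurable
    ultimately have "{X \<in> space (Q n). det (gram_mat (L n X)) \<noteq> 0} \<inter>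
       ((\<Inter>N. \<Inter>a\<in>Dn. {X \<in> space (Q n). \<Phi> N a X \<le> 0}) \<inter> space (Q n)) \<in> sets (Q n)" by (rule sets.Int[rotated])
    also have "{X \<in> space (Q n). det (gram_mat (L n X)) \<noteq> 0} \<inter>
       ((\<Inter>N. \<Inter>a\<in>Dn. {X \<in> space (Q n). \<Phi> N a X \<le> 0}) \<inter> space (Q n))
      = {X \<in> space (Q n). det (gram_mat (L n X)) \<noteq> 0 \<and> (\<forall>N. \<forall>a\<in>Dn. \<Phi> N a X \<le> 0)}" by auto
    finally show ?thesis .
  qed
  finally show ?thesis .
qed

lemma bound_nonneg: "0 \<le> bound n r"
  unfolding bound_def using lam_nonneg[OF m] by (simp add: le_max_iff_disj)

lemma error_probability:
  assumes r: "r > 1" and n: "n \<ge> 3" and mn: "real m * (14 * r * ln (real n)) \<le> real n"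
  shows "measure (Q n) {X \<in> space (Q n). lsq_full_rank \<rho> (eta lam e) m n X \<and>
     (SUP f \<in> {f \<in> H. hnorm ip f \<le> 1}. L2_norm_sq M (f - lsq_operator \<rho> (eta lam e) m n X f)) \<le> ennreal (441 * bound n r)}
    \<ge> 1 - (2 powr (3/4) + 1) * real n powr (1 - r)" (is "measure _ ?E \<ge> _")
proof -
  interpret Qn: prob_space "Q n" by (rule prob_space_Q)
  have E: "?E \<in> sets (Q n)" using bound_nonneg[of n r] by (intro error_event_measurable) simp
  obtain G where G: "G \<in> sets (Q n)" "measure (Q n) G \<ge> 1 - 13 / 9 * real n powr (1 - r)" "\<And>X. X \<in> G \<Longrightarrow> good n r X"
    using good_event[OF assms] by metis
  have sub: "G \<subseteq> ?E"
  proof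
    fix X assume XG: "X \<in> G"
    then have X: "X \<in> space (Q n)" using sets.sets_into_space[OF G(1)] by blast
    note good = G(3)[OF XG]
    have "lsq_full_rank \<rho> (eta lam e) m n X"
      unfolding lsq_full_rank_def full_column_rank_iff[OF L_carrier] using good_det[OF good] n by simp
    moreover have "(SUP f \<in> {f \<in> H. hnorm ip f \<le> 1}. L2_norm_sq M (f - lsq_operator \<rho> (eta lam e) m n X f)) \<le> ennreal (441 * bound n r)"
      by (rule SUP_least, rule good_error[OF good X]) (use n in \<open>auto simp: hnorm_def\<close>)
    ultimately show "X \<in> ?E" using X by simp
  qed
  \<comment> \<open>It suffices that \<open>13/9 \<le> 2\<close>.\<close>
  have "1 \<le> (2::real) powr (3/4)" by (rule ge_one_powr_ge_zero) auto
  then have "13 / 9 * real n powr (1 - r) \<le> (2 powr (3/4) + 1) * real n powr (1 - r)"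
    by (intro mult_right_mono) auto
  moreover have "measure (Q n) G \<le> measure (Q n) ?E" using sub E by (rule Qn.finite_measure_mono)
  ultimately show ?thesis using G(2) by linarith
qed

end

theorem theorem1p2:
  fixes D :: "(real ^ 'd) set"
    and H :: "(real ^ 'd \<Rightarrow> complex) set"
    and ip :: "(real ^ 'd \<Rightarrow> complex) \<Rightarrow> (real ^ 'd \<Rightarrow> complex) \<Rightarrow> complex"
    and K :: "real ^ 'd \<Rightarrow> real ^ 'd \<Rightarrow> complex"
    and M :: "(real ^ 'd) measure"
    and lam :: "nat \<Rightarrow> real"
    and e :: "nat \<Rightarrow> real ^ 'd \<Rightarrow> complex"
    and r :: real
    and m n :: nat
    and \<rho> :: "real ^ 'd \<Rightarrow> real"
  assumes "rkhs D H ip K"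
    and "positive_definite_hermitian_kernel D K"
    and "infinite_dimensional H"
    and "space M = D"
    and "(\<lambda>(x, y). K x y) \<in> borel_measurable (M \<Otimes>\<^sub>M M)"
    and "integrable M (\<lambda>x. Re (K x x))"
    and "kernel_trace M K > 0"
    and "eigensystem M H ip lam e"
    and "r > 1"
    and "n \<ge> 3"
    and "m = nat \<lfloor>real n / (14 * r * ln (real n))\<rfloor>"
    and "m \<ge> 1"
    and "\<forall>k\<in>{1..<m}. lam k > 0"
    and "\<rho> = sampling_density M lam K e m"
  shows "measure (node_distribution M \<rho> n)
      {X \<in> space (node_distribution M \<rho> n).
         lsq_full_rank \<rho> (eta lam e) m n X \<and>
         (SUP f \<in> {f \<in> H. hnorm ip f \<le> 1}.
            L2_norm_sq M (f - lsq_operator \<rho> (eta lam e) m n X f))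
         \<le> ennreal (441 * Max {(singular_number lam m)\<^sup>2,
              r * ln (real n) / real n * (\<Sum>\<^sub>\<infinity>j\<in>{m..}. (singular_number lam j)\<^sup>2),
              tr0 M K e / real n})}
    \<ge> 1 - (2 powr (3/4) + 1) * real n powr (1 - r)"
proof -
  interpret S: rkhs_sampling D H ip K M lam e m
    by (intro rkhs_sampling.intro rkhs_embedding.intro rkhs_embedding_axioms.intro rkhs_sampling_axioms.intro)
      (use assms in auto)
  have \<rho>: "\<rho> = S.\<rho>" using assms(14) by (simp add: S.\<rho>_def)
  have nd: "node_distribution M S.\<rho> n = S.Q n" by (simp add: node_distribution_def)
  have l: "ln (real n) > 0" using assms(10) by simp
  have mn: "real m * (14 * r * ln (real n)) \<le> real n"
  proof -
    have pos: "14 * r * ln (real n) > 0" using assms(9) l by simp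
    have "0 \<le> real n / (14 * r * ln (real n))" using pos by (intro divide_nonneg_pos) auto
    then have "real m \<le> real n / (14 * r * ln (real n))" unfolding assms(11) by (simp add: of_nat_nat)
    then show ?thesis using pos by (simp add: pos_le_divide_eq)
  qed
  \<comment> \<open>\<open>eigensystem\<close> does not constrain the index 0, hence the restriction
    to \<open>j \<ge> m\<close>, where \<open>m \<ge> 1\<close>.\<close>
  have s: "(singular_number lam j)\<^sup>2 = lam j" if "j \<ge> m" for j
    using S.lam_nonneg[of j] that assms(12) by (simp add: singular_number_def)
  have "(\<Sum>\<^sub>\<infinity>j\<in>{m..}. (singular_number lam j)\<^sup>2) = (\<Sum>\<^sub>\<infinity>j\<in>{m..}. lam j)"
    by (intro infsum_cong s) simp
  also have "\<dots> = S.T" using S.infsum_lam[OF assms(12)] by (simp add: S.T_def)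
  finally have b: "Max {(singular_number lam m)\<^sup>2,
              r * ln (real n) / real n * (\<Sum>\<^sub>\<infinity>j\<in>{m..}. (singular_number lam j)\<^sup>2),
              tr0 M K e / real n} = S.bound n r"
    by (simp add: S.bound_def s)
  show ?thesis unfolding b \<rho> nd by (rule S.error_probability[OF assms(9,10) mn])
qed

end
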